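(* Let $\Lambda(\Omega)\subset\mathbb{R}^m$ be a simple generic model set with $\Omega$ symmetric around the origin, let $A\in GL_m(\mathbb{R})$, and let $g_l,h_l\in W(L^2,\ell^1)$ for $l=1,\dots,L$. Write $\mathcal{G}(g,\Lambda(\Omega),A\mathbb{Z}^m)=\{T_\lambda M_{An} g_l: l=1,\dots,L,\ \lambda\in\Lambda(\Omega),\ n\in\mathbb{Z}^m\}$ and similarly $\mathcal{G}(h,\Lambda(\Omega),A\mathbb{Z}^m)$, and assume that both are Bessel sequences for $L^2(\mathbb{R}^m)$. Then $\mathcal{G}(h,\Lambda(\Omega),A\mathbb{Z}^m)$ is a dual system to $\mathcal{G}(g,\Lambda(\Omega),A\mathbb{Z}^m)$ if and only if $$D(\Lambda(\Omega))\,|\det A|^{-1}\,\Phi(-p_2^*(\eta))\sum_{l=1}^L\big\langle T_{A^I v}M_{p_1^*(\eta)}h_l,\,g_l\big\rangle=\delta_{\eta,0}\,\delta_{v,0}$$ for each $\eta\in\Gamma^*$ and each $v\in\mathbb{Z}^m$, where $A^I=(A^T)^{-1}$ and $\delta$ is the Kronecker delta.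
   Context: Notation: $T_\lambda f(t)=f(t-\lambda)$, $M_\beta f(t)=e^{2\pi i\beta\cdot t}f(t)$; $\widehat f(\omega)=\int_{\mathbb{R}^m} f(t)e^{-2\pi i t\cdot\omega}\,dt$. $W(L^p,\ell^q)$ is the space of measurable functions $f$ on $\mathbb{R}^m$ with $\|f\|_{p,q}=\big(\sum_{k\in\mathbb{Z}^m}\|f\mathbf{1}_{k+[0,1]^m}\|_p^q\big)^{1/q}<\infty$. A family $\{e_j\}$ is a Bessel sequence if for some $B<\infty$, $\sum_j|\langle f,e_j\rangle|^2\le B\|f\|_2^2$ for all $f\in L^2(\mathbb{R}^m)$. For Bessel sequences, $\mathcal{G}(h,\Lambda(\Omega),A\mathbb{Z}^m)$ is a dual system to $\mathcal{G}(g,\Lambda(\Omega),A\mathbb{Z}^m)$ if $f=\sum_{l}\sum_{\lambda\in\Lambda(\Omega)}\sum_{n\in\mathbb{Z}^m}\langle f,T_\lambda M_{An} g_l\rangle T_\lambda M_{An} h_l$ for all $f\in L^2(\mathbb{R}^m)$. Model sets: let $\Gamma\subset\mathbb{R}^m\times\mathbb{R}$ be a lattice and $p_1:\mathbb{R}^m\times\mathbb{R}\to\mathbb{R}^m$, $p_2:\mathbb{R}^m\times\mathbb{R}\to\mathbb{R}$ the orthogonal projections; assume $p_1|_\Gamma$ and $p_2|_\Gamma$ are injective with dense images. $\Gamma^*=\{y:\gamma\cdot y\in\mathbb{Z}\ \forall\gamma\in\Gamma\}$ is the dual lattice and $p_1^*,p_2^*$ are the same projections used on $\Gamma^*$ (also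 injective on $\Gamma^*$ with dense images). For a compact interval $\Omega\subset\mathbb{R}$ with non-empty interior, $\Lambda(\Omega)=\{p_1(\gamma):\gamma\in\Gamma,\ p_2(\gamma)\in\Omega\}$ is a simple model set; it is generic if $p_2(\Gamma)\cap\partial\Omega=\emptyset$. Standing assumption: also $p_2^*(\Gamma^* )\cap\partial\Omega=\emptyset$. Its density is $D(\Lambda(\Omega))=\lim_{R\to\infty}\#(\Lambda(\Omega)\cap(x+R[0,1]^m))/R^m=|\Omega|/\mathrm{vol}(\Gamma)$. The function $\Phi$: fix $0<\epsilon<1$, put $\Omega_n=(1-\epsilon^n)\Omega$ and let $\psi_n$ be the infinite convolution product over $s=0,1,2,\dots$ of the functions $\mathbf{1}_{\epsilon^{ns}\Omega_n}/|\epsilon^{ns}\Omega_n|$ (convergent in $L^1(\mathbb{R})$), so that $\widehat{\psi_n}(t)=\prod_{s=0}^\infty\mathrm{sinc}(t|\epsilon^{ns}\Omega_n|)$ with $\mathrm{sinc}(t)=\sin(\pi t)/(\pi t)$. Let $\Psi$ be the uniform limit of $\widehat{\psi_n}$ as $n\to\infty$ (namely $\Psi(t)=\mathrm{sinc}(|\Omega|t)$, the Fourier transform of $\mathbf{1}_\Omega/|\Omega|$), and set $\Phi=|\Omega|\cdot(\Psi*\Psi)$. Then $\Phi(0)=1$. *)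

theory Defs
  imports "HOL-Analysis.Analysis"
begin

section \<open>Function spaces and time-frequency shifts\<close>

text \<open>
  Elements of the function spaces are classes modulo null sets; they are represented by Borel
  functions, and all integrals are taken with respect to \<^const>\<open>lborel\<close>.
\<close>

definition Lp :: "real \<Rightarrow> ('a::euclidean_space \<Rightarrow> complex) set" where
  "Lp p = {f \<in> borel_measurable lborel. integrable lborel (\<lambda>t. norm (f t) powr p)}"

definition Lp_norm :: "real \<Rightarrow> ('a::euclidean_space \<Rightarrow> complex) \<Rightarrow> real" where
  "Lp_norm p f = (\<integral>t. norm (f t) powr p \<partial>lborel) powr (1 / p)"

definition L2_inner :: "('a::euclidean_space \<Rightarrow> complex) \<Rightarrow> ('a \<Rightarrow> complex) \<Rightarrow> complex" where
  "L2_inner f g = (\<integral>t. f t * cnj (g t) \<partial>lborel)"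

definition fourier :: "('a::euclidean_space \<Rightarrow> complex) \<Rightarrow> 'a \<Rightarrow> complex" where
  "fourier f \<omega> = (\<integral>t. f t * cis (- (2 * pi * (t \<bullet> \<omega>))) \<partial>lborel)"

definition convol :: "('a::euclidean_space \<Rightarrow> complex) \<Rightarrow> ('a \<Rightarrow> complex) \<Rightarrow> 'a \<Rightarrow> complex" where
  "convol f g t = (\<integral>s. f s * g (t - s) \<partial>lborel)"

definition translate :: "'a::euclidean_space \<Rightarrow> ('a \<Rightarrow> complex) \<Rightarrow> 'a \<Rightarrow> complex" where
  "translate \<tau> f t = f (t - \<tau>)"

definition modulate :: "'a::euclidean_space \<Rightarrow> ('a \<Rightarrow> complex) \<Rightarrow> 'a \<Rightarrow> complex" where
  "modulate \<beta> f t = cis (2 * pi * (\<beta> \<bullet> t)) * f t"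

definition int_vecs :: "(real ^ 'm) set" where
  "int_vecs = {k. \<forall>i. k $ i \<in> \<int>}"

definition cell_restrict :: "real ^ 'm \<Rightarrow> (real ^ 'm \<Rightarrow> complex) \<Rightarrow> real ^ 'm \<Rightarrow> complex" where
  "cell_restrict k f t = f t * indicator ((+) k ` cbox 0 (\<chi> i. 1)) t"

text \<open>The amalgam space \<open>W(L\<^sup>p, \<ell>\<^sup>q)\<close>, for finite exponents.\<close>

definition amalgam :: "real \<Rightarrow> real \<Rightarrow> (real ^ 'm \<Rightarrow> complex) set" where
  "amalgam p q =
     {f \<in> borel_measurable lborel.
        (\<forall>k\<in>int_vecs. cell_restrict k f \<in> Lp p) \<and>
        (\<lambda>k. Lp_norm p (cell_restrict k f) powr q) summable_on int_vecs}"

definition bessel_sequence :: "'i set \<Rightarrow> ('i \<Rightarrow> 'a::euclidean_space \<Rightarrow> complex) \<Rightarrow> bool" where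
  "bessel_sequence J e \<longleftrightarrow>
     (\<exists>B. \<forall>f\<in>Lp 2.
        (\<lambda>j. (norm (L2_inner f (e j)))\<^sup>2) summable_on J \<and>
        (\<Sum>\<^sub>\<infinity>j\<in>J. (norm (L2_inner f (e j)))\<^sup>2) \<le> B * (Lp_norm 2 f)\<^sup>2)"

text \<open>
  The expansion \<open>f = \<Sum>j. \<langle>f, e j\<rangle> d j\<close> is understood as (unconditional) convergence in \<open>L\<^sup>2\<close>.
  For Bessel sequences the series always converges unconditionally, so every order
  of summation gives the same meaning.
\<close>

definition dual_system ::
  "'i set \<Rightarrow> ('i \<Rightarrow> 'a::euclidean_space \<Rightarrow> complex) \<Rightarrow> ('i \<Rightarrow> 'a \<Rightarrow> complex) \<Rightarrow> bool" where
  "dual_system J d e \<longleftrightarrow>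
     (\<forall>f\<in>Lp 2.
        ((\<lambda>F. Lp_norm 2 (\<lambda>t. f t - (\<Sum>j\<in>F. L2_inner f (e j) * d j t))) \<longlongrightarrow> 0)
          (finite_subsets_at_top J))"

definition gabor ::
  "(nat \<Rightarrow> real ^ 'm \<Rightarrow> complex) \<Rightarrow> real ^ 'm ^ 'm \<Rightarrow> nat \<times> (real ^ 'm) \<times> (real ^ 'm)
     \<Rightarrow> real ^ 'm \<Rightarrow> complex" where
  "gabor g A = (\<lambda>(l, \<tau>, n). translate \<tau> (modulate (A *v n) (g l)))"

definition gabor_index ::
  "nat \<Rightarrow> (real ^ 'm) set \<Rightarrow> (nat \<times> (real ^ 'm) \<times> (real ^ 'm)) set" where
  "gabor_index L \<Lambda> = {1..L} \<times> \<Lambda> \<times> int_vecs"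


section \<open>Lattices and model sets\<close>

definition is_lattice :: "'a::euclidean_space set \<Rightarrow> bool" where
  "is_lattice \<Gamma> \<longleftrightarrow>
     (\<exists>B. independent B \<and> span B = UNIV \<and>
          \<Gamma> = range (\<lambda>c :: 'a \<Rightarrow> int. \<Sum>b\<in>B. of_int (c b) *\<^sub>R b))"

definition dual_lattice :: "'a::euclidean_space set \<Rightarrow> 'a set" where
  "dual_lattice \<Gamma> = {y. \<forall>\<gamma>\<in>\<Gamma>. \<gamma> \<bullet> y \<in> \<int>}"

definition model_set :: "((real ^ 'm) \<times> real) set \<Rightarrow> real set \<Rightarrow> (real ^ 'm) set" where
  "model_set \<Gamma> \<Omega> = {fst \<gamma> | \<gamma>. \<gamma> \<in> \<Gamma> \<and> snd \<gamma> \<in> \<Omega>}"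

definition point_density :: "(real ^ 'm) set \<Rightarrow> real" where
  "point_density \<Lambda> =
     (THE d. \<forall>x. ((\<lambda>R. real (card (\<Lambda> \<inter> (\<lambda>u. x + R *\<^sub>R u) ` cbox 0 (\<chi> i. 1))) / R ^ CARD('m))
                    \<longlongrightarrow> d) at_top)"


section \<open>The function \<open>\<Phi>\<close>\<close>

definition normalized_indicator :: "real set \<Rightarrow> real \<Rightarrow> complex" where
  "normalized_indicator S t = of_real (indicator S t / measure lborel S)"

text \<open>
  \<open>psi_factor \<Omega> \<epsilon> n s\<close> is the normalized indicator of \<open>\<epsilon>\<^bsup>ns\<^esup> \<Omega>\<^sub>n\<close> with \<open>\<Omega>\<^sub>n = (1 - \<epsilon>\<^sup>n) \<Omega>\<close>.
  For \<open>n = 0\<close> this is a junk value (the set is a null set), which does not affect the limit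
  \<open>n \<rightarrow> \<infinity>\<close> below.
\<close>

definition psi_factor :: "real set \<Rightarrow> real \<Rightarrow> nat \<Rightarrow> nat \<Rightarrow> real \<Rightarrow> complex" where
  "psi_factor \<Omega> \<epsilon> n s =
     normalized_indicator ((*) (\<epsilon> ^ (n * s)) ` (*) (1 - \<epsilon> ^ n) ` \<Omega>)"

primrec psi_partial :: "real set \<Rightarrow> real \<Rightarrow> nat \<Rightarrow> nat \<Rightarrow> real \<Rightarrow> complex" where
  "psi_partial \<Omega> \<epsilon> n 0 = psi_factor \<Omega> \<epsilon> n 0"
| "psi_partial \<Omega> \<epsilon> n (Suc N) = convol (psi_partial \<Omega> \<epsilon> n N) (psi_factor \<Omega> \<epsilon> n (Suc N))"

text \<open>
  The infinite convolution product is the \<open>L\<^sup>1\<close>-limit of the partial products. It is determined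
  only almost everywhere, so a representative is chosen; its Fourier transform does not depend
  on the choice.
\<close>

definition psi :: "real set \<Rightarrow> real \<Rightarrow> nat \<Rightarrow> real \<Rightarrow> complex" where
  "psi \<Omega> \<epsilon> n =
     (SOME f. integrable lborel f \<and>
        (\<lambda>N. \<integral>t. norm (psi_partial \<Omega> \<epsilon> n N t - f t) \<partial>lborel) \<longlonglongrightarrow> 0)"

definition Psi :: "real set \<Rightarrow> real \<Rightarrow> real \<Rightarrow> complex" where
  "Psi \<Omega> \<epsilon> = (THE F. uniform_limit UNIV (\<lambda>n. fourier (psi \<Omega> \<epsilon> n)) F sequentially)"

definition Phi :: "real set \<Rightarrow> real \<Rightarrow> real \<Rightarrow> complex" where
  "Phi \<Omega> \<epsilon> t = of_real (measure lborel \<Omega>) * convol (Psi \<Omega> \<epsilon>) (Psi \<Omega> \<epsilon>) t"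

end

theory Submission
  imports Defs
begin

text \<open>
  For Bessel sequences, duality is equivalent to \<open>\<Sum>j. \<langle>f, g\<^sub>j\<rangle> \<langle>h\<^sub>j, f'\<rangle> = \<langle>f, f'\<rangle>\<close> for bounded \<open>f\<close>, \<open>f'\<close>
  supported in tiles of the lattice \<open>A\<^sup>I \<int>\<^sup>m\<close>. For such functions Parseval's identity evaluates the sum over
  the modulations, and duality becomes: for every \<open>v \<in> A\<^sup>I \<int>\<^sup>m\<close>, the sum over \<open>\<tau> \<in> \<Lambda>(\<Omega>)\<close> of the translates
  by \<open>\<tau>\<close> of \<open>G\<^sub>v(s) = \<Sum>l. cnj (g\<^sub>l(s)) h\<^sub>l(s + v)\<close> is almost everywhere equal to \<open>\<delta>\<^bsub>v,0\<^esub> \<bar>det A\<bar>\<close>.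

  This sum is the slice at height \<open>0\<close> of the \<open>\<Gamma>\<close>-periodization of \<open>G\<^sub>v \<otimes> 1\<^sub>\<Omega>\<close>. By periodicity, a constant
  slice at height \<open>0\<close> gives the same constant at the dense set of heights \<open>p\<^sub>2(\<Gamma>)\<close>, and the slices depend
  continuously on the height (in \<open>L\<^sup>1\<close> on bounded sets) off \<open>p\<^sub>2(\<Gamma>) + \<partial>\<Omega>\<close>, a null set which does not contain \<open>0\<close>
  by genericity. So the slice is constant if and only if the whole periodization is, that is, if and only
  if its Fourier coefficients at all \<open>\<eta> \<in> \<Gamma>\<^sup>*\<close> with \<open>\<eta> \<noteq> 0\<close> vanish and the one at \<open>0\<close> has the right value. Up to
  phases and a constant, these coefficients are the left-hand sides of the stated relations, because \<open>\<Phi>\<close> is the Fourier transform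
  of the normalized indicator of \<open>\<Omega>\<close>.
\<close>

section \<open>Square-integrable functions\<close>

text \<open>The tiles are cells of the lattice \<open>A^I Z^m\<close> because its dual lattice is
  \<open>A Z^m\<close>: on one tile the modulations by \<open>A *v n\<close> are exactly the
  characters of a torus. Boundedness of \<open>f\<close> keeps its product with \<open>cnj g\<close>
  square-integrable, as Parseval's identity demands, and a pair of tiles at \<open>w\<close> and
  \<open>w'\<close> sees only the shift \<open>v = w' - w\<close>, so the relations for different
  \<open>v\<close> decouple.

  The functions \<open>G_v\<close> are products of square-integrable functions and hence merely
  integrable. Uniqueness of Fourier coefficients is therefore established for integrable functions,
  and Parseval's identity is derived from it. A single slice is a null set for the periodization, so
  its Fourier coefficients alone cannot control the slice; convergence has to be known at each fixed
  height.

  The constant arises as follows: the density is \<open>2 * a / covol\<close> and \<Phi> is the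
  transform of the indicator of \<Omega> divided by \<open>2 * a\<close>. The length of the window
  cancels, and \<open>1 / (covol * \<bar>det A\<bar>)\<close> remains.\<close>

lemma Lp_2_iff:
  "f \<in> Lp 2 \<longleftrightarrow> f \<in> borel_measurable borel \<and> integrable lborel (\<lambda>t. (norm (f t))\<^sup>2)"
  by (simp add: Lp_def)

lemma Lp_norm_2: "Lp_norm 2 f = sqrt (\<integral>t. (norm (f t))\<^sup>2 \<partial>lborel)"
  by (simp add: Lp_norm_def powr_half_sqrt)

lemma Lp_norm_2_nonneg [simp]: "0 \<le> Lp_norm 2 f"
  by (simp add: Lp_norm_2)

lemma Lp_norm_2_sq: "(Lp_norm 2 f)\<^sup>2 = (\<integral>t. (norm (f t))\<^sup>2 \<partial>lborel)"
  by (simp add: Lp_norm_2)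

lemma Lp_2_bound:
  assumes "f \<in> Lp 2" "h \<in> borel_measurable borel" "\<And>t. norm (h t) \<le> norm (f t)"
  shows "h \<in> Lp 2"
  unfolding Lp_2_iff
proof (intro conjI assms(2))
  show "integrable lborel (\<lambda>t. (norm (h t))\<^sup>2)"
  proof (rule Bochner_Integration.integrable_bound)
    show "integrable lborel (\<lambda>t. (norm (f t))\<^sup>2)" using assms(1) by (simp add: Lp_2_iff)
    show "AE t in lborel. norm ((norm (h t))\<^sup>2) \<le> norm ((norm (f t))\<^sup>2)"
      using assms(3) by (auto intro!: power_mono)
  qed (use assms(2) in measurable)
qed

lemma Lp_2_mult_integrable_norm:
  assumes "f \<in> Lp 2" "g \<in> Lp 2"
  shows "integrable lborel (\<lambda>t. norm (f t) * norm (g t))"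
proof (rule Bochner_Integration.integrable_bound)
  have [measurable]: "f \<in> borel_measurable borel" "g \<in> borel_measurable borel"
    using assms by (auto simp: Lp_2_iff)
  show "integrable lborel (\<lambda>t. (norm (f t))\<^sup>2 + (norm (g t))\<^sup>2)"
    using assms by (auto simp: Lp_2_iff)
  show "(\<lambda>t. norm (f t) * norm (g t)) \<in> borel_measurable lborel" by measurable
  have "a * b \<le> a\<^sup>2 + b\<^sup>2" if "0 \<le> a" "0 \<le> b" for a b :: real
    using sum_squares_bound[of a b] mult_nonneg_nonneg[OF that] by linarith
  then show "AE t in lborel. norm (norm (f t) * norm (g t)) \<le> norm ((norm (f t))\<^sup>2 + (norm (g t))\<^sup>2)"
    by auto
qed

lemma borel_measurable_cnj [measurable (raw)]:
  "f \<in> borel_measurable M \<Longrightarrow> (\<lambda>x. cnj (f x)) \<in> borel_measurable M"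
  by (rule borel_measurable_continuous_on[where f = cnj]) (auto intro: continuous_intros)

lemma Lp_2_mult_integrable:
  assumes "f \<in> Lp 2" "g \<in> Lp 2"
  shows "integrable lborel (\<lambda>t. f t * cnj (g t))"
proof (rule Bochner_Integration.integrable_bound[OF Lp_2_mult_integrable_norm[OF assms]])
  have [measurable]: "f \<in> borel_measurable borel" "g \<in> borel_measurable borel"
    using assms by (auto simp: Lp_2_iff)
  have [measurable]: "(\<lambda>t. cnj (g t)) \<in> borel_measurable borel"
    by (rule borel_measurable_cnj) measurable
  show "(\<lambda>t. f t * cnj (g t)) \<in> borel_measurable lborel" by measurable
qed (auto simp: norm_mult)

lemma Lp_2_zero [simp]: "(\<lambda>t. 0) \<in> Lp 2"
  by (simp add: Lp_2_iff)

lemma Lp_2_add: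
  assumes "f \<in> Lp 2" "g \<in> Lp 2"
  shows "(\<lambda>t. f t + g t) \<in> Lp 2"
  unfolding Lp_2_iff
proof
  have [measurable]: "f \<in> borel_measurable borel" "g \<in> borel_measurable borel"
    using assms by (auto simp: Lp_2_iff)
  show "(\<lambda>t. f t + g t) \<in> borel_measurable borel" by measurable
  show "integrable lborel (\<lambda>t. (norm (f t + g t))\<^sup>2)"
  proof (rule Bochner_Integration.integrable_bound)
    show "integrable lborel (\<lambda>t. 2 * (norm (f t))\<^sup>2 + 2 * (norm (g t))\<^sup>2)"
      using assms by (auto simp: Lp_2_iff)
    show "AE t in lborel. norm ((norm (f t + g t))\<^sup>2) \<le> norm (2 * (norm (f t))\<^sup>2 + 2 * (norm (g t))\<^sup>2)"
    proof (intro always_eventually allI)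
      fix t
      have "(norm (f t + g t))\<^sup>2 \<le> (norm (f t) + norm (g t))\<^sup>2"
        by (intro power_mono norm_triangle_ineq norm_ge_zero)
      also have "\<dots> \<le> 2 * (norm (f t))\<^sup>2 + 2 * (norm (g t))\<^sup>2"
        using sum_squares_bound[of "norm (f t)" "norm (g t)"] by (simp add: power2_sum)
      finally show "norm ((norm (f t + g t))\<^sup>2) \<le> norm (2 * (norm (f t))\<^sup>2 + 2 * (norm (g t))\<^sup>2)"
        by simp
    qed
  qed measurable
qed

lemma Lp_2_scale: "f \<in> Lp 2 \<Longrightarrow> (\<lambda>t. c * f t) \<in> Lp 2"
  by (auto simp: Lp_2_iff norm_mult power_mult_distrib)

lemma Lp_2_diff: "f \<in> Lp 2 \<Longrightarrow> g \<in> Lp 2 \<Longrightarrow> (\<lambda>t. f t - g t) \<in> Lp 2"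
  using Lp_2_add[of f "\<lambda>t. (- 1) * g t"] Lp_2_scale[of g "- 1"] by simp

lemma Lp_2_sum: "(\<And>i. i \<in> I \<Longrightarrow> f i \<in> Lp 2) \<Longrightarrow> (\<lambda>t. \<Sum>i\<in>I. f i t) \<in> Lp 2"
  by (induction I rule: infinite_finite_induct) (auto intro!: Lp_2_add)

lemma L2_inner_commute: "L2_inner g f = cnj (L2_inner f g)"
  unfolding L2_inner_def by (subst Bochner_Integration.integral_cnj[symmetric]) (simp add: mult.commute)

lemma L2_inner_self: "L2_inner f f = of_real ((Lp_norm 2 f)\<^sup>2)"
proof -
  have "of_real ((Lp_norm 2 f)\<^sup>2) = (\<integral>t. complex_of_real ((norm (f t))\<^sup>2) \<partial>lborel)"
    unfolding Lp_norm_2_sq by (rule integral_complex_of_real[symmetric])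
  then show ?thesis
    unfolding L2_inner_def complex_norm_square by (rule sym)
qed

lemma L2_inner_add_left:
  "f \<in> Lp 2 \<Longrightarrow> g \<in> Lp 2 \<Longrightarrow> h \<in> Lp 2 \<Longrightarrow> L2_inner (\<lambda>t. f t + g t) h = L2_inner f h + L2_inner g h"
  by (simp add: L2_inner_def distrib_right Lp_2_mult_integrable)

lemma L2_inner_diff_left:
  "f \<in> Lp 2 \<Longrightarrow> g \<in> Lp 2 \<Longrightarrow> h \<in> Lp 2 \<Longrightarrow> L2_inner (\<lambda>t. f t - g t) h = L2_inner f h - L2_inner g h"
  by (simp add: L2_inner_def left_diff_distrib Lp_2_mult_integrable)

lemma L2_inner_scale_left: "L2_inner (\<lambda>t. c * f t) h = c * L2_inner f h"
  by (simp add: L2_inner_def mult.assoc)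

lemma L2_inner_sum_left:
  assumes "\<And>i. i \<in> I \<Longrightarrow> f i \<in> Lp 2" "h \<in> Lp 2"
  shows "L2_inner (\<lambda>t. \<Sum>i\<in>I. f i t) h = (\<Sum>i\<in>I. L2_inner (f i) h)"
  using assms by (simp add: L2_inner_def sum_distrib_right Lp_2_mult_integrable)

lemma Lp_2_Cauchy_Schwarz:
  assumes "f \<in> Lp 2" "g \<in> Lp 2"
  shows "(\<integral>t. norm (f t) * norm (g t) \<partial>lborel) \<le> Lp_norm 2 f * Lp_norm 2 g"
proof -
  have [measurable]: "f \<in> borel_measurable borel" "g \<in> borel_measurable borel"
    using assms by (auto simp: Lp_2_iff)
  let ?I = "\<integral>t. norm (f t) * norm (g t) \<partial>lborel"
  have "(\<integral>\<^sup>+t. ennreal (norm (f t)) * ennreal (norm (g t)) \<partial>lborel)\<^sup>2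
      \<le> (\<integral>\<^sup>+t. ennreal (norm (f t)) ^ 2 \<partial>lborel) * (\<integral>\<^sup>+t. ennreal (norm (g t)) ^ 2 \<partial>lborel)"
    by (intro Cauchy_Schwarz_nn_integral) measurable
  also have "(\<integral>\<^sup>+t. ennreal (norm (f t)) ^ 2 \<partial>lborel) = ennreal ((Lp_norm 2 f)\<^sup>2)"
    using assms by (simp add: Lp_2_iff Lp_norm_2_sq nn_integral_eq_integral ennreal_power)
  also have "(\<integral>\<^sup>+t. ennreal (norm (g t)) ^ 2 \<partial>lborel) = ennreal ((Lp_norm 2 g)\<^sup>2)"
    using assms by (simp add: Lp_2_iff Lp_norm_2_sq nn_integral_eq_integral ennreal_power)
  also have "(\<integral>\<^sup>+t. ennreal (norm (f t)) * ennreal (norm (g t)) \<partial>lborel) = ennreal ?I"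
    using Lp_2_mult_integrable_norm[OF assms]
    by (simp add: nn_integral_eq_integral ennreal_mult[symmetric])
  finally have "?I\<^sup>2 \<le> (Lp_norm 2 f * Lp_norm 2 g)\<^sup>2"
    by (simp add: ennreal_power ennreal_mult[symmetric] power_mult_distrib)
  then show ?thesis
    by (rule power2_le_imp_le) simp
qed

lemma L2_inner_Cauchy_Schwarz:
  assumes "f \<in> Lp 2" "g \<in> Lp 2"
  shows "norm (L2_inner f g) \<le> Lp_norm 2 f * Lp_norm 2 g"
proof -
  have "norm (L2_inner f g) \<le> (\<integral>t. norm (f t * cnj (g t)) \<partial>lborel)"
    unfolding L2_inner_def by (rule integral_norm_bound)
  also have "\<dots> \<le> Lp_norm 2 f * Lp_norm 2 g"
    using Lp_2_Cauchy_Schwarz[OF assms] by (simp add: norm_mult)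
  finally show ?thesis .
qed

section \<open>Translation invariance of Lebesgue measure\<close>

lemma integral_translate:
  fixes f :: "'a::euclidean_space \<Rightarrow> 'b::{banach, second_countable_topology}"
  assumes [measurable]: "f \<in> borel_measurable borel"
  shows "(\<integral>x. f (x + c) \<partial>lborel) = (\<integral>x. f x \<partial>lborel)"
proof -
  have "(\<integral>x. f x \<partial>lborel) = (\<integral>x. f x \<partial>distr lborel borel ((+) c))"
    by (simp add: lborel_distr_plus)
  also have "\<dots> = (\<integral>x. f (c + x) \<partial>lborel)"
    by (rule integral_distr) measurable
  finally show ?thesis by (simp add: add.commute)
qed

lemma integrable_translate:
  fixes f :: "'a::euclidean_space \<Rightarrow> 'b::{banach, second_countable_topology}"
  assumes "integrable lborel f"
  shows "integrable lborel (\<lambda>x. f (x + c))"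
proof -
  have "integrable (distr lborel borel ((+) c)) f"
    using assms by (simp add: lborel_distr_plus)
  then have "integrable lborel (\<lambda>x. f (c + x))"
    by (rule integrable_distr[rotated]) measurable
  then show ?thesis by (simp add: add.commute)
qed

lemma nn_integral_translate:
  fixes f :: "'a::euclidean_space \<Rightarrow> ennreal"
  assumes [measurable]: "f \<in> borel_measurable borel"
  shows "(\<integral>\<^sup>+x. f (x + c) \<partial>lborel) = (\<integral>\<^sup>+x. f x \<partial>lborel)"
proof -
  have "(\<integral>\<^sup>+x. f x \<partial>lborel) = (\<integral>\<^sup>+x. f x \<partial>distr lborel borel ((+) c))"
    by (simp add: lborel_distr_plus)
  also have "\<dots> = (\<integral>\<^sup>+x. f (c + x) \<partial>lborel)"
    by (rule nn_integral_distr) measurable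
  finally show ?thesis by (simp add: add.commute)
qed

lemma AE_translate:
  fixes P :: "'a::euclidean_space \<Rightarrow> bool"
  assumes "AE x in lborel. P x"
  shows "AE x in lborel. P (x + c)"
proof -
  have "AE x in distr lborel borel ((+) c). P x"
    unfolding lborel_distr_plus by (rule assms)
  then have "AE x in lborel. P (c + x)"
    by (rule AE_distrD[rotated]) measurable
  then show ?thesis by (simp add: add.commute)
qed

lemma Lp_2_translate: "f \<in> Lp 2 \<Longrightarrow> (\<lambda>t. f (t + c)) \<in> Lp 2"
  using integrable_translate[of "\<lambda>t. (norm (f t))\<^sup>2" c] by (auto simp: Lp_2_iff)

lemma norm_has_sum_le:
  fixes f :: "'i \<Rightarrow> 'b::real_normed_vector"
  assumes "(f has_sum s) A" "\<And>F. finite F \<Longrightarrow> F \<subseteq> A \<Longrightarrow> norm (sum f F) \<le> b"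
  shows "norm s \<le> b"
proof (rule tendsto_upperbound)
  show "((\<lambda>F. norm (sum f F)) \<longlongrightarrow> norm s) (finite_subsets_at_top A)"
    using assms(1) unfolding has_sum_def by (rule tendsto_norm)
  show "\<forall>\<^sub>F F in finite_subsets_at_top A. norm (sum f F) \<le> b"
    by (rule eventually_finite_subsets_at_top_weakI) (use assms(2) in auto)
qed simp


section \<open>Duality as a weak identity\<close>

text \<open>Cauchy--Schwarz for finite families. The set \<open>K\<close> is kept apart from
  \<open>J\<close>: with \<open>K = J\<close> the estimate yields convergence, with
  \<open>K = J - F\<close> it bounds the remainder of an expansion by the tail of its
  coefficients.\<close>

lemma Bessel_Cauchy_Schwarz_tail:
  assumes bessel: "\<And>f. f \<in> Lp 2 \<Longrightarrow> (\<lambda>j. (norm (L2_inner f (d j)))\<^sup>2) summable_on J \<and>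
        (\<Sum>\<^sub>\<infinity>j\<in>J. (norm (L2_inner f (d j)))\<^sup>2) \<le> B * (Lp_norm 2 f)\<^sup>2"
    and "f' \<in> Lp 2" "finite F" "F \<subseteq> K" "K \<subseteq> J" "a summable_on K"
    and a: "a = (\<lambda>j. (norm (c j))\<^sup>2)"
  shows "(\<Sum>j\<in>F. norm (c j * L2_inner (d j) f')) \<le> sqrt (\<Sum>\<^sub>\<infinity>j\<in>K. a j) * (sqrt B * Lp_norm 2 f')"
proof -
  have "(\<Sum>j\<in>F. norm (c j * L2_inner (d j) f')) = (\<Sum>j\<in>F. \<bar>norm (c j)\<bar> * \<bar>norm (L2_inner f' (d j))\<bar>)"
    by (simp add: norm_mult L2_inner_commute[of _ f'])
  also have "\<dots> \<le> L2_set (\<lambda>j. norm (c j)) F * L2_set (\<lambda>j. norm (L2_inner f' (d j))) F"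
    by (rule L2_set_mult_ineq)
  also have "\<dots> \<le> sqrt (\<Sum>\<^sub>\<infinity>j\<in>K. a j) * (sqrt B * Lp_norm 2 f')"
  proof (rule mult_mono)
    show "L2_set (\<lambda>j. norm (c j)) F \<le> sqrt (\<Sum>\<^sub>\<infinity>j\<in>K. a j)"
      unfolding L2_set_def using assms(3-6) by (auto intro!: finite_sum_le_infsum simp: a)
    have "L2_set (\<lambda>j. norm (L2_inner f' (d j))) F \<le> sqrt (\<Sum>\<^sub>\<infinity>j\<in>J. (norm (L2_inner f' (d j)))\<^sup>2)"
      unfolding L2_set_def using assms(3-5) bessel[OF assms(2)]
      by (auto intro!: finite_sum_le_infsum)
    also have "\<dots> \<le> sqrt (B * (Lp_norm 2 f')\<^sup>2)"
      using bessel[OF assms(2)] by simp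
    finally show "L2_set (\<lambda>j. norm (L2_inner f' (d j))) F \<le> sqrt B * Lp_norm 2 f'"
      by (simp add: real_sqrt_mult)
    show "0 \<le> L2_set (\<lambda>j. norm (L2_inner f' (d j))) F" by (rule L2_set_nonneg)
    show "0 \<le> sqrt (\<Sum>\<^sub>\<infinity>j\<in>K. a j)" unfolding a by (simp add: infsum_nonneg)
  qed
  finally show ?thesis .
qed

text \<open>The bound in \<open>bessel_sequence\<close> carries no sign condition;
  \<open>\<bar>B\<bar>\<close> serves equally well and is nonnegative, as the later factors
  \<open>sqrt B\<close> require.\<close>

lemma bessel_sequenceE:
  assumes "bessel_sequence J d"
  obtains B where "0 \<le> B" "\<And>f. f \<in> Lp 2 \<Longrightarrow> (\<lambda>j. (norm (L2_inner f (d j)))\<^sup>2) summable_on J \<and>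
        (\<Sum>\<^sub>\<infinity>j\<in>J. (norm (L2_inner f (d j)))\<^sup>2) \<le> B * (Lp_norm 2 f)\<^sup>2"
proof -
  obtain B where B: "\<And>f. f \<in> Lp 2 \<Longrightarrow> (\<lambda>j. (norm (L2_inner f (d j)))\<^sup>2) summable_on J \<and>
        (\<Sum>\<^sub>\<infinity>j\<in>J. (norm (L2_inner f (d j)))\<^sup>2) \<le> B * (Lp_norm 2 f)\<^sup>2"
    using assms unfolding bessel_sequence_def by metis
  have "B * (Lp_norm 2 f)\<^sup>2 \<le> \<bar>B\<bar> * (Lp_norm 2 f)\<^sup>2" for f :: "'b \<Rightarrow> complex"
    by (intro mult_right_mono) auto
  with B show ?thesis
    by (intro that[of "\<bar>B\<bar>"]) (auto intro: order_trans)
qed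

text \<open>All finite sums of moduli obey one Cauchy--Schwarz bound, so the series converges
  absolutely. That \<open>C\<close> does not depend on \<open>f\<close> and \<open>f'\<close> makes
  the pairing continuous, which the limit passage in \<open>weak_dual_limit_left\<close>
  exploits.\<close>

lemma Bessel_pair_has_sum:
  fixes d e :: "'i \<Rightarrow> 'a::euclidean_space \<Rightarrow> complex"
  assumes "bessel_sequence J e" "bessel_sequence J d"
  obtains C where "\<And>f f'. f \<in> Lp 2 \<Longrightarrow> f' \<in> Lp 2 \<Longrightarrow>
    \<exists>s. ((\<lambda>j. L2_inner f (e j) * L2_inner (d j) f') has_sum s) J \<and>
        norm s \<le> C * (Lp_norm 2 f * Lp_norm 2 f')"
proof -
  obtain Be where "0 \<le> Be" and Be: "\<And>f. f \<in> Lp 2 \<Longrightarrow> (\<lambda>j. (norm (L2_inner f (e j)))\<^sup>2) summable_on J \<and>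
        (\<Sum>\<^sub>\<infinity>j\<in>J. (norm (L2_inner f (e j)))\<^sup>2) \<le> Be * (Lp_norm 2 f)\<^sup>2"
    by (rule bessel_sequenceE[OF assms(1)]) (blast intro: that)
  obtain Bd where "0 \<le> Bd" and Bd: "\<And>f. f \<in> Lp 2 \<Longrightarrow> (\<lambda>j. (norm (L2_inner f (d j)))\<^sup>2) summable_on J \<and>
        (\<Sum>\<^sub>\<infinity>j\<in>J. (norm (L2_inner f (d j)))\<^sup>2) \<le> Bd * (Lp_norm 2 f)\<^sup>2"
    by (rule bessel_sequenceE[OF assms(2)]) (blast intro: that)
  show ?thesis
  proof (rule that[of "sqrt Be * sqrt Bd"])
    fix f f' :: "'a \<Rightarrow> complex" assume f: "f \<in> Lp 2" and f': "f' \<in> Lp 2"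
    let ?t = "\<lambda>j. L2_inner f (e j) * L2_inner (d j) f'"
    have fin: "(\<Sum>j\<in>F. norm (?t j)) \<le> (sqrt Be * sqrt Bd) * (Lp_norm 2 f * Lp_norm 2 f')"
      if "finite F" "F \<subseteq> J" for F
    proof -
      have "(\<Sum>j\<in>F. norm (?t j)) \<le> sqrt (\<Sum>\<^sub>\<infinity>j\<in>J. (norm (L2_inner f (e j)))\<^sup>2) * (sqrt Bd * Lp_norm 2 f')"
        by (rule Bessel_Cauchy_Schwarz_tail[where J = J and d = d, OF Bd])
           (use f f' Be[OF f] that in auto)
      also have "\<dots> \<le> sqrt (Be * (Lp_norm 2 f)\<^sup>2) * (sqrt Bd * Lp_norm 2 f')"
        using Be[OF f] \<open>0 \<le> Bd\<close> by (intro mult_right_mono) auto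
      finally show ?thesis by (simp add: real_sqrt_mult mult_ac)
    qed
    have "(\<lambda>j. norm (?t j)) summable_on J"
      by (rule nonneg_bdd_above_summable_on) (use fin in \<open>auto intro!: bdd_aboveI2\<close>)
    then have "?t summable_on J" by (rule abs_summable_summable)
    then have s: "(?t has_sum infsum ?t J) J" by (rule has_sum_infsum)
    moreover have "norm (infsum ?t J) \<le> sqrt Be * sqrt Bd * (Lp_norm 2 f * Lp_norm 2 f')"
      by (rule norm_has_sum_le[OF s]) (rule order_trans[OF norm_sum fin])
    ultimately show "\<exists>s. (?t has_sum s) J \<and> norm s \<le> sqrt Be * sqrt Bd * (Lp_norm 2 f * Lp_norm 2 f')"
      by blast
  qed
qed

text \<open>Stated for a single pair of test functions, so that the identity can be spread by
  linearity, limits and conjugation from functions on tiles to all of L2.\<close>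

definition weak_dual ::
  "'i set \<Rightarrow> ('i \<Rightarrow> 'a::euclidean_space \<Rightarrow> complex) \<Rightarrow> ('i \<Rightarrow> 'a \<Rightarrow> complex) \<Rightarrow>
   ('a \<Rightarrow> complex) \<Rightarrow> ('a \<Rightarrow> complex) \<Rightarrow> bool" where
  "weak_dual J d e f f' \<longleftrightarrow> ((\<lambda>j. L2_inner f (e j) * L2_inner (d j) f') has_sum L2_inner f f') J"

text \<open>From weak to strong, the weak identity is tested with the remainder \<open>?r F\<close>
  itself. Its squared norm is then the part of the weak series outside \<open>F\<close>, which is at
  most the square root of the tail of the squared coefficients, times \<open>sqrt B\<close>, times
  one factor \<open>Lp_norm 2 (?r F)\<close>; that factor cancels.\<close>

lemma dual_system_iff_weak:
  assumes "bessel_sequence J e" "bessel_sequence J d"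
    and eL: "\<And>j. j \<in> J \<Longrightarrow> e j \<in> Lp 2" and dL: "\<And>j. j \<in> J \<Longrightarrow> d j \<in> Lp 2"
  shows "dual_system J d e \<longleftrightarrow> (\<forall>f\<in>Lp 2. \<forall>f'\<in>Lp 2. weak_dual J d e f f')"
proof
  have S_L2: "(\<lambda>t. \<Sum>j\<in>F. L2_inner f (e j) * d j t) \<in> Lp 2" if "F \<subseteq> J" for F f
    using that dL by (intro Lp_2_sum Lp_2_scale) auto
  have S_inner: "L2_inner (\<lambda>t. f t - (\<Sum>j\<in>F. L2_inner f (e j) * d j t)) f' =
      L2_inner f f' - (\<Sum>j\<in>F. L2_inner f (e j) * L2_inner (d j) f')"
    if "F \<subseteq> J" "f \<in> Lp 2" "f' \<in> Lp 2" for F f f'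
  proof -
    have "L2_inner (\<lambda>t. \<Sum>j\<in>F. L2_inner f (e j) * d j t) f' = (\<Sum>j\<in>F. L2_inner f (e j) * L2_inner (d j) f')"
      using that dL by (subst L2_inner_sum_left) (auto intro!: Lp_2_scale simp: L2_inner_scale_left)
    then show ?thesis
      using that by (subst L2_inner_diff_left) (auto intro!: S_L2)
  qed
  {
    assume dual: "dual_system J d e"
    show "\<forall>f\<in>Lp 2. \<forall>f'\<in>Lp 2. weak_dual J d e f f'"
    proof (intro ballI)
      fix f f' :: "'b \<Rightarrow> complex" assume f: "f \<in> Lp 2" and f': "f' \<in> Lp 2"
      have lim: "((\<lambda>F. Lp_norm 2 (\<lambda>t. f t - (\<Sum>j\<in>F. L2_inner f (e j) * d j t)) * Lp_norm 2 f') \<longlongrightarrow> 0 * Lp_norm 2 f')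
          (finite_subsets_at_top J)"
        using dual f unfolding dual_system_def by (intro tendsto_mult tendsto_const) auto
      have "((\<lambda>F. L2_inner f f' - (\<Sum>j\<in>F. L2_inner f (e j) * L2_inner (d j) f')) \<longlongrightarrow> 0) (finite_subsets_at_top J)"
      proof (rule Lim_null_comparison)
        show "\<forall>\<^sub>F F in finite_subsets_at_top J. norm (L2_inner f f' - (\<Sum>j\<in>F. L2_inner f (e j) * L2_inner (d j) f'))
          \<le> Lp_norm 2 (\<lambda>t. f t - (\<Sum>j\<in>F. L2_inner f (e j) * d j t)) * Lp_norm 2 f'"
        proof (rule eventually_finite_subsets_at_top_weakI)
          fix F assume "finite F" "F \<subseteq> J"
          then show "norm (L2_inner f f' - (\<Sum>j\<in>F. L2_inner f (e j) * L2_inner (d j) f'))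
          \<le> Lp_norm 2 (\<lambda>t. f t - (\<Sum>j\<in>F. L2_inner f (e j) * d j t)) * Lp_norm 2 f'"
            using f f' by (subst S_inner[symmetric]) (auto intro!: L2_inner_Cauchy_Schwarz Lp_2_diff S_L2)
        qed
        show "((\<lambda>F. Lp_norm 2 (\<lambda>t. f t - (\<Sum>j\<in>F. L2_inner f (e j) * d j t)) * Lp_norm 2 f') \<longlongrightarrow> 0)
          (finite_subsets_at_top J)" using lim by simp
      qed
      from tendsto_diff[OF tendsto_const[of "L2_inner f f'"] this]
      show "weak_dual J d e f f'" unfolding weak_dual_def has_sum_def by simp
    qed
  next
    assume weak: "\<forall>f\<in>Lp 2. \<forall>f'\<in>Lp 2. weak_dual J d e f f'"
    obtain B where "0 \<le> B" and B: "\<And>f. f \<in> Lp 2 \<Longrightarrow> (\<lambda>j. (norm (L2_inner f (d j)))\<^sup>2) summable_on J \<and>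
        (\<Sum>\<^sub>\<infinity>j\<in>J. (norm (L2_inner f (d j)))\<^sup>2) \<le> B * (Lp_norm 2 f)\<^sup>2"
      by (rule bessel_sequenceE[OF assms(2)]) (blast intro: that)
    show "dual_system J d e"
      unfolding dual_system_def
    proof
      fix f :: "'b \<Rightarrow> complex" assume f: "f \<in> Lp 2"
      define a where "a = (\<lambda>j. (norm (L2_inner f (e j)))\<^sup>2)"
      have a: "a summable_on J"
        using assms(1) f unfolding bessel_sequence_def a_def by blast
      let ?r = "\<lambda>F t. f t - (\<Sum>j\<in>F. L2_inner f (e j) * d j t)"
      have "((\<lambda>F. infsum a J - sum a F) \<longlongrightarrow> infsum a J - infsum a J) (finite_subsets_at_top J)"
        using has_sum_infsum[OF a] unfolding has_sum_def by (intro tendsto_intros)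
      then have "((\<lambda>F. sqrt (infsum a J - sum a F) * sqrt B) \<longlongrightarrow> sqrt 0 * sqrt B) (finite_subsets_at_top J)"
        by (intro tendsto_intros) simp
      then have lim: "((\<lambda>F. sqrt (infsum a J - sum a F) * sqrt B) \<longlongrightarrow> 0) (finite_subsets_at_top J)"
        by simp
      show "((\<lambda>F. Lp_norm 2 (?r F)) \<longlongrightarrow> 0) (finite_subsets_at_top J)"
      proof (rule Lim_null_comparison[OF _ lim], rule eventually_finite_subsets_at_top_weakI)
        fix F assume F: "finite F" "F \<subseteq> J"
        have r: "?r F \<in> Lp 2" using F f by (intro Lp_2_diff S_L2)
        let ?t = "\<lambda>j. L2_inner f (e j) * L2_inner (d j) (?r F)"
        have "(?t has_sum L2_inner f (?r F)) J"
          using weak f r unfolding weak_dual_def by blast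
        then have hs: "(?t has_sum L2_inner f (?r F) - sum ?t F) (J - F)"
          by (intro has_sum_Diff has_sum_finite F)
        have aF: "a summable_on (J - F)" using a by (rule summable_on_subset_banach) auto
        have "norm (L2_inner f (?r F) - sum ?t F) \<le> sqrt (infsum a (J - F)) * (sqrt B * Lp_norm 2 (?r F))"
        proof (rule norm_has_sum_le[OF hs])
          fix G assume G: "finite G" "G \<subseteq> J - F"
          have "norm (sum ?t G) \<le> (\<Sum>j\<in>G. norm (?t j))" by (rule norm_sum)
          also have "\<dots> \<le> sqrt (infsum a (J - F)) * (sqrt B * Lp_norm 2 (?r F))"
            by (rule Bessel_Cauchy_Schwarz_tail[where J = J, OF B]) (use r G aF in \<open>auto simp: a_def\<close>)
          finally show "norm (sum ?t G) \<le> sqrt (infsum a (J - F)) * (sqrt B * Lp_norm 2 (?r F))" .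
        qed
        also have "L2_inner f (?r F) - sum ?t F = L2_inner (?r F) (?r F)"
          using S_inner[OF F(2) f r] by simp
        also have "infsum a (J - F) = infsum a J - sum a F"
          using a F by (simp add: infsum_Diff)
        finally have "(Lp_norm 2 (?r F))\<^sup>2 \<le> sqrt (infsum a J - sum a F) * (sqrt B * Lp_norm 2 (?r F))"
          by (simp add: L2_inner_self del: of_real_power)
        then have main: "Lp_norm 2 (?r F) * Lp_norm 2 (?r F) \<le> (sqrt (infsum a J - sum a F) * sqrt B) * Lp_norm 2 (?r F)"
          by (simp add: power2_eq_square mult_ac)
        have "0 \<le> infsum a J - sum a F"
          using finite_sum_le_infsum[OF a F] by (simp add: a_def)
        then have "0 \<le> sqrt (infsum a J - sum a F) * sqrt B" using \<open>0 \<le> B\<close> by simp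
        then have "Lp_norm 2 (?r F) \<le> sqrt (infsum a J - sum a F) * sqrt B"
          using main mult_right_le_imp_le[of "Lp_norm 2 (?r F)" "Lp_norm 2 (?r F)"]
            Lp_norm_2_nonneg[of "?r F"] by (cases "Lp_norm 2 (?r F) = 0") auto
        then show "norm (Lp_norm 2 (?r F)) \<le> sqrt (infsum a J - sum a F) * sqrt B" by simp
      qed
    qed
  }
qed

text \<open>Complex conjugation of the series interchanges the two systems and the two functions, so
  linearity and limits have to be treated in the first argument only.\<close>

lemma weak_dual_swap: "weak_dual J d e f f' \<longleftrightarrow> weak_dual J e d f' f"
proof -
  have "weak_dual J e d f' f" if "weak_dual J d e f f'" for d e f f'
    using has_sum_cnj_iff[THEN iffD2, OF that[unfolded weak_dual_def]] unfolding weak_dual_def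
    by (simp add: L2_inner_commute[symmetric] mult.commute)
  then show ?thesis by blast
qed

lemma weak_dual_add_left:
  assumes "weak_dual J d e f f'" "weak_dual J d e g f'" "f \<in> Lp 2" "g \<in> Lp 2" "f' \<in> Lp 2"
    "\<And>j. j \<in> J \<Longrightarrow> e j \<in> Lp 2"
  shows "weak_dual J d e (\<lambda>t. f t + g t) f'"
proof -
  have "((\<lambda>j. L2_inner f (e j) * L2_inner (d j) f' + L2_inner g (e j) * L2_inner (d j) f') has_sum
      L2_inner f f' + L2_inner g f') J"
    using assms(1,2) unfolding weak_dual_def by (rule has_sum_add)
  then show ?thesis unfolding weak_dual_def L2_inner_add_left[OF assms(3-5)]
    by (rule has_sum_cong[THEN iffD1, rotated])
       (simp add: assms L2_inner_add_left distrib_right)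
qed

text \<open>The sum of the series and the inner product are both bounded in \<open>f\<close>, hence
  two continuous functions of \<open>f\<close> that agree along the sequence.\<close>

lemma weak_dual_limit_left:
  assumes bessel: "bessel_sequence J e" "bessel_sequence J d"
    and eL: "\<And>j. j \<in> J \<Longrightarrow> e j \<in> Lp 2"
    and f: "f \<in> Lp 2" "f' \<in> Lp 2" and fk: "\<And>k. fk k \<in> Lp 2" "\<And>k. weak_dual J d e (fk k) f'"
    and lim: "(\<lambda>k. Lp_norm 2 (\<lambda>t. f t - fk k t)) \<longlonglongrightarrow> 0"
  shows "weak_dual J d e f f'"
proof -
  obtain C where C: "\<And>f f'. f \<in> Lp 2 \<Longrightarrow> f' \<in> Lp 2 \<Longrightarrow>
    \<exists>s. ((\<lambda>j. L2_inner f (e j) * L2_inner (d j) f') has_sum s) J \<and>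
        norm s \<le> C * (Lp_norm 2 f * Lp_norm 2 f')"
    by (rule Bessel_pair_has_sum[OF bessel]) (blast intro: that)
  obtain s where s: "((\<lambda>j. L2_inner f (e j) * L2_inner (d j) f') has_sum s) J"
    using C[OF f] by blast
  have bound: "norm (s - L2_inner f f') \<le> (C + 1) * (Lp_norm 2 (\<lambda>t. f t - fk k t) * Lp_norm 2 f')" for k
  proof -
    have diff: "(\<lambda>t. f t - fk k t) \<in> Lp 2" using f fk by (intro Lp_2_diff)
    have "((\<lambda>j. L2_inner f (e j) * L2_inner (d j) f' - L2_inner (fk k) (e j) * L2_inner (d j) f') has_sum
      s - L2_inner (fk k) f') J"
      using has_sum_add[OF s has_sum_uminusI[OF fk(2)[of k, unfolded weak_dual_def]]] by simp
    then have "((\<lambda>j. L2_inner (\<lambda>t. f t - fk k t) (e j) * L2_inner (d j) f') has_sum s - L2_inner (fk k) f') J"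
      by (rule has_sum_cong[THEN iffD1, rotated])
         (simp add: f fk eL L2_inner_diff_left left_diff_distrib)
    then have "norm (s - L2_inner (fk k) f') \<le> C * (Lp_norm 2 (\<lambda>t. f t - fk k t) * Lp_norm 2 f')"
      using C[OF diff f(2)] has_sum_unique by blast
    moreover have "norm (L2_inner f f' - L2_inner (fk k) f') \<le> Lp_norm 2 (\<lambda>t. f t - fk k t) * Lp_norm 2 f'"
      using L2_inner_Cauchy_Schwarz[OF diff f(2)] f fk by (simp add: L2_inner_diff_left)
    moreover have "norm (s - L2_inner f f') \<le> norm (s - L2_inner (fk k) f') + norm (L2_inner f f' - L2_inner (fk k) f')"
      by (metis norm_triangle_ineq4 diff_diff_eq2 diff_add_cancel add_diff_eq diff_diff_eq)
    ultimately show ?thesis by (simp add: distrib_right)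
  qed
  have "(\<lambda>k. (C + 1) * (Lp_norm 2 (\<lambda>t. f t - fk k t) * Lp_norm 2 f')) \<longlonglongrightarrow> (C + 1) * (0 * Lp_norm 2 f')"
    by (intro tendsto_intros lim)
  then have "norm (s - L2_inner f f') \<le> (C + 1) * (0 * Lp_norm 2 f')"
    by (rule LIMSEQ_le_const) (use bound in auto)
  then have "s = L2_inner f f'" by simp
  with s show ?thesis by (simp add: weak_dual_def)
qed

section \<open>Lattices in coordinates\<close>

lemma cis_2pi_Ints: "z \<in> \<int> \<Longrightarrow> cis (2 * pi * z) = 1"
  by simp

lemma borel_measurable_cis [measurable (raw)]:
  "f \<in> borel_measurable M \<Longrightarrow> (\<lambda>x. cis (f x)) \<in> borel_measurable M"
  unfolding cis_conv_exp
  by (rule borel_measurable_continuous_on[where f = "\<lambda>x. exp (\<i> * complex_of_real x)"])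
     (auto intro!: continuous_intros)

text \<open>The lattice is given by a linear coordinate map sending it onto the integer vectors.\<close>

locale lattice_coords =
  fixes C :: "'a::euclidean_space \<Rightarrow> 'a"
  assumes lin: "linear C" and inj: "inj C"
begin

definition lat :: "'a set" where
  "lat = {x. \<forall>i\<in>Basis. C x \<bullet> i \<in> \<int>}"

text \<open>Half-open, so that the lattice translates partition the space exactly and every point
  has one and only one \<open>base_pt\<close>.\<close>

definition cell :: "'a set" where
  "cell = {x. \<forall>i\<in>Basis. 0 \<le> C x \<bullet> i \<and> C x \<bullet> i < 1}"

definition covol :: real where
  "covol = measure lborel cell"

definition base_pt :: "'a \<Rightarrow> 'a" where
  "base_pt x = inv C (\<Sum>i\<in>Basis. of_int \<lfloor>C x \<bullet> i\<rfloor> *\<^sub>R i)"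

lemma C_simps [simp]: "C (x + y) = C x + C y" "C (x - y) = C x - C y" "C (- x) = - C x" "C 0 = 0"
  "C (r *\<^sub>R x) = r *\<^sub>R C x"
  using lin by (simp_all add: linear_add linear_diff linear_neg linear_0 linear_scale)

lemma C_inv [simp]: "C (inv C x) = x"
  using linear_injective_imp_surjective[OF lin inj] by (simp add: surj_f_inv_f)

lemma inv_C [simp]: "inv C (C x) = x"
  using inj by simp

lemma lin_inv: "linear (inv C)"
  by (rule linearI) (metis C_inv C_simps(1) inv_C, metis C_inv C_simps(5) inv_C)

lemma lat_add: "x \<in> lat \<Longrightarrow> y \<in> lat \<Longrightarrow> x + y \<in> lat"
  by (simp add: lat_def inner_add_left)

lemma lat_diff: "x \<in> lat \<Longrightarrow> y \<in> lat \<Longrightarrow> x - y \<in> lat"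
  by (simp add: lat_def inner_diff_left)

lemma lat_uminus: "x \<in> lat \<Longrightarrow> - x \<in> lat"
  by (simp add: lat_def)

lemma C_base_pt: "i \<in> Basis \<Longrightarrow> C (base_pt x) \<bullet> i = of_int \<lfloor>C x \<bullet> i\<rfloor>"
  by (simp add: base_pt_def inner_sum_left_Basis)

lemma base_pt_lat: "base_pt x \<in> lat"
  by (simp add: lat_def C_base_pt)

lemma base_pt_cell: "x - base_pt x \<in> cell"
  unfolding cell_def by (auto simp: inner_diff_left C_base_pt) linarith

lemma base_pt_unique:
  assumes "\<gamma> \<in> lat" "x - \<gamma> \<in> cell"
  shows "\<gamma> = base_pt x"
proof -
  have "C \<gamma> \<bullet> i = C (base_pt x) \<bullet> i" if "i \<in> Basis" for i
  proof -
    from assms(1) that obtain k where k: "C \<gamma> \<bullet> i = of_int k" by (auto simp: lat_def elim: Ints_cases)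
    have "0 \<le> C x \<bullet> i - of_int k \<and> C x \<bullet> i - of_int k < 1"
      using assms(2) that k by (auto simp: cell_def inner_diff_left)
    then have "\<lfloor>C x \<bullet> i\<rfloor> = k" by (simp add: floor_unique)
    then show ?thesis using k that by (simp add: C_base_pt)
  qed
  then have "C \<gamma> = C (base_pt x)" by (simp add: euclidean_eq_iff[of "C \<gamma>"])
  then show ?thesis using inj by (simp add: inj_eq)
qed

lemma in_cell_iff: "\<gamma> \<in> lat \<Longrightarrow> x - \<gamma> \<in> cell \<longleftrightarrow> \<gamma> = base_pt x"
  using base_pt_unique base_pt_cell by blast

lemma indicator_cell_shift: "\<gamma> \<in> lat \<Longrightarrow> indicator cell (x + \<gamma>) = indicator {- base_pt x} \<gamma>"
proof -
  assume "\<gamma> \<in> lat"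
  then have "x + \<gamma> \<in> cell \<longleftrightarrow> \<gamma> = - base_pt x"
    using in_cell_iff[of "- \<gamma>" x] lat_uminus[of \<gamma>] by (metis add.inverse_inverse diff_minus_eq_add)
  then show ?thesis by (simp add: indicator_def)
qed

lemma continuous_C: "continuous_on S C"
  using lin by (simp add: linear_continuous_on linear_conv_bounded_linear)

lemma borel_C [measurable]: "C \<in> borel_measurable borel"
  by (rule borel_measurable_continuous_onI[OF continuous_C])

lemma cell_borel [measurable]: "cell \<in> sets borel"
proof -
  have "cell = {x \<in> space borel. \<forall>i\<in>Basis. 0 \<le> C x \<bullet> i \<and> C x \<bullet> i < 1}" by (simp add: cell_def)
  also have "\<dots> \<in> sets borel" by measurable
  finally show ?thesis .
qed

lemma bounded_cell: "bounded cell"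
proof (rule bounded_subset)
  show "bounded (inv C ` cbox 0 One)"
    using lin_inv by (intro compact_imp_bounded compact_continuous_image linear_continuous_on)
      (auto simp: linear_conv_bounded_linear)
  show "cell \<subseteq> inv C ` cbox 0 One"
  proof
    fix x assume "x \<in> cell"
    then have "C x \<in> cbox 0 One" by (auto simp: cell_def mem_box intro: less_imp_le)
    then show "x \<in> inv C ` cbox 0 One" by (metis imageI inv_C)
  qed
qed

lemma emeasure_cell_finite: "emeasure lborel cell < \<infinity>"
  using bounded_cell by (rule emeasure_bounded_finite)

lemma emeasure_cell: "emeasure lborel cell = ennreal covol"
  unfolding covol_def using emeasure_cell_finite by (intro emeasure_eq_ennreal_measure) auto

text \<open>The cell contains the preimage of the open unit box, a nonempty open set.\<close>

lemma covol_pos: "0 < covol"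
proof -
  have "open (C -` box 0 One)" by (intro open_vimage open_box continuous_C)
  moreover have "inv C ((1/2) *\<^sub>R One) \<in> C -` box 0 One" by (simp add: mem_box)
  ultimately obtain e where e: "0 < e" "ball (inv C ((1/2) *\<^sub>R One)) e \<subseteq> C -` box 0 One"
    using open_contains_ball_eq by blast
  have "C -` box 0 One \<subseteq> cell" by (auto simp: cell_def mem_box intro: less_imp_le)
  with e(2) have "ball (inv C ((1/2) *\<^sub>R One)) e \<subseteq> cell" by blast
  then have "measure lborel (ball (inv C ((1/2) *\<^sub>R One)) e) \<le> covol"
    unfolding covol_def using emeasure_cell_finite by (intro measure_mono_fmeasurable) (auto simp: fmeasurable_def)
  moreover have "0 < measure lborel (ball (inv C ((1/2) *\<^sub>R One)) e)"
    using content_ball_pos[OF e(1)] by simp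
  ultimately show ?thesis by linarith
qed

lemma countable_lat: "countable lat"
proof -
  let ?E = "PiE (Basis :: 'a set) (\<lambda>_. \<int> :: real set)"
  have "countable ?E" by (intro countable_PiE) (auto simp: Ints_def)
  moreover have "lat \<subseteq> (\<lambda>f. inv C (\<Sum>i\<in>Basis. f i *\<^sub>R i)) ` ?E"
  proof
    fix x assume x: "x \<in> lat"
    let ?f = "restrict (\<lambda>i. C x \<bullet> i) Basis"
    have "(\<Sum>i\<in>Basis. ?f i *\<^sub>R i) = (\<Sum>i\<in>Basis. (C x \<bullet> i) *\<^sub>R i)"
      by (intro sum.cong) auto
    then have "x = inv C (\<Sum>i\<in>Basis. ?f i *\<^sub>R i)" by (simp only: euclidean_representation inv_C)
    moreover have "?f \<in> ?E" using x by (auto simp: lat_def)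
    ultimately show "x \<in> (\<lambda>f. inv C (\<Sum>i\<in>Basis. f i *\<^sub>R i)) ` ?E" by blast
  qed
  ultimately show ?thesis by (meson countable_image countable_subset)
qed

text \<open>Volume packing: the cells at the counted lattice points are disjoint and lie in the ball
  of radius \<open>r + \<rho>\<close> around \<open>z\<close>, whose volume does not depend on
  \<open>z\<close>.\<close>

lemma lat_card_bound:
  assumes "bounded K"
  obtains N :: nat where "\<And>z. finite {\<gamma>\<in>lat. \<gamma> - z \<in> K}" "\<And>z. card {\<gamma>\<in>lat. \<gamma> - z \<in> K} \<le> N"
proof -
  obtain r where r: "\<And>x. x \<in> K \<Longrightarrow> norm x \<le> r" using assms by (auto simp: bounded_iff)
  obtain \<rho> where \<rho>: "\<And>x. x \<in> cell \<Longrightarrow> norm x \<le> \<rho>" using bounded_cell by (auto simp: bounded_iff)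
  define V where "V = measure lborel (cball (0::'a) (r + \<rho>))"
  have card_le: "real (card F) * covol \<le> V" if F: "finite F" "F \<subseteq> {\<gamma>\<in>lat. \<gamma> - z \<in> K}" for F z
  proof -
    have le: "(\<Sum>\<gamma>\<in>F. indicat_real cell (x + - \<gamma>)) \<le> indicator (cball 0 (r + \<rho>)) (x + - z)" for x
    proof (cases "base_pt x \<in> F \<and> x - z \<in> cball 0 (r + \<rho>)")
      case True
      have "(\<Sum>\<gamma>\<in>F. indicat_real cell (x + - \<gamma>)) = (\<Sum>\<gamma>\<in>F. if \<gamma> = base_pt x then 1 else 0)"
        using F(2) by (intro sum.cong refl) (auto simp: indicator_def in_cell_iff)
      then show ?thesis using True F(1) by (simp add: indicator_def)
    next
      case False
      have "indicat_real cell (x + - \<gamma>) = 0" if "\<gamma> \<in> F" for \<gamma>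
      proof (rule ccontr)
        assume "indicat_real cell (x + - \<gamma>) \<noteq> 0"
        then have c: "x - \<gamma> \<in> cell" by (auto simp: indicator_def split: if_splits)
        moreover have "norm (x - z) \<le> norm (x - \<gamma>) + norm (\<gamma> - z)"
          using norm_triangle_ineq[of "x - \<gamma>" "\<gamma> - z"] by simp
        ultimately have "norm (x - z) \<le> r + \<rho>" using \<rho>[of "x - \<gamma>"] r[of "\<gamma> - z"] F that by force
        moreover have "base_pt x \<in> F" using in_cell_iff[of \<gamma> x] c F that by auto
        ultimately show False using False by simp
      qed
      then show ?thesis by simp
    qed
    have int: "integrable lborel (\<lambda>x. indicat_real cell (x + - \<gamma>))" for \<gamma>
      using emeasure_cell_finite by (intro integrable_translate integrable_real_indicator) auto
    have "real (card F) * covol = (\<integral>x. (\<Sum>\<gamma>\<in>F. indicat_real cell (x + - \<gamma>)) \<partial>lborel)"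
      using int by (simp add: integral_translate covol_def del: add_uminus_conv_diff)
    also have "\<dots> \<le> (\<integral>x. indicator (cball (0::'a) (r + \<rho>)) (x + - z) \<partial>lborel)"
    proof (rule integral_mono)
      show "integrable lborel (\<lambda>x. indicat_real (cball (0::'a) (r + \<rho>)) (x + - z))"
        using emeasure_bounded_finite[OF bounded_cball, of "0::'a" "r + \<rho>"]
        by (intro integrable_translate integrable_real_indicator) auto
    qed (use le int in auto)
    also have "\<dots> = (\<integral>x. indicator (cball (0::'a) (r + \<rho>)) x \<partial>lborel)"
      by (rule integral_translate) (intro borel_measurable_indicator borel_closed closed_cball)
    also have "\<dots> = V" unfolding V_def by (subst Bochner_Integration.integral_indicator) simp
    finally show ?thesis .
  qed
  define N where "N = nat \<lfloor>V / covol\<rfloor>"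
  have N: "card F \<le> N" if "finite F" "F \<subseteq> {\<gamma>\<in>lat. \<gamma> - z \<in> K}" for F z
    using card_le[OF that] covol_pos unfolding N_def by (simp add: le_nat_floor pos_le_divide_eq)
  then have "finite {\<gamma>\<in>lat. \<gamma> - z \<in> K}" for z
    using finite_if_finite_subsets_card_bdd[of "{\<gamma>\<in>lat. \<gamma> - z \<in> K}" N] by auto
  with N show ?thesis by (intro that[of N]) auto
qed

section \<open>Unfolding and periodization\<close>

lemma sigma_finite_lat: "sigma_finite_measure (count_space lat)"
  by (rule sigma_finite_measure_count_space_countable[OF countable_lat])

lemma pair_sigma_finite_lat: "pair_sigma_finite (count_space lat) lborel"
  unfolding pair_sigma_finite_def using sigma_finite_lat lborel.sigma_finite_measure_axioms by blast

text \<open>After a translation by \<gamma>, sum and integral are exchanged: for fixed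
  \<open>x\<close> exactly one lattice point, \<open>- base_pt x\<close>, moves \<open>x\<close>
  into the cell.\<close>

lemma nn_integral_unfold:
  fixes f :: "'a \<Rightarrow> ennreal"
  assumes [measurable]: "f \<in> borel_measurable borel"
  shows "(\<integral>\<^sup>+x. f x \<partial>lborel) = (\<integral>\<^sup>+\<gamma>. \<integral>\<^sup>+x. f (x + - \<gamma>) * indicator cell x \<partial>lborel \<partial>count_space lat)"
proof -
  interpret pair_sigma_finite "count_space lat" lborel by (rule pair_sigma_finite_lat)
  have "(\<integral>\<^sup>+\<gamma>. \<integral>\<^sup>+x. f (x + - \<gamma>) * indicator cell x \<partial>lborel \<partial>count_space lat)
      = (\<integral>\<^sup>+\<gamma>. \<integral>\<^sup>+x. f x * indicator cell (x + \<gamma>) \<partial>lborel \<partial>count_space lat)"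
  proof (rule nn_integral_cong)
    fix \<gamma>
    show "(\<integral>\<^sup>+x. f (x + - \<gamma>) * indicator cell x \<partial>lborel) = (\<integral>\<^sup>+x. f x * indicator cell (x + \<gamma>) \<partial>lborel)"
      using nn_integral_translate[of "\<lambda>x. f x * indicator cell (x + \<gamma>)" "- \<gamma>"] by simp
  qed
  also have "\<dots> = (\<integral>\<^sup>+x. \<integral>\<^sup>+\<gamma>. f x * indicator cell (x + \<gamma>) \<partial>count_space lat \<partial>lborel)"
  proof (rule Fubini'[symmetric])
    show "(\<lambda>(\<gamma>, x). f x * indicator cell (x + \<gamma>)) \<in> borel_measurable (count_space lat \<Otimes>\<^sub>M lborel)"
      by (intro measurable_pair_measure_countable1 countable_lat) (simp, measurable)
  qed
  also have "\<dots> = (\<integral>\<^sup>+x. f x \<partial>lborel)"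
  proof (rule nn_integral_cong)
    fix x
    have "(\<integral>\<^sup>+\<gamma>. f x * indicator cell (x + \<gamma>) \<partial>count_space lat)
        = (\<integral>\<^sup>+\<gamma>. f x * indicator {- base_pt x} \<gamma> \<partial>count_space lat)"
      by (intro nn_integral_cong) (simp add: indicator_cell_shift)
    also have "\<dots> = f x"
      using lat_uminus[OF base_pt_lat] by (subst nn_integral_cmult) (auto simp: one_ennreal_def[symmetric])
    finally show "(\<integral>\<^sup>+\<gamma>. f x * indicator cell (x + \<gamma>) \<partial>count_space lat) = f x" .
  qed
  finally show ?thesis by simp
qed

text \<open>The exceptional set is covered by countably many translates of one null set.\<close>

lemma AE_cell_periodic:
  assumes "AE x in lborel. x \<in> cell \<longrightarrow> Q x" and per: "\<And>x \<gamma>. \<gamma> \<in> lat \<Longrightarrow> Q x \<Longrightarrow> Q (x + \<gamma>)"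
  shows "AE x in lborel. Q x"
proof -
  have "AE x in lborel. \<forall>\<gamma>\<in>lat. x + - \<gamma> \<in> cell \<longrightarrow> Q (x + - \<gamma>)"
    unfolding AE_ball_countable[OF countable_lat] using AE_translate[OF assms(1)] by blast
  then show ?thesis
  proof eventually_elim
    case (elim x)
    then have "Q (x + - base_pt x)" using base_pt_lat base_pt_cell[of x] by auto
    from per[OF base_pt_lat this, of x] show ?case by simp
  qed
qed

text \<open>An integral against counting measure rather than an infinite sum, so that Fubini's
  theorem and the measurability of parameter integrals apply. Its value is 0 where the series fails
  to converge absolutely.\<close>

definition periodize :: "('a \<Rightarrow> complex) \<Rightarrow> 'a \<Rightarrow> complex" where
  "periodize f x = (\<integral>\<gamma>. f (x + - \<gamma>) \<partial>count_space lat)"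

lemma bij_lat_shift: "\<gamma>\<^sub>0 \<in> lat \<Longrightarrow> bij_betw (\<lambda>\<gamma>. \<gamma> + \<gamma>\<^sub>0) lat lat"
  by (rule bij_betw_byWitness[where f' = "\<lambda>\<gamma>. \<gamma> - \<gamma>\<^sub>0"]) (auto intro: lat_add lat_diff)

text \<open>Valid at every point, also where the series diverges: reindexing by a bijection
  preserves the default value as well.\<close>

lemma periodize_periodic: "\<gamma>\<^sub>0 \<in> lat \<Longrightarrow> periodize f (x + \<gamma>\<^sub>0) = periodize f x"
  unfolding periodize_def
  using integral_bij_count_space[OF bij_lat_shift, of \<gamma>\<^sub>0 "\<lambda>\<gamma>. f (x + \<gamma>\<^sub>0 + - \<gamma>)"]
  by (simp add: algebra_simps)

context
  fixes f \<phi> :: "'a \<Rightarrow> complex"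
  assumes f: "integrable lborel (\<lambda>x. f x * \<phi> x)"
    and [measurable]: "f \<in> borel_measurable borel" "\<phi> \<in> borel_measurable borel"
    and per: "\<And>x \<gamma>. \<gamma> \<in> lat \<Longrightarrow> \<phi> (x + - \<gamma>) = \<phi> x"
begin

lemma periodize_integrable_pair:
  "integrable (count_space lat \<Otimes>\<^sub>M lborel) (\<lambda>(\<gamma>, x). f (x + - \<gamma>) * \<phi> x * indicator cell x)"
proof (rule integrableI_bounded)
  interpret pair_sigma_finite "count_space lat" lborel by (rule pair_sigma_finite_lat)
  show M: "(\<lambda>(\<gamma>, x). f (x + - \<gamma>) * \<phi> x * indicator cell x) \<in> borel_measurable (count_space lat \<Otimes>\<^sub>M lborel)"
    by (intro measurable_pair_measure_countable1 countable_lat) (simp, measurable)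
  have "(\<integral>\<^sup>+z. norm (case z of (\<gamma>, x) \<Rightarrow> f (x + - \<gamma>) * \<phi> x * indicator cell x) \<partial>(count_space lat \<Otimes>\<^sub>M lborel))
     = (\<integral>\<^sup>+\<gamma>. \<integral>\<^sup>+x. norm (f (x + - \<gamma>) * \<phi> x * indicator cell x) \<partial>lborel \<partial>count_space lat)"
    using M by (subst lborel.nn_integral_fst[symmetric]) auto
  also have "\<dots> = (\<integral>\<^sup>+\<gamma>. \<integral>\<^sup>+x. ennreal (norm (f (x + - \<gamma>) * \<phi> (x + - \<gamma>))) * indicator cell x \<partial>lborel \<partial>count_space lat)"
    by (intro nn_integral_cong) (auto simp: per[simplified] norm_mult indicator_def)
  also have "\<dots> = (\<integral>\<^sup>+x. norm (f x * \<phi> x) \<partial>lborel)"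
    by (rule nn_integral_unfold[symmetric]) measurable
  also have "\<dots> < \<infinity>"
    using f by (simp add: integrable_iff_bounded)
  finally show "(\<integral>\<^sup>+z. norm (case z of (\<gamma>, x) \<Rightarrow> f (x + - \<gamma>) * \<phi> x * indicator cell x) \<partial>(count_space lat \<Otimes>\<^sub>M lborel)) < \<infinity>" .
qed

lemma periodize_integrable: "integrable lborel (\<lambda>x. periodize f x * \<phi> x * indicator cell x)"
proof -
  interpret pair_sigma_finite "count_space lat" lborel by (rule pair_sigma_finite_lat)
  show ?thesis
    using integrable_snd[OF periodize_integrable_pair] by (simp add: periodize_def mult.assoc)
qed

text \<open>Periodicity of \<phi>, which will be a character or the constant 1, lets the translation
  move from \<open>f\<close> to the cell. Fubini's theorem is applied twice, to take the sum outside
  and to bring it back; in the end the sum collapses to the one lattice point that puts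
  \<open>x\<close> into the cell.\<close>

lemma periodize_integral:
  "(\<integral>x. periodize f x * \<phi> x * indicator cell x \<partial>lborel) = (\<integral>x. f x * \<phi> x \<partial>lborel)"
proof -
  interpret pair_sigma_finite "count_space lat" lborel by (rule pair_sigma_finite_lat)
  have "(\<integral>x. periodize f x * \<phi> x * indicator cell x \<partial>lborel)
      = (\<integral>x. \<integral>\<gamma>. f (x + - \<gamma>) * \<phi> x * indicator cell x \<partial>count_space lat \<partial>lborel)"
    by (simp add: periodize_def mult.assoc)
  also have "\<dots> = (\<integral>\<gamma>. \<integral>x. f (x + - \<gamma>) * \<phi> x * indicator cell x \<partial>lborel \<partial>count_space lat)"
    by (rule Fubini_integral[OF periodize_integrable_pair])
  also have "\<dots> = (\<integral>\<gamma>. \<integral>x. f x * \<phi> x * indicator cell (x + \<gamma>) \<partial>lborel \<partial>count_space lat)"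
  proof (rule Bochner_Integration.integral_cong[OF refl])
    fix \<gamma> assume "\<gamma> \<in> space (count_space lat)"
    then show "(\<integral>x. f (x + - \<gamma>) * \<phi> x * indicator cell x \<partial>lborel) = (\<integral>x. f x * \<phi> x * indicator cell (x + \<gamma>) \<partial>lborel)"
      using integral_translate[of "\<lambda>x. f x * \<phi> x * indicator cell (x + \<gamma>)" "- \<gamma>"] by (simp add: per[simplified])
  qed
  also have "\<dots> = (\<integral>x. \<integral>\<gamma>. f x * \<phi> x * indicator cell (x + \<gamma>) \<partial>count_space lat \<partial>lborel)"
  proof (rule Fubini_integral[symmetric], rule integrableI_bounded)
    show M: "(\<lambda>(\<gamma>, x). f x * \<phi> x * indicator cell (x + \<gamma>)) \<in> borel_measurable (count_space lat \<Otimes>\<^sub>M lborel)"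
      by (intro measurable_pair_measure_countable1 countable_lat) (simp, measurable)
    have "(\<integral>\<^sup>+z. norm (case z of (\<gamma>, x) \<Rightarrow> f x * \<phi> x * indicator cell (x + \<gamma>)) \<partial>(count_space lat \<Otimes>\<^sub>M lborel))
       = (\<integral>\<^sup>+\<gamma>. \<integral>\<^sup>+x. norm (f x * \<phi> x * indicator cell (x + \<gamma>)) \<partial>lborel \<partial>count_space lat)"
      using M by (subst lborel.nn_integral_fst[symmetric]) auto
    also have "\<dots> = (\<integral>\<^sup>+\<gamma>. \<integral>\<^sup>+x. ennreal (norm (f (x + - \<gamma>) * \<phi> (x + - \<gamma>))) * indicator cell x \<partial>lborel \<partial>count_space lat)"
    proof (rule nn_integral_cong)
      fix \<gamma>
      show "(\<integral>\<^sup>+x. norm (f x * \<phi> x * indicator cell (x + \<gamma>)) \<partial>lborel)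
        = (\<integral>\<^sup>+x. ennreal (norm (f (x + - \<gamma>) * \<phi> (x + - \<gamma>))) * indicator cell x \<partial>lborel)"
      proof -
        have "(\<integral>\<^sup>+x. norm (f x * \<phi> x * indicator cell (x + \<gamma>)) \<partial>lborel)
          = (\<integral>\<^sup>+x. norm (f (x + - \<gamma>) * \<phi> (x + - \<gamma>) * indicator cell (x + - \<gamma> + \<gamma>)) \<partial>lborel)"
          by (rule nn_integral_translate[symmetric]) measurable
        also have "\<dots> = (\<integral>\<^sup>+x. ennreal (norm (f (x + - \<gamma>) * \<phi> (x + - \<gamma>))) * indicator cell x \<partial>lborel)"
          by (rule nn_integral_cong) (auto simp: indicator_def)
        finally show ?thesis .
      qed
    qed
    also have "\<dots> = (\<integral>\<^sup>+x. norm (f x * \<phi> x) \<partial>lborel)"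
      by (rule nn_integral_unfold[symmetric]) measurable
    also have "\<dots> < \<infinity>"
      using f by (simp add: integrable_iff_bounded)
    finally show "(\<integral>\<^sup>+z. norm (case z of (\<gamma>, x) \<Rightarrow> f x * \<phi> x * indicator cell (x + \<gamma>)) \<partial>(count_space lat \<Otimes>\<^sub>M lborel)) < \<infinity>" .
  qed
  also have "\<dots> = (\<integral>x. f x * \<phi> x \<partial>lborel)"
  proof (rule Bochner_Integration.integral_cong[OF refl])
    fix x
    have "(\<integral>\<gamma>. f x * \<phi> x * indicator cell (x + \<gamma>) \<partial>count_space lat) =
      (\<integral>\<gamma>. f x * \<phi> x * indicator {- base_pt x} \<gamma> \<partial>count_space lat)"
      by (intro Bochner_Integration.integral_cong) (simp_all add: indicator_cell_shift)
    also have "\<dots> = f x * \<phi> x * (\<integral>\<gamma>. complex_of_real (indicat_real {- base_pt x} \<gamma>) \<partial>count_space lat)"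
      by (simp add: of_real_indicator)
    also have "\<dots> = f x * \<phi> x * of_real (\<integral>\<gamma>. indicat_real {- base_pt x} \<gamma> \<partial>count_space lat)"
      by (simp only: integral_complex_of_real)
    also have "\<dots> = f x * \<phi> x"
      using lat_uminus[OF base_pt_lat[of x]]
      by (simp add: measure_count_space)
    finally show "(\<integral>\<gamma>. f x * \<phi> x * indicator cell (x + \<gamma>) \<partial>count_space lat) = f x * \<phi> x" .
  qed
  finally show ?thesis .
qed

end

lemma borel_measurable_periodize [measurable]:
  assumes [measurable]: "f \<in> borel_measurable borel"
  shows "periodize f \<in> borel_measurable borel"
proof -
  interpret sigma_finite_measure "count_space lat" by (rule sigma_finite_lat)
  have "(\<lambda>(x, \<gamma>). f (x + - \<gamma>)) \<in> borel_measurable (borel \<Otimes>\<^sub>M count_space lat)"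
    by (subst measurable_pair_swap_iff, intro measurable_pair_measure_countable1 countable_lat)
       (simp, measurable)
  then have "(\<lambda>x. \<integral>\<gamma>. f (x + - \<gamma>) \<partial>count_space lat) \<in> borel_measurable borel"
    by (rule borel_measurable_lebesgue_integral)
  then show ?thesis by (simp add: periodize_def[abs_def])
qed

end

section \<open>Uniqueness of Fourier coefficients\<close>

text \<open>Functions on the circle tending to the indicator of an open arc are smoothed by distance
  functions and then approximated by polynomials via Stone--Weierstrass.\<close>

lemma cis_2pi_eq_imp:
  assumes "cis (2 * pi * s) = cis (2 * pi * t)" "0 < s" "s < 1" "0 \<le> t" "t \<le> 1"
  shows "s = t"
proof -
  have "cis (2 * pi * (s - t)) = cis (2 * pi * s) / cis (2 * pi * t)"
    by (simp add: cis_divide right_diff_distrib)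
  also have "\<dots> = 1" using assms(1) by simp
  finally have "cos (2 * pi * (s - t)) = 1" by (metis cis.sel(1) one_complex.sel(1))
  then obtain n :: int where "2 * pi * (s - t) = of_int n * 2 * pi" by (auto simp: cos_one_2pi_int)
  then have n: "s - t = of_int n" by simp
  moreover have "-1 < s - t" "s - t < 1" using assms by auto
  ultimately have "n = 0" by linarith
  with n show ?thesis by simp
qed

lemma arc_indicator_polynomial_limit:
  fixes l u :: real
  obtains p :: "nat \<Rightarrow> complex \<Rightarrow> real"
  where "\<And>k. real_polynomial_function (p k)" "\<And>k z. norm z = 1 \<Longrightarrow> \<bar>p k z\<bar> \<le> 2"
    "\<And>s. 0 < s \<Longrightarrow> s < 1 \<Longrightarrow> (\<lambda>k. p k (cis (2 * pi * s))) \<longlonglongrightarrow> (if l < s \<and> s < u then 1 else 0)"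
proof -
  \<comment> \<open>The point 0 keeps \<open>K\<close> nonempty, since the distance to the empty set
    would be 0. It maps to the same point of the circle as 1 and does no harm, because only
    \<open>0 < s < 1\<close> is considered.\<close>
  define S where "S = {0::real} \<union> ({0..1} \<inter> ({..l} \<union> {u..}))"
  define K where "K = (\<lambda>s. cis (2 * pi * s)) ` S"
  have "compact S" unfolding S_def by (intro compact_Un compact_Int_closed) (auto intro: closed_Un)
  then have "compact K" unfolding K_def
    by (intro compact_continuous_image) (auto intro!: continuous_intros simp: cis_conv_exp)
  then have K: "closed K" "K \<noteq> {}" by (auto simp: compact_imp_closed K_def S_def)
  have K_iff: "cis (2 * pi * s) \<in> K \<longleftrightarrow> \<not> (l < s \<and> s < u)" if "0 < s" "s < 1" for s
  proof
    assume "cis (2 * pi * s) \<in> K"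
    then obtain t where t: "t \<in> S" "cis (2 * pi * s) = cis (2 * pi * t)" by (auto simp: K_def)
    then have "s = t" using that by (intro cis_2pi_eq_imp) (auto simp: S_def)
    with t that show "\<not> (l < s \<and> s < u)" by (auto simp: S_def)
  next
    assume "\<not> (l < s \<and> s < u)"
    with that have "s \<in> S" by (auto simp: S_def)
    then show "cis (2 * pi * s) \<in> K" by (auto simp: K_def)
  qed
  \<comment> \<open>Off the closed set \<open>K\<close> the distance is positive, so these
    continuous functions increase to the indicator of the complement of \<open>K\<close>.\<close>
  define \<phi> where "\<phi> k z = min 1 (real k * infdist z K)" for k z
  have "\<exists>g. real_polynomial_function g \<and> (\<forall>z\<in>sphere 0 1. \<bar>\<phi> k z - g z\<bar> < 1 / (real k + 1))" for k
  proof -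
    have "continuous_on (sphere 0 1) (\<phi> k)"
      unfolding \<phi>_def by (intro continuous_intros)
    from Stone_Weierstrass_real_polynomial_function[OF compact_sphere this, of "1 / (real k + 1)"]
    show ?thesis by (metis divide_pos_pos of_nat_0_le_iff zero_less_one add_nonneg_pos)
  qed
  then obtain p where p: "\<And>k. real_polynomial_function (p k)"
    "\<And>k z. norm z = 1 \<Longrightarrow> \<bar>\<phi> k z - p k z\<bar> < 1 / (real k + 1)" by (metis mem_sphere_0)
  show ?thesis
  proof (rule that[of p])
    show "real_polynomial_function (p k)" for k by (rule p)
    show "\<bar>p k z\<bar> \<le> 2" if "norm z = 1" for k z
    proof -
      have "0 \<le> \<phi> k z" "\<phi> k z \<le> 1" by (auto simp: \<phi>_def infdist_nonneg)
      moreover have "1 / (real k + 1) \<le> 1" by simp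
      ultimately show ?thesis using p(2)[OF that, of k] by linarith
    qed
    fix s :: real assume s: "0 < s" "s < 1"
    let ?z = "cis (2 * pi * s)"
    let ?v = "if l < s \<and> s < u then 1 else 0 :: real"
    have "(\<lambda>k. \<phi> k ?z) \<longlonglongrightarrow> ?v"
    proof (cases "l < s \<and> s < u")
      case True
      then have "?z \<notin> K" using K_iff s by auto
      then have d: "0 < infdist ?z K" using K in_closed_iff_infdist_zero[OF K, of ?z] infdist_nonneg[of ?z K] by linarith
      obtain N :: nat where N: "1 / infdist ?z K < real N" using reals_Archimedean2 by blast
      have "\<phi> k ?z = 1" if "N \<le> k" for k
      proof -
        have "1 / infdist ?z K \<le> real k" using N that by linarith
        then have "1 \<le> real k * infdist ?z K" using d by (simp add: pos_divide_le_eq)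
        then show ?thesis by (simp add: \<phi>_def)
      qed
      then have "eventually (\<lambda>k. \<phi> k ?z = ?v) sequentially"
        using True by (auto simp: eventually_sequentially)
      then show ?thesis by (rule tendsto_eventually)
    next
      case False
      then have "?z \<in> K" using K_iff s by auto
      then have "\<phi> k ?z = 0" for k by (simp add: \<phi>_def)
      then show ?thesis by (simp only: False if_False) simp
    qed
    moreover have "(\<lambda>k. \<phi> k ?z - p k ?z) \<longlonglongrightarrow> 0"
    proof (rule Lim_null_comparison)
      show "\<forall>\<^sub>F k in sequentially. norm (\<phi> k ?z - p k ?z) \<le> 1 / (real k + 1)"
        using p(2)[of ?z] by (intro always_eventually allI) (simp add: less_imp_le)
      show "(\<lambda>k. 1 / (real k + 1)) \<longlonglongrightarrow> 0"
        using LIMSEQ_inverse_real_of_nat by (simp add: inverse_eq_divide add.commute)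
    qed
    ultimately show "(\<lambda>k. p k ?z) \<longlonglongrightarrow> ?v"
      using tendsto_diff by fastforce
  qed
qed

section \<open>Characters of the dual lattice and trigonometric polynomials\<close>

context lattice_coords
begin

lemma dual_0 [simp]: "0 \<in> dual_lattice lat"
  by (simp add: dual_lattice_def)

lemma dual_add: "x \<in> dual_lattice lat \<Longrightarrow> y \<in> dual_lattice lat \<Longrightarrow> x + y \<in> dual_lattice lat"
  by (simp add: dual_lattice_def inner_add_right)

lemma dual_uminus: "x \<in> dual_lattice lat \<Longrightarrow> - x \<in> dual_lattice lat"
  by (simp add: dual_lattice_def)

lemma adjoint_dual: "i \<in> Basis \<Longrightarrow> adjoint C i \<in> dual_lattice lat"
  by (simp add: dual_lattice_def lat_def adjoint_works[OF lin])

lemma char_periodic: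
  assumes "\<eta> \<in> dual_lattice lat" "\<gamma> \<in> lat"
  shows "cis (2 * pi * ((x + \<gamma>) \<bullet> \<eta>)) = cis (2 * pi * (x \<bullet> \<eta>))"
  using assms by (auto simp: dual_lattice_def inner_add_left distrib_left cis_mult[symmetric])

text \<open>Finite sums of characters, generated inductively so that closure under products and the
  vanishing of integrals are proved by induction.\<close>

inductive_set trig_polys :: "('a \<Rightarrow> complex) set" where
  char: "\<eta> \<in> dual_lattice lat \<Longrightarrow> (\<lambda>x. c * cis (2 * pi * (x \<bullet> \<eta>))) \<in> trig_polys"
| add: "p \<in> trig_polys \<Longrightarrow> q \<in> trig_polys \<Longrightarrow> (\<lambda>x. p x + q x) \<in> trig_polys"

lemma trig_polys_const: "(\<lambda>x. c) \<in> trig_polys"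
  using trig_polys.char[of 0 c] by simp

lemma trig_polys_mult:
  assumes "p \<in> trig_polys" "q \<in> trig_polys"
  shows "(\<lambda>x. p x * q x) \<in> trig_polys"
  using assms(1)
proof induction
  case (char \<eta> c)
  show ?case using assms(2)
  proof induction
    case (char \<eta>' c')
    have "(\<lambda>x. (c * c') * cis (2 * pi * (x \<bullet> (\<eta> + \<eta>')))) \<in> trig_polys"
      by (intro trig_polys.char dual_add char \<open>\<eta> \<in> dual_lattice lat\<close>)
    then show ?case by (simp add: inner_add_right distrib_left cis_mult[symmetric] mult_ac)
  next
    case (add p q)
    from trig_polys.add[OF add.IH] show ?case by (simp add: distrib_left)
  qed
next
  case (add p' q')
  from trig_polys.add[OF add.IH] show ?case by (simp add: distrib_right)
qed

lemma trig_polys_prod: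
  "(\<And>i. i \<in> I \<Longrightarrow> p i \<in> trig_polys) \<Longrightarrow> (\<lambda>x. \<Prod>i\<in>I. p i x) \<in> trig_polys"
  by (induction I rule: infinite_finite_induct) (auto intro: trig_polys_mult trig_polys_const)

text \<open>On the unit circle a real linear functional is a combination of
  \<open>cis \<theta>\<close> and \<open>cis (- \<theta>)\<close>. With \<theta> the coordinate
  \<open>i\<close> of \<open>C x\<close> times \<open>2 * pi\<close>, these are the characters of
  \<open>adjoint C i\<close> and its negative; products and sums then give all polynomials.\<close>

lemma trig_polys_polynomial:
  assumes "real_polynomial_function p" "i \<in> Basis"
  shows "(\<lambda>x. of_real (p (cis (2 * pi * (C x \<bullet> i))))) \<in> trig_polys"
  using assms(1)
proof induction
  case (linear f)
  interpret bounded_linear f by fact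
  define a b where "a = complex_of_real (f 1)" and "b = complex_of_real (f \<i>)"
  have fz: "complex_of_real (f (cis \<theta>)) = (a - \<i> * b) / 2 * cis \<theta> + (a + \<i> * b) / 2 * cis (- \<theta>)" for \<theta>
  proof -
    have "cis \<theta> = cos \<theta> *\<^sub>R 1 + sin \<theta> *\<^sub>R \<i>" by (simp add: complex_eq_iff)
    then have "f (cis \<theta>) = f (cos \<theta> *\<^sub>R 1 + sin \<theta> *\<^sub>R \<i>)" by simp
    also have "\<dots> = cos \<theta> * f 1 + sin \<theta> * f \<i>" by (simp only: add scaleR real_scaleR_def)
    finally show ?thesis by (simp add: a_def b_def complex_eq_iff field_simps)
  qed
  have "(\<lambda>x. (a - \<i> * b) / 2 * cis (2 * pi * (x \<bullet> adjoint C i)) +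
    (a + \<i> * b) / 2 * cis (2 * pi * (x \<bullet> (- adjoint C i)))) \<in> trig_polys"
    by (intro trig_polys.add trig_polys.char dual_uminus adjoint_dual assms)
  then show ?case by (simp add: fz adjoint_works[OF lin])
next
  case (const c)
  show ?case by (rule trig_polys_const)
next
  case (add f g)
  from trig_polys.add[OF add.IH] show ?case by simp
next
  case (mult f g)
  from trig_polys_mult[OF mult.IH] show ?case by simp
qed

lemma borel_measurable_char [measurable]: "(\<lambda>x::'a. cis (2 * pi * (x \<bullet> \<eta>))) \<in> borel_measurable borel"
  by measurable

lemma integral_trig_poly_eq_0:
  assumes f: "integrable lborel f" and 0: "\<And>\<eta>. \<eta> \<in> dual_lattice lat \<Longrightarrow> fourier f \<eta> = 0"
    and "p \<in> trig_polys"
  shows "integrable lborel (\<lambda>x. f x * p x) \<and> (\<integral>x. f x * p x \<partial>lborel) = 0"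
  using assms(3)
proof induction
  case (char \<eta> c)
  have i: "integrable lborel (\<lambda>x. f x * cis (2 * pi * (x \<bullet> \<eta>)))"
    by (rule Bochner_Integration.integrable_bound[OF f]) (use f in \<open>auto simp: norm_mult\<close>)
  have "(\<integral>x. f x * cis (2 * pi * (x \<bullet> \<eta>)) \<partial>lborel) = fourier f (- \<eta>)"
    by (simp add: fourier_def)
  also have "\<dots> = 0" using 0 char dual_uminus by blast
  finally show ?case using i by (simp add: mult.left_commute[of _ c])
qed (simp add: distrib_left)

text \<open>Coordinate hyperplanes are null sets. The approximants of arc indicators converge only
  for coordinates strictly between 0 and 1, whereas the half-open cell contains faces with a
  coordinate 0.\<close>

lemma AE_coord_nonzero: "AE x in lborel. \<forall>i\<in>Basis. C x \<bullet> i \<noteq> 0"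
proof (subst AE_ball_countable)
  show "countable (Basis :: 'a set)" by (simp add: countable_finite)
  show "\<forall>i\<in>Basis. AE x in lborel. C x \<bullet> i \<noteq> 0"
  proof
    fix i :: 'a assume i: "i \<in> Basis"
    have "C (inv C i) \<bullet> i = 1" using i by simp
    then have "inv C i \<bullet> adjoint C i = 1" by (simp add: adjoint_works[OF lin])
    then have "adjoint C i \<noteq> 0" by auto
    then have "negligible {x. adjoint C i \<bullet> x = 0}" by (intro negligible_hyperplane) auto
    then have "AE x in lebesgue. x \<notin> {x. adjoint C i \<bullet> x = 0}"
      by (intro AE_not_in) (simp add: negligible_iff_null_sets)
    then have "AE x in lborel. x \<notin> {x. adjoint C i \<bullet> x = 0}"
      by (simp add: AE_completion_iff)
    then show "AE x in lborel. C x \<bullet> i \<noteq> 0"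
      by eventually_elim (auto simp: adjoint_works[OF lin] inner_commute)
  qed
qed

text \<open>The product over the coordinates of the approximants of arc indicators is a
  trigonometric polynomial. It is bounded by \<open>2 ^ DIM('a)\<close>, as each factor is bounded
  by 2, and tends to the box indicator almost everywhere on the cell; outside the cell
  \<open>f\<close> vanishes.\<close>

lemma integral_box_eq_0:
  assumes f: "integrable lborel f" and supp: "\<And>x. x \<notin> cell \<Longrightarrow> f x = 0"
    and 0: "\<And>\<eta>. \<eta> \<in> dual_lattice lat \<Longrightarrow> fourier f \<eta> = 0"
  shows "(\<integral>x. f x * indicator (box l u) (C x) \<partial>lborel) = 0"
proof -
  have "\<forall>i. \<exists>p. (\<forall>k. real_polynomial_function (p k)) \<and> (\<forall>k z. norm z = 1 \<longrightarrow> \<bar>p k z\<bar> \<le> 2) \<and>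
    (\<forall>s. 0 < s \<longrightarrow> s < 1 \<longrightarrow> (\<lambda>k. p k (cis (2 * pi * s))) \<longlonglongrightarrow> (if l \<bullet> i < s \<and> s < u \<bullet> i then 1 else 0))"
    using arc_indicator_polynomial_limit by metis
  then obtain p :: "'a \<Rightarrow> nat \<Rightarrow> complex \<Rightarrow> real" where p: "\<And>i k. real_polynomial_function (p i k)"
    "\<And>i k z. norm z = 1 \<Longrightarrow> \<bar>p i k z\<bar> \<le> 2"
    "\<And>i s. 0 < s \<Longrightarrow> s < 1 \<Longrightarrow> (\<lambda>k. p i k (cis (2 * pi * s))) \<longlonglongrightarrow> (if l \<bullet> i < s \<and> s < u \<bullet> i then 1 else 0)"
    by metis
  define P where "P k x = (\<Prod>i\<in>Basis. complex_of_real (p i k (cis (2 * pi * (C x \<bullet> i)))))" for k x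
  have "P k \<in> trig_polys" for k
    unfolding P_def by (intro trig_polys_prod trig_polys_polynomial p)
  note P0 = integral_trig_poly_eq_0[OF f 0 this]
  have "(\<lambda>k. \<integral>x. f x * P k x \<partial>lborel) \<longlonglongrightarrow> (\<integral>x. f x * indicator (box l u) (C x) \<partial>lborel)"
  proof (rule integral_dominated_convergence)
    have [measurable]: "f \<in> borel_measurable borel" using f by auto
    show "(\<lambda>x. f x * indicator (box l u) (C x)) \<in> borel_measurable lborel" by measurable
    show "(\<lambda>x. f x * P k x) \<in> borel_measurable lborel" for k using P0[of k] by auto
    show "integrable lborel (\<lambda>x. norm (f x) * 2 ^ DIM('a))" using f by auto
    show "AE x in lborel. norm (f x * P k x) \<le> norm (f x) * 2 ^ DIM('a)" for k
    proof (intro always_eventually allI)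
      fix x
      have "norm (P k x) \<le> (\<Prod>i\<in>(Basis::'a set). 2)"
        unfolding P_def prod_norm[symmetric] by (intro prod_mono) (auto simp: p(2))
      then show "norm (f x * P k x) \<le> norm (f x) * 2 ^ DIM('a)"
        by (simp add: norm_mult mult_left_mono)
    qed
    show "AE x in lborel. (\<lambda>k. f x * P k x) \<longlonglongrightarrow> f x * indicator (box l u) (C x)"
      using AE_coord_nonzero
    proof eventually_elim
      case (elim x)
      show ?case
      proof (cases "x \<in> cell")
        case True
        then have "0 < C x \<bullet> i \<and> C x \<bullet> i < 1" if "i \<in> Basis" for i
          using elim that by (auto simp: cell_def less_le)
        then have "(\<lambda>k. P k x) \<longlonglongrightarrow> (\<Prod>i\<in>Basis. complex_of_real (if l \<bullet> i < C x \<bullet> i \<and> C x \<bullet> i < u \<bullet> i then 1 else 0))"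
          unfolding P_def by (intro tendsto_prod tendsto_of_real p(3)) auto
        also have "(\<Prod>i\<in>Basis. complex_of_real (if l \<bullet> i < C x \<bullet> i \<and> C x \<bullet> i < u \<bullet> i then 1 else 0)) = indicator (box l u) (C x)"
        proof (cases "C x \<in> box l u")
          case True
          then show ?thesis by (simp add: mem_box)
        next
          case False
          then obtain i where "i \<in> Basis" "\<not> (l \<bullet> i < C x \<bullet> i \<and> C x \<bullet> i < u \<bullet> i)" by (auto simp: mem_box)
          then have "(\<Prod>i\<in>Basis. complex_of_real (if l \<bullet> i < C x \<bullet> i \<and> C x \<bullet> i < u \<bullet> i then 1 else 0)) = 0"
            by (intro prod_zero) auto
          then show ?thesis using False by simp
        qed
        finally show ?thesis by (intro tendsto_intros)
      qed (simp add: supp)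
    qed
  qed
  then show ?thesis using P0 by (simp add: LIMSEQ_const_iff)
qed

text \<open>The positive and the negative part of \<open>g\<close>, pushed forward by
  \<open>C\<close>, are finite measures that agree on the open boxes, an intersection-stable
  generator of the Borel sets; hence they coincide.\<close>

lemma AE_eq_0_of_boxes:
  fixes g :: "'a \<Rightarrow> real"
  assumes g: "integrable lborel g" and 0: "\<And>l u. (\<integral>x. g x * indicator (box l u) (C x) \<partial>lborel) = 0"
  shows "AE x in lborel. g x = 0"
proof -
  have [measurable]: "g \<in> borel_measurable borel" using g by auto
  have [measurable]: "inv C \<in> borel_measurable borel"
    using lin_inv by (intro borel_measurable_continuous_onI linear_continuous_on) (simp add: linear_conv_bounded_linear)
  \<comment> \<open>The conversion to \<open>ennreal\<close> sends negative values to 0, so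
    \<open>M g\<close> and \<open>M (\<lambda>x. - g x)\<close> carry the positive and the negative
    part of \<open>g\<close> as densities.\<close>
  define M where "M h = distr (density lborel (\<lambda>x. ennreal (h x))) borel C" for h :: "'a \<Rightarrow> real"
  have em: "emeasure (M h) B = (\<integral>\<^sup>+x. ennreal (h x) * indicator B (C x) \<partial>lborel)"
    if [measurable]: "h \<in> borel_measurable borel" "B \<in> sets borel" for h B
    unfolding M_def
    by (subst emeasure_distr, simp, simp, subst emeasure_density) (auto intro!: nn_integral_cong simp: indicator_def measurable_sets_borel[OF borel_C])
  have em': "emeasure (M h) B = ennreal (\<integral>x. max 0 (h x) * indicator B (C x) \<partial>lborel)"
    if h: "integrable lborel h" and [measurable]: "B \<in> sets borel" for h B
  proof -
    have [measurable]: "h \<in> borel_measurable borel" using h by auto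
    have "emeasure (M h) B = (\<integral>\<^sup>+x. ennreal (max 0 (h x) * indicator B (C x)) \<partial>lborel)"
      by (subst em) (auto intro!: nn_integral_cong simp: indicator_def max_def ennreal_neg)
    also have "\<dots> = ennreal (\<integral>x. max 0 (h x) * indicator B (C x) \<partial>lborel)"
    proof (rule nn_integral_eq_integral)
      show "integrable lborel (\<lambda>x. max 0 (h x) * indicator B (C x))"
        by (rule Bochner_Integration.integrable_bound[OF h]) (auto simp: indicator_def)
    qed auto
    finally show ?thesis .
  qed
  have Meq: "M g = M (\<lambda>x. - g x)"
  proof (rule measure_eqI_generator_eq)
    let ?E = "range (\<lambda>(a, b). box a b::'a set)"
    show "Int_stable ?E" by (auto simp: Int_stable_def box_Int_box)
    show "?E \<subseteq> Pow UNIV" "sets (M g) = sigma_sets UNIV ?E" "sets (M (\<lambda>x. - g x)) = sigma_sets UNIV ?E"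
      by (simp_all add: borel_eq_box M_def)
    let ?A = "\<lambda>n::nat. box (- (real n *\<^sub>R One)) (real n *\<^sub>R One) :: 'a set"
    show "range ?A \<subseteq> ?E" "(\<Union>i. ?A i) = UNIV"
      unfolding UN_box_eq_UNIV by auto
    show "emeasure (M g) (?A i) \<noteq> \<infinity>" for i using g by (subst em') auto
    show "emeasure (M g) X = emeasure (M (\<lambda>x. - g x)) X" if "X \<in> ?E" for X
    proof -
      from that obtain l u where X: "X = box l u" by auto
      have i: "integrable lborel (\<lambda>x. max 0 (g x) * indicator X (C x))"
        "integrable lborel (\<lambda>x. max 0 (- g x) * indicator X (C x))"
        by (rule Bochner_Integration.integrable_bound[OF g]; auto simp: indicator_def X)+
      have "(\<integral>x. max 0 (g x) * indicator X (C x) \<partial>lborel) - (\<integral>x. max 0 (- g x) * indicator X (C x) \<partial>lborel)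
         = (\<integral>x. max 0 (g x) * indicator X (C x) - max 0 (- g x) * indicator X (C x) \<partial>lborel)"
        using i by simp
      also have "\<dots> = (\<integral>x. g x * indicator X (C x) \<partial>lborel)"
        by (rule Bochner_Integration.integral_cong) (auto simp: indicator_def)
      also have "\<dots> = 0" by (simp add: X 0)
      finally show ?thesis using g by (simp add: em' X)
    qed
  qed
  have AE: "AE x in lborel. h x \<le> 0" if "M h = M (\<lambda>x. - h x)" and [measurable]: "h \<in> borel_measurable borel" for h :: "'a \<Rightarrow> real"
  proof -
    \<comment> \<open>The image under \<open>C\<close> of the set where \<open>h\<close> is
      positive. On that set the density of the other measure is 0, so the first measure vanishes
      there too.\<close>
    define B where "B = inv C -` {x \<in> space borel. 0 < h x} \<inter> space borel"
    have [measurable]: "B \<in> sets borel" unfolding B_def by (rule measurable_sets) measurable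
    have ind: "indicator B (C x) = (if 0 < h x then 1 else 0 :: ennreal)" for x
      by (simp add: B_def indicator_def)
    have "(\<integral>\<^sup>+x. ennreal (h x) * indicator B (C x) \<partial>lborel) = (\<integral>\<^sup>+x. ennreal (- h x) * indicator B (C x) \<partial>lborel)"
      using that(1) em[of h B] em[of "\<lambda>x. - h x" B] by simp
    also have "\<dots> = (\<integral>\<^sup>+x. 0 \<partial>(lborel :: 'a measure))"
      by (rule nn_integral_cong) (auto simp: ind ennreal_neg)
    finally have "AE x in lborel. ennreal (h x) * indicator B (C x) = 0"
      by (subst nn_integral_0_iff_AE[symmetric]) auto
    then show ?thesis
      by eventually_elim (auto simp: ind split: if_splits)
  qed
  have "AE x in lborel. g x \<le> 0" by (rule AE) (use Meq in auto)
  moreover have "AE x in lborel. - g x \<le> 0" by (rule AE) (use Meq in auto)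
  ultimately show ?thesis by eventually_elim auto
qed

text \<open>Real and imaginary parts are separated because the comparison of measures handles real
  densities.\<close>

lemma fourier_unique_0:
  assumes f: "integrable lborel f" and supp: "\<And>x. x \<notin> cell \<Longrightarrow> f x = 0"
    and 0: "\<And>\<eta>. \<eta> \<in> dual_lattice lat \<Longrightarrow> fourier f \<eta> = 0"
  shows "AE x in lborel. f x = 0"
proof -
  have i: "integrable lborel (\<lambda>x. f x * indicator (box l u) (C x))" for l u
    by (rule Bochner_Integration.integrable_bound[OF f]) (use f in \<open>auto simp: indicator_def\<close>)
  have z: "(\<integral>x. f x * indicator (box l u) (C x) \<partial>lborel) = 0" for l u
    by (rule integral_box_eq_0[OF f supp 0])
  have "AE x in lborel. Re (f x) = 0"
  proof (rule AE_eq_0_of_boxes)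
    show "(\<integral>x. Re (f x) * indicator (box l u) (C x) \<partial>lborel) = 0" for l u
    proof -
      have "(\<integral>x. Re (f x) * indicator (box l u) (C x) \<partial>lborel) = (\<integral>x. Re (f x * indicator (box l u) (C x)) \<partial>lborel)"
        by (rule Bochner_Integration.integral_cong) (auto simp: indicator_def)
      also have "\<dots> = Re (\<integral>x. f x * indicator (box l u) (C x) \<partial>lborel)" by (rule integral_Re[OF i])
      finally show ?thesis by (simp add: z)
    qed
  qed (use f in auto)
  moreover have "AE x in lborel. Im (f x) = 0"
  proof (rule AE_eq_0_of_boxes)
    show "(\<integral>x. Im (f x) * indicator (box l u) (C x) \<partial>lborel) = 0" for l u
    proof -
      have "(\<integral>x. Im (f x) * indicator (box l u) (C x) \<partial>lborel) = (\<integral>x. Im (f x * indicator (box l u) (C x)) \<partial>lborel)"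
        by (rule Bochner_Integration.integral_cong) (auto simp: indicator_def)
      also have "\<dots> = Im (\<integral>x. f x * indicator (box l u) (C x) \<partial>lborel)" by (rule integral_Im[OF i])
      finally show ?thesis by (simp add: z)
    qed
  qed (use f in auto)
  ultimately show ?thesis by eventually_elim (simp add: complex_eq_iff)
qed

section \<open>Orthogonality of characters over a cell\<close>

lemma integral_count_lat_single:
  "a \<in> lat \<Longrightarrow> (\<integral>\<gamma>. indicator {a} \<gamma> \<partial>count_space lat) = (1 :: complex)"
proof -
  assume "a \<in> lat"
  have "(\<integral>\<gamma>. indicator {a} \<gamma> \<partial>count_space lat) =
    (\<integral>\<gamma>. complex_of_real (indicat_real {a} \<gamma>) \<partial>count_space lat)"
    by (simp add: of_real_indicator)
  also have "\<dots> = of_real (\<integral>\<gamma>. indicat_real {a} \<gamma> \<partial>count_space lat)"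
    by (simp only: integral_complex_of_real)
  also have "\<dots> = 1" using \<open>a \<in> lat\<close> by (simp add: measure_count_space)
  finally show ?thesis .
qed

text \<open>For \<eta> different from 0, a shift by \<open>s\<close> with
  \<open>s \<bullet> \<eta> = 1 / 2\<close> changes the sign of the character, whereas the integral
  of a periodic function over a cell does not change when the cell is shifted. So the integral
  equals its negative.\<close>

lemma integral_char_cell:
  assumes "\<eta> \<in> dual_lattice lat"
  shows "(\<integral>x. cis (2 * pi * (x \<bullet> \<eta>)) * indicator cell x \<partial>lborel) = (if \<eta> = 0 then of_real covol else 0)"
proof (cases "\<eta> = 0")
  case True
  have "(\<integral>x. complex_of_real (indicat_real cell x) \<partial>lborel) = of_real covol"
    by (simp only: integral_complex_of_real) (simp add: covol_def)
  then show ?thesis using True by (simp add: of_real_indicator)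
next
  case False
  define s where "s = (1 / (2 * (\<eta> \<bullet> \<eta>))) *\<^sub>R \<eta>"
  have s: "s \<bullet> \<eta> = 1 / 2" using False by (simp add: s_def)
  let ?\<phi> = "\<lambda>x. cis (2 * pi * (x \<bullet> \<eta>))"
  let ?I = "\<integral>x. ?\<phi> x * indicator cell x \<partial>lborel"
  have int: "integrable lborel (\<lambda>x. indicator cell x * ?\<phi> (x + s))"
  proof (rule Bochner_Integration.integrable_bound)
    show "integrable lborel (indicat_real cell)"
      using emeasure_cell_finite by (intro integrable_real_indicator) auto
  qed (auto simp: indicator_def)
  have "?I = (\<integral>x. 1 * ?\<phi> x * indicator cell x \<partial>lborel)" by simp
  \<comment> \<open>The shifted cell is a fundamental domain too: its indicator has a periodization
    that is identically 1, and unfolding transfers the integral to it.\<close>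
  also have "\<dots> = (\<integral>x. periodize (\<lambda>x. indicator cell (x + - s)) x * ?\<phi> x * indicator cell x \<partial>lborel)"
  proof (rule Bochner_Integration.integral_cong[OF refl])
    fix x
    have "periodize (\<lambda>x. indicator cell (x + - s)) x = (\<integral>\<gamma>. indicator {base_pt (x - s)} \<gamma> \<partial>count_space lat)"
      unfolding periodize_def
      by (rule Bochner_Integration.integral_cong)
         (use in_cell_iff[of _ "x - s"] in \<open>auto simp: indicator_def algebra_simps\<close>)
    then show "1 * ?\<phi> x * indicator cell x = periodize (\<lambda>x. indicator cell (x + - s)) x * ?\<phi> x * indicator cell x"
      by (simp add: integral_count_lat_single base_pt_lat)
  qed
  also have "\<dots> = (\<integral>x. indicator cell (x + - s) * ?\<phi> x \<partial>lborel)"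
  proof (rule periodize_integral)
    show "integrable lborel (\<lambda>x. indicator cell (x + - s) * ?\<phi> x)"
      using integrable_translate[OF int, of "- s"] by simp
    show "?\<phi> (x + - \<gamma>) = ?\<phi> x" if "\<gamma> \<in> lat" for x \<gamma>
      by (rule char_periodic[OF assms lat_uminus[OF that]])
  qed measurable
  also have "\<dots> = (\<integral>x. indicator cell x * ?\<phi> (x + s) \<partial>lborel)"
    using integral_translate[of "\<lambda>x. indicator cell x * ?\<phi> (x + s)" "- s"] by simp
  also have "\<dots> = (\<integral>x. (- 1) * (?\<phi> x * indicator cell x) \<partial>lborel)"
    by (rule Bochner_Integration.integral_cong)
       (auto simp: inner_add_left distrib_left cis_mult[symmetric] s)
  also have "\<dots> = - ?I" by simp
  finally show ?thesis using False by simp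
qed

end

section \<open>Parseval's identity\<close>

text \<open>Completeness of L1 for sequences with summable increments: the telescoping series
  converges absolutely almost everywhere, and the tails of the increments bound the distance to its
  sum.\<close>

lemma L1_convergent:
  fixes f :: "nat \<Rightarrow> 'a \<Rightarrow> 'b::{banach, second_countable_topology}"
  assumes f: "\<And>k. integrable M (f k)"
    and sum: "summable (\<lambda>k. \<integral>x. norm (f (Suc k) x - f k x) \<partial>M)"
  obtains g where "integrable M g" "AE x in M. (\<lambda>k. f k x) \<longlonglongrightarrow> g x"
    "(\<lambda>k. \<integral>x. norm (f k x - g x) \<partial>M) \<longlonglongrightarrow> 0"
    "\<And>k. (\<integral>x. norm (f k x - g x) \<partial>M) \<le> (\<Sum>j. \<integral>x. norm (f (Suc (j + k)) x - f (j + k) x) \<partial>M)"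
proof -
  define d where "d k x = f (Suc k) x - f k x" for k x
  have d: "integrable M (d k)" for k unfolding d_def using f by auto
  have sum_d: "summable (\<lambda>k. \<integral>x. norm (d k x) \<partial>M)" using sum by (simp add: d_def)
  have fin: "(\<Sum>k. \<integral>\<^sup>+x. norm (d k x) \<partial>M) < \<infinity>"
  proof -
    have "(\<Sum>k. \<integral>\<^sup>+x. norm (d k x) \<partial>M) = (\<Sum>k. ennreal (\<integral>x. norm (d k x) \<partial>M))"
      using d by (intro suminf_cong nn_integral_eq_integral) auto
    also have "\<dots> < \<infinity>" using sum_d by (simp add: ennreal_suminf_neq_top less_top[symmetric])
    finally show ?thesis .
  qed
  have [measurable]: "f k \<in> borel_measurable M" "d k \<in> borel_measurable M" for k using f d by auto
  have "(\<integral>\<^sup>+x. (\<Sum>k. ennreal (norm (d k x))) \<partial>M) < \<infinity>"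
    using fin by (subst nn_integral_suminf) auto
  then have "AE x in M. (\<Sum>k. ennreal (norm (d k x))) \<noteq> \<infinity>"
    by (intro nn_integral_noteq_infinite) auto
  then have AEs: "AE x in M. summable (\<lambda>k. norm (d k x))"
    by eventually_elim (auto intro: summable_suminf_not_top)
  define g where "g x = f 0 x + (\<Sum>k. d k x)" for x
  have g: "integrable M g"
    unfolding g_def by (intro Bochner_Integration.integrable_add f integrable_suminf[OF d AEs sum_d])
  have tele: "(\<Sum>j<k. d j x) = f k x - f 0 x" for k x
    unfolding d_def by (rule sum_lessThan_telescope)
  have lim: "AE x in M. (\<lambda>k. f k x) \<longlonglongrightarrow> g x"
    using AEs
  proof eventually_elim
    case (elim x)
    then have "(\<lambda>k. \<Sum>j<k. d j x) \<longlonglongrightarrow> (\<Sum>k. d k x)"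
      by (rule summable_LIMSEQ[OF summable_norm_cancel])
    from tendsto_add[OF tendsto_const[of "f 0 x"] this] show ?case by (simp add: tele g_def)
  qed
  have le: "(\<integral>x. norm (f k x - g x) \<partial>M) \<le> (\<Sum>j. \<integral>x. norm (d (j + k) x) \<partial>M)" for k
  proof -
    have AEs': "AE x in M. summable (\<lambda>j. norm (d (j + k) x))"
      using AEs by eventually_elim (subst summable_iff_shift)
    have sd': "summable (\<lambda>j. \<integral>x. norm (d (j + k) x) \<partial>M)"
      using sum_d by (subst summable_iff_shift)
    have AEs'': "AE x in M. summable (\<lambda>j. norm (norm (d (j + k) x)))" using AEs' by simp
    have sd'': "summable (\<lambda>j. \<integral>x. norm (norm (d (j + k) x)) \<partial>M)" using sd' by simp
    have dn: "integrable M (\<lambda>x. norm (d (j + k) x))" for j using d by auto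
    have "(\<integral>x. norm (f k x - g x) \<partial>M) \<le> (\<integral>x. (\<Sum>j. norm (d (j + k) x)) \<partial>M)"
    proof (rule integral_mono_AE)
      show "integrable M (\<lambda>x. norm (f k x - g x))" using f g by auto
      show "integrable M (\<lambda>x. \<Sum>j. norm (d (j + k) x))"
        by (rule integrable_suminf[OF dn AEs'' sd''])
      show "AE x in M. norm (f k x - g x) \<le> (\<Sum>j. norm (d (j + k) x))"
        using AEs AEs'
      proof eventually_elim
        case (elim x)
        have "(\<Sum>k. d k x) = (\<Sum>j. d (j + k) x) + (\<Sum>j<k. d j x)"
          by (rule suminf_split_initial_segment[OF summable_norm_cancel[OF elim(1)]])
        then have "g x - f k x = (\<Sum>j. d (j + k) x)" by (simp add: g_def tele)
        then show ?case using summable_norm[OF elim(2)] by (simp add: norm_minus_commute)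
      qed
    qed
    also have "\<dots> = (\<Sum>j. \<integral>x. norm (d (j + k) x) \<partial>M)"
      by (rule integral_suminf[OF dn AEs'' sd''])
    finally show ?thesis .
  qed
  have "(\<lambda>k. \<integral>x. norm (f k x - g x) \<partial>M) \<longlonglongrightarrow> 0"
  proof (rule Lim_null_comparison)
    show "\<forall>\<^sub>F k in sequentially. norm (\<integral>x. norm (f k x - g x) \<partial>M) \<le> (\<Sum>j. \<integral>x. norm (d (j + k) x) \<partial>M)"
      using le by (intro always_eventually allI) (simp add: integral_nonneg_AE)
    show "(\<lambda>k. \<Sum>j. \<integral>x. norm (d (j + k) x) \<partial>M) \<longlonglongrightarrow> 0"
      by (rule suminf_exist_split2[OF sum_d])
  qed
  with g lim le show ?thesis by (intro that[of g]) (auto simp: d_def)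
qed

lemma norm_fourier_le: "norm (fourier f \<eta>) \<le> (\<integral>x. norm (f x) \<partial>lborel)"
proof -
  have "norm (fourier f \<eta>) \<le> (\<integral>x. norm (f x * cis (- (2 * pi * (x \<bullet> \<eta>)))) \<partial>lborel)"
    unfolding fourier_def by (rule integral_norm_bound)
  then show ?thesis by (simp add: norm_mult)
qed

lemma fourier_integrable:
  assumes "integrable lborel f"
  shows "integrable lborel (\<lambda>x. f x * cis (- (2 * pi * (x \<bullet> \<eta>))))"
  by (rule Bochner_Integration.integrable_bound[OF assms]) (use assms in \<open>auto simp: norm_mult\<close>)

lemma fourier_diff:
  "integrable lborel f \<Longrightarrow> integrable lborel g \<Longrightarrow> fourier (\<lambda>x. f x - g x) \<eta> = fourier f \<eta> - fourier g \<eta>"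
  unfolding fourier_def left_diff_distrib by (intro Bochner_Integration.integral_diff fourier_integrable)

lemma fourier_translate:
  assumes [measurable]: "u \<in> borel_measurable borel"
  shows "fourier (\<lambda>x. u (x + z)) \<eta> = cis (2 * pi * (z \<bullet> \<eta>)) * fourier u \<eta>"
proof -
  have "fourier (\<lambda>x. u (x + z)) \<eta> = (\<integral>x. cis (2 * pi * (z \<bullet> \<eta>)) * (u (x + z) * cis (- (2 * pi * ((x + z) \<bullet> \<eta>)))) \<partial>lborel)"
    unfolding fourier_def
    by (rule Bochner_Integration.integral_cong)
       (auto simp: inner_add_left distrib_left cis_mult mult.left_commute[of _ "u _"])
  also have "\<dots> = cis (2 * pi * (z \<bullet> \<eta>)) * fourier u \<eta>"
    unfolding fourier_def
    using integral_translate[of "\<lambda>x. u x * cis (- (2 * pi * (x \<bullet> \<eta>)))" z] by simp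
  finally show ?thesis .
qed

context lattice_coords
begin

text \<open>Cauchy--Schwarz against the indicator of the cell, whose L2 norm is
  \<open>sqrt covol\<close>.\<close>

lemma Lp_2_cell_integrable:
  assumes "u \<in> Lp 2" "\<And>x. x \<notin> cell \<Longrightarrow> u x = 0"
  shows "integrable lborel u"
    "(\<integral>x. norm (u x) \<partial>lborel) \<le> sqrt covol * Lp_norm 2 u"
proof -
  have 1: "(indicator cell :: 'a \<Rightarrow> complex) \<in> Lp 2"
  proof -
    have "integrable lborel (indicat_real cell)"
      using emeasure_cell_finite by (intro integrable_real_indicator) auto
    moreover have "(norm (indicator cell x :: complex))\<^sup>2 = indicat_real cell x" for x
      by (simp add: indicator_def)
    ultimately show ?thesis by (simp add: Lp_2_iff)
  qed
  have norm1: "Lp_norm 2 (indicator cell :: 'a \<Rightarrow> complex) = sqrt covol"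
  proof -
    have "(norm (indicator cell x :: complex))\<^sup>2 = indicat_real cell x" for x
      by (simp add: indicator_def)
    then show ?thesis by (simp add: Lp_norm_2 covol_def)
  qed
  have eq: "norm (indicator cell x :: complex) * norm (u x) = norm (u x)" for x
    using assms(2)[of x] by (auto simp: indicator_def)
  have "u \<in> borel_measurable lborel" using assms by (simp add: Lp_2_iff)
  then show "integrable lborel u"
    using Lp_2_mult_integrable_norm[OF 1 assms(1)] unfolding eq by (simp only: integrable_norm_iff)
  show "(\<integral>x. norm (u x) \<partial>lborel) \<le> sqrt covol * Lp_norm 2 u"
    using Lp_2_Cauchy_Schwarz[OF 1 assms(1)] unfolding eq norm1 .
qed

definition tile_char :: "'a \<Rightarrow> 'a \<Rightarrow> complex" where
  "tile_char \<eta> x = cis (2 * pi * (x \<bullet> \<eta>)) * indicator cell x"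

lemma tile_char_Lp_2: "tile_char \<eta> \<in> Lp 2"
proof (rule Lp_2_bound)
  show "(indicator cell :: 'a \<Rightarrow> complex) \<in> Lp 2"
  proof -
    have "integrable lborel (indicat_real cell)"
      using emeasure_cell_finite by (intro integrable_real_indicator) auto
    moreover have "(norm (indicator cell x :: complex))\<^sup>2 = indicat_real cell x" for x
      by (simp add: indicator_def)
    ultimately show ?thesis by (simp add: Lp_2_iff)
  qed
qed (auto simp: tile_char_def[abs_def] norm_mult)

lemma L2_inner_tile_char:
  assumes "\<And>x. x \<notin> cell \<Longrightarrow> u x = 0"
  shows "L2_inner u (tile_char \<eta>) = fourier u \<eta>"
  unfolding L2_inner_def fourier_def
  by (rule Bochner_Integration.integral_cong) (use assms in \<open>auto simp: tile_char_def cis_cnj indicator_def\<close>)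

lemma L2_inner_tile_chars:
  assumes "\<eta> \<in> dual_lattice lat" "\<eta>' \<in> dual_lattice lat"
  shows "L2_inner (tile_char \<eta>) (tile_char \<eta>') = (if \<eta> = \<eta>' then of_real covol else 0)"
proof -
  have "\<eta> - \<eta>' \<in> dual_lattice lat" using dual_add[OF assms(1) dual_uminus[OF assms(2)]] by simp
  have "L2_inner (tile_char \<eta>) (tile_char \<eta>') = (\<integral>x. cis (2 * pi * (x \<bullet> (\<eta> - \<eta>'))) * indicator cell x \<partial>lborel)"
    unfolding L2_inner_def
    by (rule Bochner_Integration.integral_cong)
       (auto simp: tile_char_def cis_cnj cis_mult inner_diff_right right_diff_distrib indicator_def)
  then show ?thesis using integral_char_cell[OF \<open>\<eta> - \<eta>' \<in> dual_lattice lat\<close>] by simp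
qed

context
  fixes u :: "'a \<Rightarrow> complex"
  assumes u: "u \<in> Lp 2" and supp: "\<And>x. x \<notin> cell \<Longrightarrow> u x = 0"
begin

text \<open>The division accounts for the squared norm \<open>covol\<close> of each
  \<open>tile_char\<close>; for finite \<open>F\<close> in the dual lattice this is the orthogonal
  projection of \<open>u\<close> onto the span of the characters in \<open>F\<close>.\<close>

definition fourier_sum :: "'a set \<Rightarrow> 'a \<Rightarrow> complex" where
  "fourier_sum F x = (\<Sum>\<eta>\<in>F. fourier u \<eta> / of_real covol * tile_char \<eta> x)"

lemma fourier_sum_Lp_2: "fourier_sum F \<in> Lp 2"
  unfolding fourier_sum_def[abs_def] by (intro Lp_2_sum Lp_2_scale tile_char_Lp_2)

lemma fourier_fourier_sum:
  assumes "finite F" "F \<subseteq> dual_lattice lat" "\<eta> \<in> dual_lattice lat"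
  shows "fourier (fourier_sum F) \<eta> = (if \<eta> \<in> F then fourier u \<eta> else 0)"
proof -
  have "fourier (fourier_sum F) \<eta> = L2_inner (fourier_sum F) (tile_char \<eta>)"
    by (rule L2_inner_tile_char[symmetric]) (simp add: fourier_sum_def tile_char_def)
  also have "\<dots> = (\<Sum>\<eta>'\<in>F. fourier u \<eta>' / of_real covol * L2_inner (tile_char \<eta>') (tile_char \<eta>))"
    unfolding fourier_sum_def[abs_def]
    by (subst L2_inner_sum_left) (auto intro!: Lp_2_scale tile_char_Lp_2 simp: L2_inner_scale_left
        simp del: times_divide_eq_left times_divide_eq_right)
  also have "\<dots> = (\<Sum>\<eta>'\<in>F. if \<eta> = \<eta>' then fourier u \<eta> else 0)"
    using assms covol_pos by (intro sum.cong refl) (auto simp: L2_inner_tile_chars)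
  finally show ?thesis using assms(1) by simp
qed

lemma norm_fourier_sum:
  assumes "finite F" "F \<subseteq> dual_lattice lat"
  shows "(Lp_norm 2 (fourier_sum F))\<^sup>2 = (\<Sum>\<eta>\<in>F. (norm (fourier u \<eta>))\<^sup>2) / covol"
proof -
  have "complex_of_real ((Lp_norm 2 (fourier_sum F))\<^sup>2) = L2_inner (fourier_sum F) (fourier_sum F)"
    by (rule L2_inner_self[symmetric])
  also have "\<dots> = (\<Sum>\<eta>\<in>F. fourier u \<eta> / of_real covol * L2_inner (tile_char \<eta>) (fourier_sum F))"
    by (subst (1) fourier_sum_def[abs_def], subst L2_inner_sum_left)
       (auto intro!: Lp_2_scale tile_char_Lp_2 fourier_sum_Lp_2 simp: L2_inner_scale_left
        simp del: times_divide_eq_left times_divide_eq_right)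
  also have "\<dots> = (\<Sum>\<eta>\<in>F. complex_of_real ((norm (fourier u \<eta>))\<^sup>2 / covol))"
  proof (rule sum.cong[OF refl])
    fix \<eta> assume \<eta>: "\<eta> \<in> F"
    have "L2_inner (tile_char \<eta>) (fourier_sum F) = cnj (fourier (fourier_sum F) \<eta>)"
      by (subst L2_inner_commute, subst L2_inner_tile_char) (auto simp: fourier_sum_def tile_char_def)
    also have "\<dots> = cnj (fourier u \<eta>)" using fourier_fourier_sum[OF assms, of \<eta>] assms(2) \<eta> by auto
    finally show "fourier u \<eta> / of_real covol * L2_inner (tile_char \<eta>) (fourier_sum F) = complex_of_real ((norm (fourier u \<eta>))\<^sup>2 / covol)"
      by (simp add: complex_norm_square del: of_real_power)
  qed
  also have "\<dots> = complex_of_real ((\<Sum>\<eta>\<in>F. (norm (fourier u \<eta>))\<^sup>2) / covol)"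
    by (simp add: sum_divide_distrib)
  finally show ?thesis using of_real_eq_iff by blast
qed

text \<open>The sum is \<open>covol\<close> times the squared norm of \<open>fourier_sum F\<close>,
  and also \<open>covol\<close> times its inner product with \<open>u\<close>. Cauchy--Schwarz then
  bounds the norm of the projection by that of \<open>u\<close>.\<close>

lemma Bessel_inequality:
  assumes "finite F" "F \<subseteq> dual_lattice lat"
  shows "(\<Sum>\<eta>\<in>F. (norm (fourier u \<eta>))\<^sup>2) \<le> covol * (Lp_norm 2 u)\<^sup>2"
proof -
  let ?s = "\<Sum>\<eta>\<in>F. (norm (fourier u \<eta>))\<^sup>2"
  have tc: "L2_inner (tile_char \<eta>) u = cnj (fourier u \<eta>)" for \<eta>
    using L2_inner_commute[of "tile_char \<eta>" u] L2_inner_tile_char[OF supp, where \<eta> = \<eta>] by simp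
  have "L2_inner (fourier_sum F) u = (\<Sum>\<eta>\<in>F. fourier u \<eta> / of_real covol * L2_inner (tile_char \<eta>) u)"
    unfolding fourier_sum_def[abs_def]
    by (subst L2_inner_sum_left) (auto intro!: Lp_2_scale tile_char_Lp_2 u simp: L2_inner_scale_left
        simp del: times_divide_eq_left times_divide_eq_right)
  also have "\<dots> = complex_of_real (?s / covol)"
    unfolding tc by (simp add: sum_divide_distrib complex_norm_square del: of_real_power)
  finally have "complex_of_real ?s = of_real covol * L2_inner (fourier_sum F) u"
    using covol_pos by simp
  then have "norm (complex_of_real ?s) = covol * norm (L2_inner (fourier_sum F) u)"
    using covol_pos by (simp add: norm_mult)
  then have "?s = covol * norm (L2_inner (fourier_sum F) u)"
    by (simp only: norm_of_real) (simp add: sum_nonneg)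
  also have "\<dots> \<le> covol * (Lp_norm 2 (fourier_sum F) * Lp_norm 2 u)"
    using covol_pos by (intro mult_left_mono L2_inner_Cauchy_Schwarz fourier_sum_Lp_2 u) auto
  finally have le: "?s \<le> covol * (Lp_norm 2 (fourier_sum F) * Lp_norm 2 u)" .
  have "?s = covol * (Lp_norm 2 (fourier_sum F))\<^sup>2"
    using norm_fourier_sum[OF assms] covol_pos by simp
  with le have "(Lp_norm 2 (fourier_sum F))\<^sup>2 \<le> Lp_norm 2 (fourier_sum F) * Lp_norm 2 u"
    using covol_pos by simp
  then have "Lp_norm 2 (fourier_sum F) \<le> Lp_norm 2 u"
    using Lp_norm_2_nonneg[of "fourier_sum F"] by (cases "Lp_norm 2 (fourier_sum F) = 0")
      (auto simp: power2_eq_square)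
  then have "Lp_norm 2 (fourier_sum F) * Lp_norm 2 u \<le> (Lp_norm 2 u)\<^sup>2"
    by (simp add: power2_eq_square mult_right_mono)
  from order_trans[OF le mult_left_mono[OF this]] show ?thesis using covol_pos by simp
qed

text \<open>Partial sums over suitable finite sets converge in L1 and almost everywhere to some
  \<open>g\<close>. Its coefficients are those of \<open>u\<close>, so uniqueness identifies
  \<open>g\<close> with \<open>u\<close> almost everywhere, and Fatou's lemma yields the inequality
  opposite to Bessel's.\<close>

lemma Parseval_norm: "((\<lambda>\<eta>. (norm (fourier u \<eta>))\<^sup>2) has_sum covol * (Lp_norm 2 u)\<^sup>2) (dual_lattice lat)"
proof -
  let ?D = "dual_lattice lat"
  define a where "a = (\<lambda>\<eta>. (norm (fourier u \<eta>))\<^sup>2)"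
  have summ: "a summable_on ?D"
    by (rule nonneg_bdd_above_summable_on) (use Bessel_inequality in \<open>auto simp: a_def intro!: bdd_aboveI2\<close>)
  define T where "T = infsum a ?D"
  have hs: "(a has_sum T) ?D" unfolding T_def using summ by (rule has_sum_infsum)
  have T_le: "T \<le> covol * (Lp_norm 2 u)\<^sup>2"
    by (rule has_sum_le_finite_sums[OF hs]) (use Bessel_inequality in \<open>auto simp: a_def\<close>)
  have fin_le: "sum a F \<le> T" if "finite F" "F \<subseteq> ?D" for F
    unfolding T_def using summ that by (intro finite_sum_le_infsum) (auto simp: a_def)
  \<comment> \<open>The tail \<open>(1/4)^k\<close> is chosen for its square root: it bounds the L1
    distance of consecutive partial sums by the summable \<open>(1/2)^k\<close>.\<close>
  have "\<exists>F. finite F \<and> F \<subseteq> ?D \<and> T - (1/4)^k < sum a F" for k :: nat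
  proof -
    have "\<forall>\<^sub>F F in finite_subsets_at_top ?D. T - (1/4)^k < sum a F"
      using hs unfolding has_sum_def by (rule order_tendstoD) simp
    then show ?thesis unfolding eventually_finite_subsets_at_top by blast
  qed
  then obtain F0 where F0: "\<And>k. finite (F0 k)" "\<And>k. F0 k \<subseteq> ?D" "\<And>k::nat. T - (1/4)^k < sum a (F0 k)"
    by metis
  \<comment> \<open>Unions make the sets increasing, so that a difference of consecutive partial
    sums is again a \<open>fourier_sum\<close>.\<close>
  define F where "F k = (\<Union>j\<le>k. F0 j)" for k
  have F: "finite (F k)" "F k \<subseteq> ?D" "F k \<subseteq> F (Suc k)" for k
    using F0 by (auto simp: F_def intro: le_SucI)
  have Ft: "T - sum a (F k) < (1/4)^k" for k
  proof -
    have "sum a (F0 k) \<le> sum a (F k)" using F by (intro sum_mono2) (auto simp: F_def a_def)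
    then show ?thesis using F0(3)[of k] by linarith
  qed
  let ?S = "\<lambda>k. fourier_sum (F k)"
  have S: "integrable lborel (?S k)" for k
    by (rule Lp_2_cell_integrable(1)[OF fourier_sum_Lp_2]) (simp add: fourier_sum_def tile_char_def)
  have step: "(\<integral>x. norm (?S (Suc k) x - ?S k x) \<partial>lborel) \<le> (1/2)^k" for k
  proof -
    let ?G = "F (Suc k) - F k"
    have eq: "?S (Suc k) x - ?S k x = fourier_sum ?G x" for x
      unfolding fourier_sum_def using F[of k] F[of "Suc k"] by (simp add: sum_diff)
    have "sum a ?G \<le> (1/4)^k"
      using F[of k] F[of "Suc k"] Ft[of k] fin_le[of "F (Suc k)"] by (simp add: sum_diff)
    have "(\<integral>x. norm (fourier_sum ?G x) \<partial>lborel) \<le> sqrt covol * Lp_norm 2 (fourier_sum ?G)"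
      by (rule Lp_2_cell_integrable(2)[OF fourier_sum_Lp_2]) (simp add: fourier_sum_def tile_char_def)
    also have "\<dots> = sqrt (covol * (Lp_norm 2 (fourier_sum ?G))\<^sup>2)"
      by (simp add: real_sqrt_mult)
    also have "covol * (Lp_norm 2 (fourier_sum ?G))\<^sup>2 = sum a ?G"
    proof -
      have "finite ?G" "?G \<subseteq> ?D" using F(1,2)[of "Suc k"] by auto
      from norm_fourier_sum[OF this] show ?thesis using covol_pos by (simp add: a_def)
    qed
    also have "sqrt (sum a ?G) \<le> sqrt ((1/4)^k)" using \<open>sum a ?G \<le> (1/4)^k\<close> by simp
    also have "\<dots> = (1/2)^k" by (simp add: real_sqrt_power real_sqrt_divide)
    finally show ?thesis by (simp add: eq)
  qed
  have "summable (\<lambda>k. \<integral>x. norm (?S (Suc k) x - ?S k x) \<partial>lborel)"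
    by (rule summable_comparison_test'[of "\<lambda>k. (1/2)^k" 0])
       (use step in \<open>auto simp: integral_nonneg_AE\<close>)
  then obtain g where g: "integrable lborel g"
    and lim: "AE x in lborel. (\<lambda>k. ?S k x) \<longlonglongrightarrow> g x"
    and L1: "(\<lambda>k. \<integral>x. norm (?S k x - g x) \<partial>lborel) \<longlonglongrightarrow> 0"
    by (rule L1_convergent[of lborel ?S, OF S]) (blast intro: that)
  have fg: "fourier g \<eta> = fourier u \<eta>" if \<eta>: "\<eta> \<in> ?D" for \<eta>
  proof -
    have "(\<lambda>k. fourier (?S k) \<eta> - fourier g \<eta>) \<longlonglongrightarrow> 0"
      by (rule Lim_null_comparison[OF _ L1])
         (auto intro!: always_eventually norm_fourier_le simp: fourier_diff[symmetric] S g)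
    moreover have "(\<lambda>k. fourier (?S k) \<eta> - fourier u \<eta>) \<longlonglongrightarrow> 0"
    proof (rule Lim_null_comparison)
      show "\<forall>\<^sub>F k in sequentially. norm (fourier (?S k) \<eta> - fourier u \<eta>) \<le> (1/2)^k"
      proof (intro always_eventually allI)
        fix k
        show "norm (fourier (?S k) \<eta> - fourier u \<eta>) \<le> (1/2)^k"
        proof (cases "\<eta> \<in> F k")
          case False
          \<comment> \<open>An index outside \<open>F k\<close> belongs to the tail, which bounds
            its coefficient.\<close>
          have "a \<eta> \<le> (1/4)^k" using fin_le[of "insert \<eta> (F k)"] F[of k] \<eta> Ft[of k] False by simp
          then have "(norm (fourier u \<eta>))\<^sup>2 \<le> ((1/2)^k)\<^sup>2"
            by (simp add: a_def power_mult_distrib[symmetric] power2_eq_square)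
          then have "norm (fourier u \<eta>) \<le> (1/2)^k" by (rule power2_le_imp_le) simp
          then show ?thesis using fourier_fourier_sum[OF F(1,2) \<eta>] False by simp
        qed (use fourier_fourier_sum[OF F(1,2) \<eta>] in simp)
      qed
      show "(\<lambda>k. (1/2)^k :: real) \<longlonglongrightarrow> 0" by (rule LIMSEQ_power_zero) simp
    qed
    ultimately have "(\<lambda>k. (fourier (?S k) \<eta> - fourier g \<eta>) - (fourier (?S k) \<eta> - fourier u \<eta>)) \<longlonglongrightarrow> 0 - 0"
      by (rule tendsto_diff)
    then show ?thesis by (simp add: LIMSEQ_const_iff)
  qed
  have g0: "AE x in lborel. x \<notin> cell \<longrightarrow> g x = 0"
    using lim
  proof eventually_elim
    case (elim x)
    show ?case
    proof
      assume "x \<notin> cell"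
      then have "?S k x = 0" for k by (simp add: fourier_sum_def tile_char_def)
      with elim show "g x = 0" by (simp add: LIMSEQ_const_iff)
    qed
  qed
  have ui: "integrable lborel u" by (rule Lp_2_cell_integrable[OF u supp])
  have gi: "integrable lborel (\<lambda>x. g x * indicator cell x)"
    by (rule Bochner_Integration.integrable_bound[OF g]) (use g in \<open>auto simp: indicator_def\<close>)
  have "AE x in lborel. u x - g x * indicator cell x = 0"
  proof (rule fourier_unique_0)
    show "integrable lborel (\<lambda>x. u x - g x * indicator cell x)" using ui gi by simp
    show "u x - g x * indicator cell x = 0" if "x \<notin> cell" for x using that supp by simp
    show "fourier (\<lambda>x. u x - g x * indicator cell x) \<eta> = 0" if "\<eta> \<in> ?D" for \<eta>
    proof -
      have "fourier (\<lambda>x. g x * indicator cell x) \<eta> = fourier g \<eta>"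
        unfolding fourier_def
      proof (rule integral_cong_AE)
        show "AE x in lborel. g x * indicator cell x * cis (- (2 * pi * (x \<bullet> \<eta>))) = g x * cis (- (2 * pi * (x \<bullet> \<eta>)))"
          using g0 by eventually_elim (auto simp: indicator_def)
      qed (use fourier_integrable[OF gi, of \<eta>] fourier_integrable[OF g, of \<eta>] in auto)
      then show ?thesis using fg[OF that] ui gi by (simp add: fourier_diff)
    qed
  qed
  then have limu: "AE x in lborel. (\<lambda>k. ?S k x) \<longlonglongrightarrow> u x"
    using lim g0 by eventually_elim (auto simp: indicator_def supp split: if_splits)
  have [measurable]: "u \<in> borel_measurable borel" "?S k \<in> borel_measurable borel" for k
    using u fourier_sum_Lp_2 by (auto simp: Lp_2_iff)
  have "ennreal ((Lp_norm 2 u)\<^sup>2) = (\<integral>\<^sup>+x. ennreal ((norm (u x))\<^sup>2) \<partial>lborel)"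
    using u by (simp add: Lp_norm_2_sq Lp_2_iff nn_integral_eq_integral)
  also have "\<dots> = (\<integral>\<^sup>+x. liminf (\<lambda>k. ennreal ((norm (?S k x))\<^sup>2)) \<partial>lborel)"
  proof (rule nn_integral_cong_AE)
    show "AE x in lborel. ennreal ((norm (u x))\<^sup>2) = liminf (\<lambda>k. ennreal ((norm (?S k x))\<^sup>2))"
      using limu
    proof eventually_elim
      case (elim x)
      then have "(\<lambda>k. ennreal ((norm (?S k x))\<^sup>2)) \<longlonglongrightarrow> ennreal ((norm (u x))\<^sup>2)"
        by (intro tendsto_intros)
      then show ?case by (intro lim_imp_Liminf[symmetric]) auto
    qed
  qed
  also have "\<dots> \<le> liminf (\<lambda>k. \<integral>\<^sup>+x. ennreal ((norm (?S k x))\<^sup>2) \<partial>lborel)"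
    by (rule nn_integral_liminf) measurable
  also have "\<dots> \<le> limsup (\<lambda>k. \<integral>\<^sup>+x. ennreal ((norm (?S k x))\<^sup>2) \<partial>lborel)"
    by (rule Liminf_le_Limsup) simp
  also have "\<dots> \<le> ennreal (T / covol)"
  proof (rule Limsup_bounded, intro always_eventually allI)
    fix k
    have "(\<integral>\<^sup>+x. ennreal ((norm (?S k x))\<^sup>2) \<partial>lborel) = ennreal ((Lp_norm 2 (?S k))\<^sup>2)"
      using fourier_sum_Lp_2[of "F k"] by (simp add: Lp_norm_2_sq Lp_2_iff nn_integral_eq_integral)
    also have "\<dots> \<le> ennreal (T / covol)"
      using norm_fourier_sum[OF F(1,2)] fin_le[OF F(1,2)] covol_pos
      by (intro ennreal_leI) (simp add: a_def divide_right_mono)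
    finally show "(\<integral>\<^sup>+x. ennreal ((norm (?S k x))\<^sup>2) \<partial>lborel) \<le> ennreal (T / covol)" .
  qed
  finally have "(Lp_norm 2 u)\<^sup>2 \<le> T / covol"
    using fin_le[of "{}"] covol_pos by (simp add: ennreal_le_iff)
  then have "covol * (Lp_norm 2 u)\<^sup>2 \<le> T" using covol_pos by (simp add: pos_le_divide_eq mult.commute)
  with T_le hs show ?thesis by (simp add: a_def)
qed

end

text \<open>Polarization of \<open>Parseval_norm\<close>, applied to
  \<open>\<lambda>x. u x + c * w x\<close> for the four fourth roots of unity
  \<open>c\<close>.\<close>

lemma Parseval_cell:
  assumes u: "u \<in> Lp 2" "\<And>x. x \<notin> cell \<Longrightarrow> u x = 0" and w: "w \<in> Lp 2" "\<And>x. x \<notin> cell \<Longrightarrow> w x = 0"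
  shows "((\<lambda>\<eta>. fourier u \<eta> * cnj (fourier w \<eta>)) has_sum of_real covol * L2_inner u w) (dual_lattice lat)"
proof -
  let ?D = "dual_lattice lat"
  have ui: "integrable lborel u" and wi: "integrable lborel w"
    using Lp_2_cell_integrable[OF u] Lp_2_cell_integrable[OF w] by auto
  have lin: "fourier (\<lambda>x. u x + c * w x) \<eta> = fourier u \<eta> + c * fourier w \<eta>" for c \<eta>
    using fourier_integrable[OF ui, of \<eta>] fourier_integrable[OF wi, of \<eta>]
    by (simp add: fourier_def distrib_right mult.assoc)
  have P: "((\<lambda>\<eta>. of_real ((norm (fourier u \<eta> + c * fourier w \<eta>))\<^sup>2)) has_sum
    of_real covol * (L2_inner u u + cnj c * L2_inner u w + c * L2_inner w u + c * cnj c * L2_inner w w)) ?D" for c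
  proof -
    let ?v = "\<lambda>x. u x + c * w x"
    have v: "?v \<in> Lp 2" by (intro Lp_2_add Lp_2_scale u w)
    have "((\<lambda>\<eta>. (norm (fourier ?v \<eta>))\<^sup>2) has_sum covol * (Lp_norm 2 ?v)\<^sup>2) ?D"
      by (rule Parseval_norm[OF v]) (simp add: u(2) w(2))
    then have 1: "((\<lambda>\<eta>. complex_of_real ((norm (fourier ?v \<eta>))\<^sup>2)) has_sum of_real (covol * (Lp_norm 2 ?v)\<^sup>2)) ?D"
      by (rule has_sum_of_real)
    have "complex_of_real ((Lp_norm 2 ?v)\<^sup>2) = L2_inner ?v ?v" by (rule L2_inner_self[symmetric])
    also have "\<dots> = L2_inner u ?v + c * L2_inner w ?v"
      by (subst L2_inner_add_left) (auto intro: u w Lp_2_scale v simp: L2_inner_scale_left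
        simp del: times_divide_eq_left times_divide_eq_right)
    also have "L2_inner u ?v = L2_inner u u + cnj c * L2_inner u w"
      by (subst L2_inner_commute, subst L2_inner_add_left)
         (auto intro: u w Lp_2_scale simp: L2_inner_scale_left L2_inner_commute[symmetric])
    also have "L2_inner w ?v = L2_inner w u + cnj c * L2_inner w w"
      by (subst L2_inner_commute, subst L2_inner_add_left)
         (auto intro: u w Lp_2_scale simp: L2_inner_scale_left L2_inner_commute[symmetric])
    finally show ?thesis using 1 unfolding lin of_real_mult by (simp add: algebra_simps)
  qed
  let ?N = "\<lambda>c \<eta>. complex_of_real ((norm (fourier u \<eta> + c * fourier w \<eta>))\<^sup>2)"
  have pol: "fourier u \<eta> * cnj (fourier w \<eta>) =
      1/4 * ?N 1 \<eta> + (- 1/4 * ?N (- 1) \<eta> + (\<i>/4 * ?N \<i> \<eta> + (- \<i>/4) * ?N (- \<i>) \<eta>))" for \<eta>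
    by (simp add: complex_norm_square algebra_simps del: of_real_power)
  have "((\<lambda>\<eta>. 1/4 * ?N 1 \<eta> + (- 1/4 * ?N (- 1) \<eta> + (\<i>/4 * ?N \<i> \<eta> + (- \<i>/4) * ?N (- \<i>) \<eta>))) has_sum
    1/4 * (of_real covol * (L2_inner u u + cnj 1 * L2_inner u w + 1 * L2_inner w u + 1 * cnj 1 * L2_inner w w)) +
    (- 1/4 * (of_real covol * (L2_inner u u + cnj (- 1) * L2_inner u w + (- 1) * L2_inner w u + (- 1) * cnj (- 1) * L2_inner w w)) +
    (\<i>/4 * (of_real covol * (L2_inner u u + cnj \<i> * L2_inner u w + \<i> * L2_inner w u + \<i> * cnj \<i> * L2_inner w w)) +
    (- \<i>/4) * (of_real covol * (L2_inner u u + cnj (- \<i>) * L2_inner u w + (- \<i>) * L2_inner w u + (- \<i>) * cnj (- \<i>) * L2_inner w w))))) ?D"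
    by (intro has_sum_add has_sum_cmult_right P)
  also have "1/4 * (of_real covol * (L2_inner u u + cnj 1 * L2_inner u w + 1 * L2_inner w u + 1 * cnj 1 * L2_inner w w)) +
    (- 1/4 * (of_real covol * (L2_inner u u + cnj (- 1) * L2_inner u w + (- 1) * L2_inner w u + (- 1) * cnj (- 1) * L2_inner w w)) +
    (\<i>/4 * (of_real covol * (L2_inner u u + cnj \<i> * L2_inner u w + \<i> * L2_inner w u + \<i> * cnj \<i> * L2_inner w w)) +
    (- \<i>/4) * (of_real covol * (L2_inner u u + cnj (- \<i>) * L2_inner u w + (- \<i>) * L2_inner w u + (- \<i>) * cnj (- \<i>) * L2_inner w w)))) =
    of_real covol * L2_inner u w"
    by (simp add: field_simps)
  finally show ?thesis unfolding pol .
qed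

text \<open>Translating both functions by \<open>z\<close> multiplies their coefficients by the same
  phase, which cancels against its conjugate.\<close>

lemma Parseval:
  assumes u: "u \<in> Lp 2" "\<And>x. x - z \<notin> cell \<Longrightarrow> u x = 0" and w: "w \<in> Lp 2" "\<And>x. x - z \<notin> cell \<Longrightarrow> w x = 0"
  shows "((\<lambda>\<eta>. fourier u \<eta> * cnj (fourier w \<eta>)) has_sum of_real covol * L2_inner u w) (dual_lattice lat)"
proof -
  have [measurable]: "u \<in> borel_measurable borel" "w \<in> borel_measurable borel"
    using u w by (auto simp: Lp_2_iff)
  have "((\<lambda>\<eta>. fourier (\<lambda>x. u (x + z)) \<eta> * cnj (fourier (\<lambda>x. w (x + z)) \<eta>)) has_sum
    of_real covol * L2_inner (\<lambda>x. u (x + z)) (\<lambda>x. w (x + z))) (dual_lattice lat)"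
    by (rule Parseval_cell) (auto intro: Lp_2_translate u w)
  moreover have "L2_inner (\<lambda>x. u (x + z)) (\<lambda>x. w (x + z)) = L2_inner u w"
    unfolding L2_inner_def by (rule integral_translate) measurable
  moreover have "fourier (\<lambda>x. u (x + z)) \<eta> * cnj (fourier (\<lambda>x. w (x + z)) \<eta>) = fourier u \<eta> * cnj (fourier w \<eta>)" for \<eta>
  proof -
    have "cis (2 * pi * (z \<bullet> \<eta>)) * cnj (cis (2 * pi * (z \<bullet> \<eta>))) = 1"
      by (simp add: cis_cnj cis_mult)
    then show ?thesis by (simp add: fourier_translate mult_ac)
  qed
  ultimately show ?thesis by simp
qed

end

section \<open>Periodizations and slices\<close>

text \<open>By unfolding, the transform of \<open>f\<close> on the dual lattice lists the
  coefficients of its periodization over a cell, while a constant \<open>c\<close> has the only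
  nonzero coefficient \<open>c * covol\<close> at 0. Uniqueness is applied to the
  difference.\<close>

lemma (in lattice_coords) periodize_const_iff:
  assumes f: "integrable lborel f"
  shows "(AE x in lborel. periodize f x = c) \<longleftrightarrow>
    (\<forall>\<eta>\<in>dual_lattice lat. fourier f \<eta> = (if \<eta> = 0 then c * of_real covol else 0))"
proof -
  let ?D = "dual_lattice lat"
  let ?F = "\<lambda>x. periodize f x * indicator cell x"
  let ?c = "\<lambda>x. c * indicator cell x :: complex"
  have [measurable]: "f \<in> borel_measurable borel" using f by auto
  have char_per: "cis (- (2 * pi * ((x + - \<gamma>) \<bullet> \<eta>))) = cis (- (2 * pi * (x \<bullet> \<eta>)))"
    if "\<eta> \<in> ?D" "\<gamma> \<in> lat" for \<eta> \<gamma> x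
    using char_periodic[OF dual_uminus[OF that(1)] lat_uminus[OF that(2)], of x] by simp
  have F: "integrable lborel ?F"
    using periodize_integrable[of f "\<lambda>x. 1"] f by simp
  have fF: "fourier ?F \<eta> = fourier f \<eta>" if "\<eta> \<in> ?D" for \<eta>
  proof -
    have "fourier ?F \<eta> = (\<integral>x. periodize f x * cis (- (2 * pi * (x \<bullet> \<eta>))) * indicator cell x \<partial>lborel)"
      unfolding fourier_def by (simp add: mult_ac)
    also have "\<dots> = fourier f \<eta>"
      unfolding fourier_def
      by (rule periodize_integral) (use char_per that f in \<open>auto intro!: fourier_integrable\<close>)
    finally show ?thesis .
  qed
  have ic: "integrable lborel (indicator cell :: 'a \<Rightarrow> complex)"
  proof -
    have "integrable lborel (\<lambda>x. complex_of_real (indicat_real cell x))"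
      using emeasure_cell_finite by (intro integrable_of_real integrable_real_indicator) auto
    then show ?thesis by (simp add: of_real_indicator)
  qed
  then have c: "integrable lborel ?c" by simp
  have fc: "fourier ?c \<eta> = (if \<eta> = 0 then c * of_real covol else 0)" if "\<eta> \<in> ?D" for \<eta>
  proof -
    have "fourier ?c \<eta> = (\<integral>x. c * (cis (2 * pi * (x \<bullet> (- \<eta>))) * indicator cell x) \<partial>lborel)"
      unfolding fourier_def by (simp add: mult_ac)
    also have "\<dots> = c * (\<integral>x. cis (2 * pi * (x \<bullet> (- \<eta>))) * indicator cell x \<partial>lborel)"
      by (rule integral_mult_right_zero)
    finally show ?thesis unfolding integral_char_cell[OF dual_uminus[OF that]] by simp
  qed
  show ?thesis
  proof
    assume AE: "AE x in lborel. periodize f x = c"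
    show "\<forall>\<eta>\<in>?D. fourier f \<eta> = (if \<eta> = 0 then c * of_real covol else 0)"
    proof
      fix \<eta> assume \<eta>: "\<eta> \<in> ?D"
      have "fourier ?F \<eta> = fourier ?c \<eta>"
        unfolding fourier_def
      proof (rule integral_cong_AE)
        show "AE x in lborel. ?F x * cis (- (2 * pi * (x \<bullet> \<eta>))) = ?c x * cis (- (2 * pi * (x \<bullet> \<eta>)))"
          using AE by eventually_elim simp
      qed (use borel_measurable_integrable[OF fourier_integrable[OF F]]
          borel_measurable_integrable[OF fourier_integrable[OF c]] in blast)+
      with \<eta> show "fourier f \<eta> = (if \<eta> = 0 then c * of_real covol else 0)" by (simp add: fF fc)
    qed
  next
    assume R: "\<forall>\<eta>\<in>?D. fourier f \<eta> = (if \<eta> = 0 then c * of_real covol else 0)"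
    have "AE x in lborel. ?F x - ?c x = 0"
    proof (rule fourier_unique_0)
      show "integrable lborel (\<lambda>x. ?F x - ?c x)" using F c by simp
      show "fourier (\<lambda>x. ?F x - ?c x) \<eta> = 0" if "\<eta> \<in> ?D" for \<eta>
        using R that by (simp add: fourier_diff F c fF fc)
    qed simp
    then have "AE x in lborel. x \<in> cell \<longrightarrow> periodize f x = c"
      by eventually_elim (auto simp: indicator_def split: if_splits)
    then show "AE x in lborel. periodize f x = c"
      by (rule AE_cell_periodic) (simp add: periodize_periodic)
  qed
qed

lemma borel_measurable_fst_borel [measurable]:
  "fst \<in> borel_measurable (borel :: ('a::euclidean_space \<times> 'b::euclidean_space) measure)"
  by (intro borel_measurable_continuous_onI continuous_intros)

lemma borel_measurable_snd_borel [measurable]: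
  "snd \<in> borel_measurable (borel :: ('a::euclidean_space \<times> 'b::euclidean_space) measure)"
  by (intro borel_measurable_continuous_onI continuous_intros)

text \<open>A nonempty open interval is not a null set.\<close>

lemma AE_frequently_near:
  fixes Q :: "real \<Rightarrow> bool"
  assumes "AE y in lborel. Q y" "0 < e"
  shows "\<exists>y'. \<bar>y' - y\<bar> < e \<and> Q y'"
proof (rule ccontr)
  assume no: "\<nexists>y'. \<bar>y' - y\<bar> < e \<and> Q y'"
  have "AE z in lborel. z \<notin> {y - e<..<y + e}"
    using assms(1) by eventually_elim (use no in \<open>auto simp: abs_less_iff\<close>)
  then have "emeasure lborel {y - e<..<y + e} = 0"
    by (subst (asm) AE_iff_measurable[of "{y - e<..<y + e}"]) auto
  then show False using assms(2) by simp
qed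

locale cut_project = lattice_coords C for C :: "'b::euclidean_space \<times> real \<Rightarrow> 'b \<times> real" +
  fixes a :: real
  assumes a_pos: "0 < a"
    and dense_snd: "closure (snd ` lat) = UNIV"
    and generic: "snd ` lat \<inter> {- a, a} = {}"
begin

definition \<Omega> :: "real set" where "\<Omega> = {- a..a}"

lemma \<Omega>_borel [measurable]: "\<Omega> \<in> sets borel"
  by (simp add: \<Omega>_def)

text \<open>Since \<open>\<Omega>\<close> is symmetric, \<open>layer G 0\<close> is the sum of the translates of \<open>G\<close> over the model set.\<close>

definition layer :: "('b \<Rightarrow> complex) \<Rightarrow> real \<Rightarrow> 'b \<Rightarrow> complex" where
  "layer G y x = (\<integral>\<gamma>. G (x + - fst \<gamma>) * indicator \<Omega> (y + - snd \<gamma>) \<partial>count_space lat)"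

definition lift_window :: "('b \<Rightarrow> complex) \<Rightarrow> 'b \<times> real \<Rightarrow> complex" where
  "lift_window G z = G (fst z) * indicator \<Omega> (snd z)"

lemma periodize_lift_window: "periodize (lift_window G) (x, y) = layer G y x"
  by (simp add: periodize_def layer_def lift_window_def)

lemma lift_window_measurable [measurable]:
  "G \<in> borel_measurable borel \<Longrightarrow> lift_window G \<in> borel_measurable borel"
proof -
  assume [measurable]: "G \<in> borel_measurable borel"
  have "(\<lambda>z :: 'b \<times> real. G (fst z)) \<in> borel_measurable borel"
    by (rule measurable_compose[OF borel_measurable_fst_borel]) measurable
  moreover have "(\<lambda>z :: 'b \<times> real. indicator \<Omega> (snd z) :: complex) \<in> borel_measurable borel"
    by (rule measurable_compose[OF borel_measurable_snd_borel]) measurable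
  ultimately show ?thesis unfolding lift_window_def[abs_def] by (rule borel_measurable_times)
qed

lemma integrable_lift_window:
  assumes G: "integrable lborel G"
  shows "integrable lborel (lift_window G)"
proof (rule integrableI_bounded)
  have [measurable]: "G \<in> borel_measurable borel" using G by auto
  show M: "lift_window G \<in> borel_measurable lborel" by measurable
  have "(\<integral>\<^sup>+z. norm (lift_window G z) \<partial>lborel) = (\<integral>\<^sup>+z. norm (lift_window G z) \<partial>(lborel \<Otimes>\<^sub>M lborel))"
    by (simp add: lborel_prod)
  also have "\<dots> = (\<integral>\<^sup>+x. \<integral>\<^sup>+y. norm (lift_window G (x, y)) \<partial>lborel \<partial>lborel)"
    using M by (subst lborel.nn_integral_fst[symmetric]) (auto simp: lborel_prod)
  also have "\<dots> = (\<integral>\<^sup>+x. \<integral>\<^sup>+y. ennreal (norm (G x)) * indicator \<Omega> y \<partial>lborel \<partial>lborel)"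
    by (intro nn_integral_cong) (auto simp: lift_window_def indicator_def)
  also have "\<dots> = (\<integral>\<^sup>+x. ennreal (norm (G x)) \<partial>lborel) * ennreal (2 * a)"
    using a_pos by (simp add: nn_integral_cmult nn_integral_multc \<Omega>_def)
  also have "\<dots> < \<infinity>" using G by (simp add: integrable_iff_bounded ennreal_mult_less_top)
  finally show "(\<integral>\<^sup>+z. norm (lift_window G z) \<partial>lborel) < \<infinity>" .
qed

lemma fourier_lift_window:
  assumes G: "integrable lborel G"
  shows "fourier (lift_window G) \<eta> = fourier G (fst \<eta>) * fourier (indicator \<Omega>) (snd \<eta>)"
proof -
  let ?f = "\<lambda>z. lift_window G z * cis (- (2 * pi * (z \<bullet> \<eta>)))"
  have int: "integrable (lborel \<Otimes>\<^sub>M lborel) ?f"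
    using fourier_integrable[OF integrable_lift_window[OF G], of \<eta>] by (simp add: lborel_prod)
  have "fourier (lift_window G) \<eta> = (\<integral>z. ?f z \<partial>(lborel \<Otimes>\<^sub>M lborel))"
    by (simp add: fourier_def lborel_prod)
  also have "\<dots> = (\<integral>x. \<integral>y. ?f (x, y) \<partial>lborel \<partial>lborel)"
    by (rule lborel_pair.integral_fst'[OF int, symmetric])
  also have "\<dots> = (\<integral>x. \<integral>y. (G x * cis (- (2 * pi * (x \<bullet> fst \<eta>)))) * (indicator \<Omega> y * cis (- (2 * pi * (y \<bullet> snd \<eta>)))) \<partial>lborel \<partial>lborel)"
  proof -
    have e: "cis (- (2 * pi * (s + t))) = cis (- (2 * pi * s)) * cis (- (2 * pi * t))" for s t :: real
      by (simp add: cis_mult distrib_left)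
    show ?thesis
      by (intro Bochner_Integration.integral_cong refl) (simp only: lift_window_def inner_prod_def fst_conv snd_conv e, simp only: mult_ac)
  qed
  also have "\<dots> = fourier G (fst \<eta>) * fourier (indicator \<Omega>) (snd \<eta>)"
    by (simp add: fourier_def)
  finally show ?thesis .
qed

section \<open>Absolute convergence over slabs and dependence of slices on the height\<close>

lemma slab_card_bound:
  assumes "bounded E" "bounded J"
  obtains N :: nat where "\<And>x. (\<integral>\<^sup>+\<gamma>. indicator E (x + fst \<gamma>) * indicator J (snd \<gamma>) \<partial>count_space lat) \<le> of_nat N"
proof -
  \<comment> \<open>For fixed \<open>x\<close> the counted points are the lattice points in the
    translate of \<open>E \<times> J\<close> by \<open>(- x, 0)\<close>; their number is bounded
    uniformly in \<open>x\<close>.\<close>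
  from lat_card_bound[OF bounded_Times[OF assms]] obtain N :: nat where
    N: "\<And>z. finite {\<gamma>\<in>lat. \<gamma> - z \<in> E \<times> J}" "\<And>z. card {\<gamma>\<in>lat. \<gamma> - z \<in> E \<times> J} \<le> N" by metis
  show ?thesis
  proof (rule that[of N])
    fix x
    let ?S = "{\<gamma>\<in>lat. \<gamma> - (- x, 0) \<in> E \<times> J}"
    have "(\<integral>\<^sup>+\<gamma>. indicator E (x + fst \<gamma>) * indicator J (snd \<gamma>) \<partial>count_space lat) = (\<integral>\<^sup>+\<gamma>. indicator ?S \<gamma> \<partial>count_space lat)"
      by (rule nn_integral_cong) (auto simp: indicator_def mem_Times_iff add.commute)
    also have "\<dots> = of_nat (card ?S)"
      using N(1)[of "(- x, 0)"] by (subst nn_integral_indicator) (auto simp: emeasure_count_space_finite)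
    also have "\<dots> \<le> of_nat N" using N(2)[of "(- x, 0)"] by simp
    finally show "(\<integral>\<^sup>+\<gamma>. indicator E (x + fst \<gamma>) * indicator J (snd \<gamma>) \<partial>count_space lat) \<le> of_nat N" .
  qed
qed

text \<open>Exchanging sum and integral weighs \<open>norm (G x)\<close> with a number of lattice
  points that is bounded in \<open>x\<close>. The finite series obtained is the majorant behind
  every later exchange or limit over a slab.\<close>

lemma slab_sum_finite:
  assumes G: "integrable lborel (G :: 'b \<Rightarrow> complex)" and E: "bounded E" "E \<in> sets borel" and J: "bounded J"
  shows "(\<integral>\<^sup>+\<gamma>. indicator J (snd \<gamma>) * (\<integral>\<^sup>+x. norm (G (x + - fst \<gamma>)) * indicator E x \<partial>lborel) \<partial>count_space lat) < \<infinity>"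
proof -
  have [measurable]: "G \<in> borel_measurable borel" "E \<in> sets borel" using G E by auto
  interpret pair_sigma_finite "count_space lat" "lborel :: 'b measure"
    unfolding pair_sigma_finite_def using sigma_finite_lat lborel.sigma_finite_measure_axioms by blast
  obtain N :: nat where N: "\<And>x. (\<integral>\<^sup>+\<gamma>. indicator E (x + fst \<gamma>) * indicator J (snd \<gamma>) \<partial>count_space lat) \<le> of_nat N"
    by (rule slab_card_bound[OF E(1) J]) (blast intro: that)
  have "(\<integral>\<^sup>+\<gamma>. indicator J (snd \<gamma>) * (\<integral>\<^sup>+x. norm (G (x + - fst \<gamma>)) * indicator E x \<partial>lborel) \<partial>count_space lat)
    = (\<integral>\<^sup>+\<gamma>. \<integral>\<^sup>+x. ennreal (norm (G x)) * (indicator E (x + fst \<gamma>) * indicator J (snd \<gamma>)) \<partial>lborel \<partial>count_space lat)"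
  proof (rule nn_integral_cong)
    fix \<gamma> :: "'b \<times> real"
    have "(\<integral>\<^sup>+x. norm (G (x + - fst \<gamma>)) * indicator E x \<partial>lborel) = (\<integral>\<^sup>+x. ennreal (norm (G x)) * indicator E (x + fst \<gamma>) \<partial>lborel)"
    proof -
      have "(\<integral>\<^sup>+x. norm (G (x + - fst \<gamma>)) * indicator E x \<partial>lborel)
        = (\<integral>\<^sup>+x. ennreal (norm (G (x + - fst \<gamma>))) * indicator E (x + - fst \<gamma> + fst \<gamma>) \<partial>lborel)"
        by (rule nn_integral_cong) (auto simp: indicator_def)
      also have "\<dots> = (\<integral>\<^sup>+x. ennreal (norm (G x)) * indicator E (x + fst \<gamma>) \<partial>lborel)"
        by (rule nn_integral_translate) measurable
      finally show ?thesis .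
    qed
    then show "indicator J (snd \<gamma>) * (\<integral>\<^sup>+x. norm (G (x + - fst \<gamma>)) * indicator E x \<partial>lborel) =
      (\<integral>\<^sup>+x. ennreal (norm (G x)) * (indicator E (x + fst \<gamma>) * indicator J (snd \<gamma>)) \<partial>lborel)"
    proof -
      assume eq: "(\<integral>\<^sup>+x. norm (G (x + - fst \<gamma>)) * indicator E x \<partial>lborel) = (\<integral>\<^sup>+x. ennreal (norm (G x)) * indicator E (x + fst \<gamma>) \<partial>lborel)"
      have "(\<integral>\<^sup>+x. ennreal (norm (G x)) * (indicator E (x + fst \<gamma>) * indicator J (snd \<gamma>)) \<partial>lborel)
        = (\<integral>\<^sup>+x. ennreal (norm (G x)) * indicator E (x + fst \<gamma>) * indicator J (snd \<gamma>) \<partial>lborel)"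
        by (simp only: mult.assoc)
      also have "\<dots> = (\<integral>\<^sup>+x. ennreal (norm (G x)) * indicator E (x + fst \<gamma>) \<partial>lborel) * indicator J (snd \<gamma>)"
        by (rule nn_integral_multc) measurable
      finally show ?thesis unfolding eq by (simp only: mult.commute)
    qed
  qed
  also have "\<dots> = (\<integral>\<^sup>+x. \<integral>\<^sup>+\<gamma>. ennreal (norm (G x)) * (indicator E (x + fst \<gamma>) * indicator J (snd \<gamma>)) \<partial>count_space lat \<partial>lborel)"
  proof (rule Fubini'[symmetric])
    show "(\<lambda>(\<gamma>, x). ennreal (norm (G x)) * (indicator E (x + fst \<gamma>) * indicator J (snd \<gamma>)))
      \<in> borel_measurable (count_space lat \<Otimes>\<^sub>M lborel)"
      by (intro measurable_pair_measure_countable1 countable_lat) (simp, measurable)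
  qed
  also have "\<dots> \<le> (\<integral>\<^sup>+x. ennreal (norm (G x)) * of_nat N \<partial>lborel)"
    by (intro nn_integral_mono) (simp add: nn_integral_cmult mult_left_mono N)
  also have "\<dots> = (\<integral>\<^sup>+x. ennreal (norm (G x)) \<partial>lborel) * of_nat N"
    by (rule nn_integral_multc) measurable
  also have "\<dots> < \<infinity>" using G by (simp add: integrable_iff_bounded ennreal_mult_less_top of_nat_less_top)
  finally show ?thesis .
qed

lemma bounded_window: "bounded {s. y + - s \<in> \<Omega>}"
  by (rule bounded_subset[of "{y - a..y + a}"]) (auto simp: \<Omega>_def)

text \<open>This holds at every height \<open>y\<close>, not merely at almost every one, as Fubini's
  theorem for the periodization would give. Balls exhaust the space because the majorant is local in
  \<open>x\<close>.\<close>

lemma AE_integrable_layer: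
  assumes G: "integrable lborel (G :: 'b \<Rightarrow> complex)"
  shows "AE x in lborel. integrable (count_space lat) (\<lambda>\<gamma>. G (x + - fst \<gamma>) * indicator \<Omega> (y + - snd \<gamma>))"
proof -
  have [measurable]: "G \<in> borel_measurable borel" using G by auto
  interpret pair_sigma_finite "count_space lat" "lborel :: 'b measure"
    unfolding pair_sigma_finite_def using sigma_finite_lat lborel.sigma_finite_measure_axioms by blast
  have 1: "AE x in lborel. x \<in> ball 0 (real n) \<longrightarrow>
      (\<integral>\<^sup>+\<gamma>. norm (G (x + - fst \<gamma>) * indicator \<Omega> (y + - snd \<gamma>)) \<partial>count_space lat) \<noteq> \<infinity>" for n :: nat
  proof -
    let ?E = "ball (0::'b) (real n)"
    have [measurable]: "?E \<in> sets borel" by simp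
    define h where "h \<gamma> x = ennreal (norm (G (x + - fst \<gamma>))) * indicator \<Omega> (y + - snd \<gamma>) * indicator ?E x"
      for \<gamma> :: "'b \<times> real" and x
    have M: "(\<lambda>(\<gamma>, x). h \<gamma> x) \<in> borel_measurable (count_space lat \<Otimes>\<^sub>M lborel)"
      unfolding h_def by (intro measurable_pair_measure_countable1 countable_lat) (simp, measurable)
    have "(\<integral>\<^sup>+x. \<integral>\<^sup>+\<gamma>. h \<gamma> x \<partial>count_space lat \<partial>lborel) = (\<integral>\<^sup>+\<gamma>. \<integral>\<^sup>+x. h \<gamma> x \<partial>lborel \<partial>count_space lat)"
      by (rule Fubini'[OF M])
    also have "\<dots> = (\<integral>\<^sup>+\<gamma>. indicator {s. y + - s \<in> \<Omega>} (snd \<gamma>) * (\<integral>\<^sup>+x. norm (G (x + - fst \<gamma>)) * indicator ?E x \<partial>lborel) \<partial>count_space lat)"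
    proof (rule nn_integral_cong)
      fix \<gamma> :: "'b \<times> real"
      have "(\<integral>\<^sup>+x. h \<gamma> x \<partial>lborel) = (\<integral>\<^sup>+x. indicator {s. y + - s \<in> \<Omega>} (snd \<gamma>) * ennreal (norm (G (x + - fst \<gamma>)) * indicator ?E x) \<partial>lborel)"
        by (rule nn_integral_cong) (auto simp: h_def indicator_def)
      also have "\<dots> = indicator {s. y + - s \<in> \<Omega>} (snd \<gamma>) * (\<integral>\<^sup>+x. norm (G (x + - fst \<gamma>)) * indicator ?E x \<partial>lborel)"
        by (rule nn_integral_cmult) measurable
      finally show "(\<integral>\<^sup>+x. h \<gamma> x \<partial>lborel) = \<dots>" .
    qed
    also have "\<dots> < \<infinity>" by (rule slab_sum_finite[OF G bounded_ball _ bounded_window]) simp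
    finally have "AE x in lborel. (\<integral>\<^sup>+\<gamma>. h \<gamma> x \<partial>count_space lat) \<noteq> \<infinity>"
    proof (intro nn_integral_noteq_infinite)
      have "(\<lambda>(x, \<gamma>). h \<gamma> x) \<in> borel_measurable (lborel \<Otimes>\<^sub>M count_space lat)"
        using M by (subst measurable_pair_swap_iff) simp
      then show "(\<lambda>x. \<integral>\<^sup>+\<gamma>. h \<gamma> x \<partial>count_space lat) \<in> borel_measurable lborel"
        by (rule M1.borel_measurable_nn_integral)
    qed auto
    then show ?thesis
    proof eventually_elim
      case (elim x)
      show ?case
      proof
        assume "x \<in> ball 0 (real n)"
        then have "(\<integral>\<^sup>+\<gamma>. h \<gamma> x \<partial>count_space lat) = (\<integral>\<^sup>+\<gamma>. norm (G (x + - fst \<gamma>) * indicator \<Omega> (y + - snd \<gamma>)) \<partial>count_space lat)"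
          by (intro nn_integral_cong) (auto simp: h_def indicator_def)
        with elim show "(\<integral>\<^sup>+\<gamma>. norm (G (x + - fst \<gamma>) * indicator \<Omega> (y + - snd \<gamma>)) \<partial>count_space lat) \<noteq> \<infinity>" by simp
      qed
    qed
  qed
  then have "AE x in lborel. \<forall>n::nat. x \<in> ball 0 (real n) \<longrightarrow>
      (\<integral>\<^sup>+\<gamma>. norm (G (x + - fst \<gamma>) * indicator \<Omega> (y + - snd \<gamma>)) \<partial>count_space lat) \<noteq> \<infinity>"
    unfolding AE_all_countable by blast
  then show ?thesis
  proof eventually_elim
    case (elim x)
    obtain n :: nat where "norm x < real n" using reals_Archimedean2 by blast
    with elim have "(\<integral>\<^sup>+\<gamma>. norm (G (x + - fst \<gamma>) * indicator \<Omega> (y + - snd \<gamma>)) \<partial>count_space lat) \<noteq> \<infinity>"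
      by (metis dist_0_norm mem_ball)
    then show ?case by (simp add: integrable_iff_bounded less_top)
  qed
qed

lemma layer_measurable [measurable]:
  assumes [measurable]: "G \<in> borel_measurable borel"
  shows "layer G y \<in> borel_measurable borel"
proof -
  have "(\<lambda>x. periodize (lift_window G) (x, y)) \<in> borel_measurable borel"
    by (rule measurable_compose[OF _ borel_measurable_periodize])
       (auto intro!: borel_measurable_Pair)
  then show ?thesis by (simp add: periodize_lift_window)
qed

text \<open>Only the lattice points whose heights are close to the boundary of \<open>y - \<Omega>\<close> contribute to the
  difference of two layers at nearby heights.\<close>

lemma layer_const_limit:
  assumes G: "integrable lborel (G :: 'b \<Rightarrow> complex)"
    and y: "\<And>\<gamma>. \<gamma> \<in> lat \<Longrightarrow> y - snd \<gamma> \<noteq> a \<and> y - snd \<gamma> \<noteq> - a"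
    and near: "\<And>e. 0 < e \<Longrightarrow> \<exists>y'. \<bar>y' - y\<bar> < e \<and> (AE x in lborel. layer G y' x = c)"
  shows "AE x in lborel. layer G y x = c"
proof -
  have [measurable]: "G \<in> borel_measurable borel" using G by auto
  interpret pair_sigma_finite "count_space lat" "lborel :: 'b measure"
    unfolding pair_sigma_finite_def using sigma_finite_lat lborel.sigma_finite_measure_axioms by blast
  have "\<forall>k::nat. \<exists>y'. \<bar>y' - y\<bar> < inverse (real (Suc k)) \<and> (AE x in lborel. layer G y' x = c)"
    using near by simp
  then obtain Y where Y: "\<And>k::nat. \<bar>Y k - y\<bar> < inverse (real (Suc k))" "\<And>k. AE x in lborel. layer G (Y k) x = c"
    by metis
  have Ylim: "Y \<longlonglongrightarrow> y"
  proof -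
    have "(\<lambda>k. Y k - y) \<longlonglongrightarrow> 0"
      by (rule Lim_null_comparison[OF _ LIMSEQ_inverse_real_of_nat])
         (use Y(1) in \<open>auto intro!: always_eventually less_imp_le\<close>)
    then show ?thesis by (simp add: LIM_zero_iff)
  qed
  have Y1: "\<bar>Y k - y\<bar> \<le> 1" for k
  proof -
    have "inverse (real (Suc k)) \<le> 1" by (simp add: field_simps)
    with Y(1)[of k] show ?thesis by linarith
  qed
  \<comment> \<open>Equal to 1 if exactly one of the heights \<open>y\<close> and \<open>t\<close>
    has the lattice height \<open>s\<close> in its window, and 0 otherwise.\<close>
  define w where "w s t = norm (indicator \<Omega> (y + - s) - indicator \<Omega> (t + - s) :: complex)" for s t
  have ball: "AE x in lborel. x \<in> ball 0 (real n) \<longrightarrow> layer G y x = c" for n :: nat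
  proof -
    let ?E = "ball (0::'b) (real n)"
    have [measurable]: "?E \<in> sets borel" by simp
    define A where "A \<gamma> = (\<integral>\<^sup>+x. norm (G (x + - fst \<gamma>)) * indicator ?E x \<partial>lborel)" for \<gamma> :: "'b \<times> real"
    let ?I = "\<integral>\<^sup>+x. ennreal (norm (layer G y x - c)) * indicator ?E x \<partial>lborel"
    have le: "?I \<le> (\<integral>\<^sup>+\<gamma>. ennreal (w (snd \<gamma>) (Y k)) * A \<gamma> \<partial>count_space lat)" for k
    proof -
      have "?I \<le> (\<integral>\<^sup>+x. \<integral>\<^sup>+\<gamma>. ennreal (w (snd \<gamma>) (Y k)) * (norm (G (x + - fst \<gamma>)) * indicator ?E x) \<partial>count_space lat \<partial>lborel)"
      proof (rule nn_integral_mono_AE)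
        show "AE x in lborel. ennreal (norm (layer G y x - c)) * indicator ?E x
          \<le> (\<integral>\<^sup>+\<gamma>. ennreal (w (snd \<gamma>) (Y k)) * (norm (G (x + - fst \<gamma>)) * indicator ?E x) \<partial>count_space lat)"
          using Y(2)[of k] AE_integrable_layer[OF G, of y] AE_integrable_layer[OF G, of "Y k"]
        proof eventually_elim
          case (elim x)
          let ?d = "\<lambda>\<gamma>. G (x + - fst \<gamma>) * indicator \<Omega> (y + - snd \<gamma>) - G (x + - fst \<gamma>) * indicator \<Omega> (Y k + - snd \<gamma>)"
          have "layer G y x - c = (\<integral>\<gamma>. ?d \<gamma> \<partial>count_space lat)"
            using elim by (simp add: layer_def)
          then have "ennreal (norm (layer G y x - c)) \<le> (\<integral>\<^sup>+\<gamma>. norm (?d \<gamma>) \<partial>count_space lat)"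
            using elim by (simp only:) (intro integral_norm_bound_ennreal Bochner_Integration.integrable_diff)
          also have "\<dots> = (\<integral>\<^sup>+\<gamma>. ennreal (w (snd \<gamma>) (Y k)) * ennreal (norm (G (x + - fst \<gamma>))) \<partial>count_space lat)"
            by (intro nn_integral_cong)
               (simp add: w_def ennreal_mult[symmetric] norm_mult[symmetric] algebra_simps)
          finally show ?case by (cases "x \<in> ?E") auto
        qed
      qed
      also have "\<dots> = (\<integral>\<^sup>+\<gamma>. \<integral>\<^sup>+x. ennreal (w (snd \<gamma>) (Y k)) * (norm (G (x + - fst \<gamma>)) * indicator ?E x) \<partial>lborel \<partial>count_space lat)"
      proof (rule Fubini')
        show "(\<lambda>(\<gamma>, x). ennreal (w (snd \<gamma>) (Y k)) * ennreal (norm (G (x + - fst \<gamma>)) * indicator ?E x))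
          \<in> borel_measurable (count_space lat \<Otimes>\<^sub>M lborel)"
          by (intro measurable_pair_measure_countable1 countable_lat) (simp, measurable)
      qed
      also have "\<dots> = (\<integral>\<^sup>+\<gamma>. ennreal (w (snd \<gamma>) (Y k)) * A \<gamma> \<partial>count_space lat)"
        unfolding A_def by (intro nn_integral_cong nn_integral_cmult) measurable
      finally show ?thesis .
    qed
    have "(\<lambda>k. \<integral>\<^sup>+\<gamma>. ennreal (w (snd \<gamma>) (Y k)) * A \<gamma> \<partial>count_space lat) \<longlonglongrightarrow> (\<integral>\<^sup>+\<gamma>. 0 \<partial>count_space lat)"
    proof (rule nn_integral_dominated_convergence)
      \<comment> \<open>Since \<open>\<bar>Y k - y\<bar> \<le> 1\<close>, lattice heights farther
        than \<open>a + 1\<close> from \<open>y\<close> contribute for no \<open>k\<close>; one slab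
        therefore dominates the whole sequence.\<close>
      let ?J = "{y - a - 1..y + a + 1}"
      show "AE \<gamma> in count_space lat. ennreal (w (snd \<gamma>) (Y k)) * A \<gamma> \<le> indicator ?J (snd \<gamma>) * A \<gamma>" for k
      proof (intro always_eventually allI mult_right_mono)
        fix \<gamma> :: "'b \<times> real"
        show "ennreal (w (snd \<gamma>) (Y k)) \<le> indicator ?J (snd \<gamma>)"
          using Y1[of k] by (auto simp: w_def \<Omega>_def indicator_def abs_le_iff)
      qed simp
      show "(\<integral>\<^sup>+\<gamma>. indicator ?J (snd \<gamma>) * A \<gamma> \<partial>count_space lat) < \<infinity>"
        unfolding A_def by (rule slab_sum_finite[OF G]) auto
      show "AE \<gamma> in count_space lat. (\<lambda>k. ennreal (w (snd \<gamma>) (Y k)) * A \<gamma>) \<longlonglongrightarrow> 0"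
      proof (simp only: AE_count_space, rule ballI)
        fix \<gamma> assume \<gamma>: "\<gamma> \<in> lat"
        have "\<forall>\<^sub>F k in sequentially. w (snd \<gamma>) (Y k) = 0"
        proof -
          have L: "(\<lambda>k. Y k - snd \<gamma>) \<longlonglongrightarrow> y - snd \<gamma>" by (intro tendsto_intros Ylim)
          consider "y - snd \<gamma> < - a" | "- a < y - snd \<gamma>" "y - snd \<gamma> < a" | "a < y - snd \<gamma>"
            using y[OF \<gamma>] by linarith
          then show ?thesis
          proof cases
            case 1
            from order_tendstoD(2)[OF L 1] show ?thesis
              by eventually_elim (use 1 in \<open>auto simp: w_def \<Omega>_def indicator_def\<close>)
          next
            case 2
            from order_tendstoD(1)[OF L 2(1)] order_tendstoD(2)[OF L 2(2)] show ?thesis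
              by eventually_elim (use 2 in \<open>auto simp: w_def \<Omega>_def indicator_def\<close>)
          next
            case 3
            from order_tendstoD(1)[OF L 3] show ?thesis
              by eventually_elim (use 3 in \<open>auto simp: w_def \<Omega>_def indicator_def\<close>)
          qed
        qed
        then have "\<forall>\<^sub>F k in sequentially. ennreal (w (snd \<gamma>) (Y k)) * A \<gamma> = 0"
          by eventually_elim simp
        then show "(\<lambda>k. ennreal (w (snd \<gamma>) (Y k)) * A \<gamma>) \<longlonglongrightarrow> 0" by (rule tendsto_eventually)
      qed
    qed simp_all
    then have "?I \<le> 0"
      by (intro LIMSEQ_le_const) (use le in auto)
    then have "AE x in lborel. ennreal (norm (layer G y x - c)) * indicator ?E x = 0"
      by (subst nn_integral_0_iff_AE[symmetric]) auto
    then show ?thesis by eventually_elim (auto simp: indicator_def)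
  qed
  then have "AE x in lborel. \<forall>n::nat. x \<in> ball 0 (real n) \<longrightarrow> layer G y x = c"
    unfolding AE_all_countable by blast
  then show ?thesis
  proof eventually_elim
    case (elim x)
    obtain n :: nat where "norm x < real n" using reals_Archimedean2 by blast
    with elim show ?case by (metis dist_0_norm mem_ball)
  qed
qed

lemma layer_shift: "\<gamma> \<in> lat \<Longrightarrow> layer G (snd \<gamma>) x = layer G 0 (x + - fst \<gamma>)"
  using periodize_periodic[of \<gamma> "lift_window G" "(x + - fst \<gamma>, 0)"]
  by (simp add: periodize_lift_window[symmetric] plus_prod_def)

lemma layer_const_iff:
  assumes G: "integrable lborel (G :: 'b \<Rightarrow> complex)"
  shows "(AE x in lborel. layer G 0 x = c) \<longleftrightarrow> (AE z in lborel. periodize (lift_window G) z = c)"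
proof -
  have [measurable]: "G \<in> borel_measurable borel" using G by auto
  \<comment> \<open>Joint measurability, inherited from the periodization, permits the exchange of
    the two almost everywhere quantifiers below.\<close>
  have sets: "{z \<in> space (lborel \<Otimes>\<^sub>M lborel). layer G (snd z) (fst z) = c} \<in> sets (lborel \<Otimes>\<^sub>M (lborel :: real measure))"
  proof -
    have "{z \<in> space borel. periodize (lift_window G) z = c} \<in> sets borel" by measurable
    moreover have "layer G (snd z) (fst z) = periodize (lift_window G) z" for z
      using periodize_lift_window[of G "fst z" "snd z"] by simp
    ultimately show ?thesis unfolding lborel_prod by simp
  qed
  have "(AE z in lborel. periodize (lift_window G) z = c) \<longleftrightarrow>
    (AE z in lborel \<Otimes>\<^sub>M lborel. layer G (snd z) (fst z) = c)"
    unfolding lborel_prod by (simp add: periodize_lift_window[symmetric])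
  also have "\<dots> \<longleftrightarrow> (AE x in lborel. AE y in lborel. layer G y x = c)"
    by (rule lborel_pair.AE_pair_iff[OF sets, symmetric])
  also have "\<dots> \<longleftrightarrow> (AE y in lborel. AE x in lborel. layer G y x = c)"
    using sets by (rule lborel_pair.AE_commute)
  finally have iff: "(AE z in lborel. periodize (lift_window G) z = c) \<longleftrightarrow> (AE y in lborel. AE x in lborel. layer G y x = c)" .
  show ?thesis
    unfolding iff
  proof
    assume 0: "AE x in lborel. layer G 0 x = c"
    have good: "AE x in lborel. layer G (snd \<gamma>) x = c" if "\<gamma> \<in> lat" for \<gamma>
      using AE_translate[OF 0, of "- fst \<gamma>"] layer_shift[OF that] by simp
    have "AE y in lborel. \<forall>\<gamma>\<in>lat. y \<noteq> snd \<gamma> + a \<and> y \<noteq> snd \<gamma> - a"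
      using AE_lborel_singleton by (subst AE_ball_countable[OF countable_lat]) (auto intro!: AE_conjI)
    then show "AE y in lborel. AE x in lborel. layer G y x = c"
    proof eventually_elim
      case (elim y)
      show ?case
      proof (rule layer_const_limit[OF G])
        show "y - snd \<gamma> \<noteq> a \<and> y - snd \<gamma> \<noteq> - a" if "\<gamma> \<in> lat" for \<gamma>
          using elim that by force
        fix e :: real assume "0 < e"
        then obtain \<gamma> where \<gamma>: "\<gamma> \<in> lat" "dist (snd \<gamma>) y < e"
          using dense_snd closure_approachable[of y "snd ` lat"] by auto
        then show "\<exists>y'. \<bar>y' - y\<bar> < e \<and> (AE x in lborel. layer G y' x = c)"
          using good[OF \<gamma>(1)] \<gamma>(2) by (intro exI[of _ "snd \<gamma>"]) (simp add: dist_real_def)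
      qed
    qed
  next
    assume AE: "AE y in lborel. AE x in lborel. layer G y x = c"
    show "AE x in lborel. layer G 0 x = c"
    \<comment> \<open>Heights with a constant slice accumulate at 0 because their complement is a
      null set.\<close>
    proof (rule layer_const_limit[OF G])
      show "0 - snd \<gamma> \<noteq> a \<and> 0 - snd \<gamma> \<noteq> - a" if "\<gamma> \<in> lat" for \<gamma>
        using generic that by auto
    qed (rule AE_frequently_near[OF AE])
  qed
qed

theorem layer_fourier_iff:
  assumes G: "integrable lborel (G :: 'b \<Rightarrow> complex)"
  shows "(AE x in lborel. layer G 0 x = c) \<longleftrightarrow>
    (\<forall>\<eta>\<in>dual_lattice lat. fourier G (fst \<eta>) * fourier (indicator \<Omega>) (snd \<eta>) =
      (if \<eta> = 0 then c * of_real covol else 0))"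
  unfolding layer_const_iff[OF G] periodize_const_iff[OF integrable_lift_window[OF G]]
    fourier_lift_window[OF G] ..

end

section \<open>Density of model sets\<close>

context lattice_coords
begin

lemma finite_lat_Int:
  assumes "bounded Y"
  shows "finite {\<gamma>\<in>lat. z - \<gamma> \<in> Y}"
proof -
  obtain N :: nat where "\<And>z. finite {\<gamma>\<in>lat. \<gamma> - z \<in> uminus ` Y}"
    by (rule lat_card_bound[of "uminus ` Y"]) (use assms in \<open>auto simp: bounded_uminus\<close>)
  then have "finite {\<gamma>\<in>lat. \<gamma> - z \<in> uminus ` Y}" .
  moreover have "\<gamma> - z \<in> uminus ` Y \<longleftrightarrow> z - \<gamma> \<in> Y" for \<gamma>
  proof
    assume "\<gamma> - z \<in> uminus ` Y"
    then obtain y where "y \<in> Y" "\<gamma> - z = - y" by auto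
    then show "z - \<gamma> \<in> Y" by (metis minus_diff_eq minus_minus)
  next
    assume "z - \<gamma> \<in> Y"
    then show "\<gamma> - z \<in> uminus ` Y" by (rule rev_image_eqI) simp
  qed
  ultimately show ?thesis by simp
qed

lemma nn_integral_lat_card:
  assumes "bounded Y"
  shows "(\<integral>\<^sup>+\<gamma>. indicator Y (z + - \<gamma>) \<partial>count_space lat) = of_nat (card {\<gamma>\<in>lat. z - \<gamma> \<in> Y})"
proof -
  have "(\<integral>\<^sup>+\<gamma>. indicator Y (z + - \<gamma>) \<partial>count_space lat) = (\<integral>\<^sup>+\<gamma>. indicator {\<gamma>\<in>lat. z - \<gamma> \<in> Y} \<gamma> \<partial>count_space lat)"
    by (rule nn_integral_cong) (auto simp: indicator_def)
  also have "\<dots> = of_nat (card {\<gamma>\<in>lat. z - \<gamma> \<in> Y})"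
    using finite_lat_Int[OF assms, of z] by (subst nn_integral_indicator) (auto simp: emeasure_count_space_finite)
  finally show ?thesis .
qed

text \<open>Unfolding for the indicator of \<open>Y\<close>. This converts a uniform estimate of
  counts over all positions in the cell into an estimate of a volume.\<close>

lemma mean_lat_card:
  assumes [measurable]: "Y \<in> sets borel" and Y: "bounded Y"
  shows "(\<integral>\<^sup>+x. of_nat (card {\<gamma>\<in>lat. x - \<gamma> \<in> Y}) * indicator cell x \<partial>lborel) = emeasure lborel Y"
proof -
  interpret pair_sigma_finite "count_space lat" lborel by (rule pair_sigma_finite_lat)
  have "(\<integral>\<^sup>+x. of_nat (card {\<gamma>\<in>lat. x - \<gamma> \<in> Y}) * indicator cell x \<partial>lborel)
    = (\<integral>\<^sup>+x. \<integral>\<^sup>+\<gamma>. indicator Y (x + - \<gamma>) * indicator cell x \<partial>count_space lat \<partial>lborel)"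
    by (intro nn_integral_cong) (simp add: nn_integral_multc nn_integral_lat_card[OF Y, simplified])
  also have "\<dots> = (\<integral>\<^sup>+\<gamma>. \<integral>\<^sup>+x. indicator Y (x + - \<gamma>) * indicator cell x \<partial>lborel \<partial>count_space lat)"
  proof (rule Fubini')
    show "(\<lambda>(\<gamma>, x). indicator Y (x + - \<gamma>) * indicator cell x :: ennreal) \<in> borel_measurable (count_space lat \<Otimes>\<^sub>M lborel)"
      by (intro measurable_pair_measure_countable1 countable_lat) (simp, measurable)
  qed
  also have "\<dots> = (\<integral>\<^sup>+x. indicator Y x \<partial>lborel)"
    by (rule nn_integral_unfold[symmetric]) measurable
  finally show ?thesis by simp
qed

lemma lat_card_le_measure:
  assumes "Y \<in> sets borel" "bounded Y" and le: "\<And>x. x \<in> cell \<Longrightarrow> n \<le> card {\<gamma>\<in>lat. x - \<gamma> \<in> Y}"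
  shows "covol * real n \<le> measure lborel Y"
proof -
  have "ennreal (covol * real n) = (\<integral>\<^sup>+x. of_nat n * indicator cell x \<partial>lborel)"
    using covol_pos by (subst nn_integral_cmult_indicator)
      (auto simp: emeasure_cell ennreal_mult ennreal_of_nat_eq_real_of_nat mult.commute)
  also have "\<dots> \<le> (\<integral>\<^sup>+x. of_nat (card {\<gamma>\<in>lat. x - \<gamma> \<in> Y}) * indicator cell x \<partial>lborel)"
    using le by (intro nn_integral_mono) (auto simp: indicator_def)
  also have "\<dots> = emeasure lborel Y" by (rule mean_lat_card[OF assms(1,2)])
  also have "\<dots> = ennreal (measure lborel Y)"
    using emeasure_bounded_finite[OF assms(2)] by (intro emeasure_eq_ennreal_measure) auto
  finally show ?thesis by simp
qed

lemma measure_le_lat_card: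
  assumes "Y \<in> sets borel" "bounded Y" and le: "\<And>x. x \<in> cell \<Longrightarrow> card {\<gamma>\<in>lat. x - \<gamma> \<in> Y} \<le> n"
  shows "measure lborel Y \<le> covol * real n"
proof -
  have "ennreal (measure lborel Y) = emeasure lborel Y"
    using emeasure_bounded_finite[OF assms(2)] by (intro emeasure_eq_ennreal_measure[symmetric]) auto
  also have "\<dots> = (\<integral>\<^sup>+x. of_nat (card {\<gamma>\<in>lat. x - \<gamma> \<in> Y}) * indicator cell x \<partial>lborel)"
    by (rule mean_lat_card[OF assms(1,2), symmetric])
  also have "\<dots> \<le> (\<integral>\<^sup>+x. of_nat n * indicator cell x \<partial>lborel)"
    using le by (intro nn_integral_mono) (auto simp: indicator_def)
  also have "\<dots> = ennreal (covol * real n)"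
    using covol_pos by (subst nn_integral_cmult_indicator)
      (auto simp: emeasure_cell ennreal_mult ennreal_of_nat_eq_real_of_nat mult.commute)
  finally show ?thesis using covol_pos by (simp add: ennreal_le_iff)
qed

lemma lat_card_shift:
  assumes "\<gamma>\<^sub>0 \<in> lat"
  shows "card {\<gamma>\<in>lat. z - \<gamma>\<^sub>0 - \<gamma> \<in> Y} = card {\<gamma>\<in>lat. z - \<gamma> \<in> Y}"
proof (rule bij_betw_same_card)
  show "bij_betw (\<lambda>\<gamma>. \<gamma> + \<gamma>\<^sub>0) {\<gamma>\<in>lat. z - \<gamma>\<^sub>0 - \<gamma> \<in> Y} {\<gamma>\<in>lat. z - \<gamma> \<in> Y}"
    by (rule bij_betw_byWitness[where f' = "\<lambda>\<gamma>. \<gamma> - \<gamma>\<^sub>0"])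
       (use assms in \<open>auto intro: lat_add lat_diff simp: algebra_simps\<close>)
qed

end

context cut_project
begin

text \<open>Subtracting \<open>base_pt z\<close> brings \<open>z\<close> into the bounded cell. As
  the lattice heights are dense and \<open>{- \<rho>..\<rho>}\<close> is compact, finitely many
  further lattice points \<open>F\<close> suffice to correct the height up to \<delta>; the
  horizontal cost is at most \<rho> plus the sum of their norms.\<close>

lemma thin_slab_covering:
  assumes "0 < \<delta>"
  obtains S where "0 < S" "\<And>z. \<exists>\<gamma>\<in>lat. norm (fst (z - \<gamma>)) \<le> S \<and> \<bar>snd (z - \<gamma>)\<bar> \<le> \<delta>"
proof -
  obtain \<rho> where \<rho>: "\<And>x. x \<in> cell \<Longrightarrow> norm x \<le> \<rho>" "0 < \<rho>"
    using bounded_cell by (auto simp: bounded_pos)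
  have "{- \<rho>..\<rho>} \<subseteq> (\<Union>\<gamma>\<in>lat. ball (snd \<gamma>) \<delta>)"
  proof
    fix t :: real
    obtain \<gamma> where "\<gamma> \<in> lat" "dist (snd \<gamma>) t < \<delta>"
      using dense_snd closure_approachable[of t "snd ` lat"] assms by auto
    then show "t \<in> (\<Union>\<gamma>\<in>lat. ball (snd \<gamma>) \<delta>)" by auto
  qed
  then obtain F where F: "F \<subseteq> lat" "finite F" "{- \<rho>..\<rho>} \<subseteq> (\<Union>\<gamma>\<in>F. ball (snd \<gamma>) \<delta>)"
    using compact_Icc[of "- \<rho>" \<rho>] by (elim compactE_image) auto
  define S where "S = \<rho> + (\<Sum>\<gamma>\<in>F. norm \<gamma>)"
  show ?thesis
  proof (rule that)
    show "0 < S" using \<rho>(2) by (simp add: S_def add_pos_nonneg sum_nonneg)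
    fix z
    let ?w = "z - base_pt z"
    have w: "norm ?w \<le> \<rho>" by (rule \<rho>(1)[OF base_pt_cell])
    have "norm (snd ?w) \<le> norm (fst ?w, snd ?w)" by (rule norm_snd_le)
    then have "norm (snd ?w) \<le> \<rho>" using w by (simp only: prod.collapse)
    then have "snd ?w \<in> {- \<rho>..\<rho>}" by auto
    then obtain \<gamma> where \<gamma>: "\<gamma> \<in> F" "dist (snd \<gamma>) (snd ?w) < \<delta>" using F(3) by fastforce
    have "norm (fst (?w - \<gamma>)) \<le> norm (fst (?w - \<gamma>), snd (?w - \<gamma>))" by (rule norm_fst_le)
    also have "\<dots> = norm (?w - \<gamma>)" by (simp only: prod.collapse)
    also have "\<dots> \<le> norm ?w + norm \<gamma>" by (rule norm_triangle_ineq4)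
    also have "norm \<gamma> \<le> (\<Sum>\<gamma>\<in>F. norm \<gamma>)" using \<gamma>(1) F(2) by (intro member_le_sum) auto
    finally have "norm (fst (?w - \<gamma>)) \<le> S" using w by (simp add: S_def)
    moreover have "\<bar>snd (?w - \<gamma>)\<bar> \<le> \<delta>" using \<gamma>(2) by (auto simp: dist_real_def)
    moreover have "base_pt z + \<gamma> \<in> lat" using F(1) \<gamma>(1) base_pt_lat by (intro lat_add) auto
    ultimately show "\<exists>\<gamma>\<in>lat. norm (fst (z - \<gamma>)) \<le> S \<and> \<bar>snd (z - \<gamma>)\<bar> \<le> \<delta>"
      by (metis diff_diff_eq)
  qed
qed

end

lemma measure_cbox_Times:
  fixes l u :: "real ^ 'm"
  assumes "\<And>i. l $ i \<le> u $ i" "c \<le> d"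
  shows "measure lborel (cbox l u \<times> {c..d}) = (\<Prod>i\<in>UNIV. u $ i - l $ i) * (d - c)"
proof -
  have ne: "cbox l u \<noteq> {}" using assms(1) by (simp add: interval_ne_empty_cart)
  have "emeasure lborel (cbox l u \<times> {c..d}) = emeasure (lborel \<Otimes>\<^sub>M lborel) (cbox l u \<times> {c..d})"
    by (simp add: lborel_prod)
  also have "\<dots> = emeasure lborel (cbox l u) * emeasure lborel {c..d}"
    by (rule lborel.emeasure_pair_measure_Times) auto
  also have "emeasure lborel (cbox l u) = ennreal (measure lborel (cbox l u))"
    using emeasure_bounded_finite[OF bounded_cbox, of l u] by (intro emeasure_eq_ennreal_measure) auto
  finally have "measure lborel (cbox l u \<times> {c..d}) = measure lborel (cbox l u) * (d - c)"
    using assms(2) by (simp add: measure_def ennreal_mult[symmetric])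
  then show ?thesis using content_cbox_cart[OF ne] by simp
qed

locale cart_cut_project = cut_project C a for C :: "(real ^ 'm) \<times> real \<Rightarrow> (real ^ 'm) \<times> real" and a +
  assumes inj_fst: "inj_on fst lat"
begin

text \<open>The box is reflected so that the count takes the form
  \<open>z - \<gamma> \<in> Y\<close>, with \<open>z = 0\<close>, in which lattice points are
  averaged. The symmetric window is unaffected, and injectivity of \<open>fst\<close> prevents
  double counting.\<close>

lemma card_model_set_cube:
  assumes "0 < R"
  shows "card (model_set lat \<Omega> \<inter> (\<lambda>u. x + R *\<^sub>R u) ` cbox 0 (\<chi> i. 1)) =
    card {\<gamma>\<in>lat. 0 - \<gamma> \<in> cbox (- x - (\<chi> i. R)) (- x) \<times> {- a..a}}"
proof -
  have mem: "y \<in> (\<lambda>u. x + R *\<^sub>R u) ` cbox 0 (\<chi> i. 1) \<longleftrightarrow> - y \<in> cbox (- x - (\<chi> i. R)) (- x)" for y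
  proof
    assume "y \<in> (\<lambda>u. x + R *\<^sub>R u) ` cbox 0 (\<chi> i. 1)"
    then obtain u where u1: "y = x + R *\<^sub>R u" and "u \<in> cbox 0 (\<chi> i. 1)" by blast
    then have u: "0 \<le> u $ i \<and> u $ i \<le> 1" for i by (simp add: mem_box_cart)
    have "R * u $ i \<le> R" "0 \<le> R * u $ i" for i
      using u[of i] assms mult_left_mono[of "u $ i" 1 R] by auto
    then show "- y \<in> cbox (- x - (\<chi> i. R)) (- x)" by (auto simp: mem_box_cart u1)
  next
    assume y: "- y \<in> cbox (- x - (\<chi> i. R)) (- x)"
    let ?u = "inverse R *\<^sub>R (y - x)"
    have "0 \<le> ?u $ i \<and> ?u $ i \<le> 1" for i
    proof -
      have "x $ i \<le> y $ i" "y $ i - x $ i \<le> R" using y by (auto simp: mem_box_cart) (smt (verit))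
      then show ?thesis using assms by (simp add: field_simps)
    qed
    then have "?u \<in> cbox 0 (\<chi> i. 1)" by (simp add: mem_box_cart)
    moreover have "y = x + R *\<^sub>R ?u" using assms by simp
    ultimately show "y \<in> (\<lambda>u. x + R *\<^sub>R u) ` cbox 0 (\<chi> i. 1)" by blast
  qed
  have "model_set lat \<Omega> \<inter> (\<lambda>u. x + R *\<^sub>R u) ` cbox 0 (\<chi> i. 1) =
    fst ` {\<gamma>\<in>lat. snd \<gamma> \<in> \<Omega> \<and> fst \<gamma> \<in> (\<lambda>u. x + R *\<^sub>R u) ` cbox 0 (\<chi> i. 1)}"
    unfolding model_set_def by blast
  also have "{\<gamma>\<in>lat. snd \<gamma> \<in> \<Omega> \<and> fst \<gamma> \<in> (\<lambda>u. x + R *\<^sub>R u) ` cbox 0 (\<chi> i. 1)} =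
    {\<gamma>\<in>lat. 0 - \<gamma> \<in> cbox (- x - (\<chi> i. R)) (- x) \<times> {- a..a}}"
    unfolding mem by (auto simp: \<Omega>_def mem_Times_iff)
  finally have "model_set lat \<Omega> \<inter> (\<lambda>u. x + R *\<^sub>R u) ` cbox 0 (\<chi> i. 1) =
    fst ` {\<gamma>\<in>lat. 0 - \<gamma> \<in> cbox (- x - (\<chi> i. R)) (- x) \<times> {- a..a}}" .
  moreover have "inj_on fst {\<gamma>\<in>lat. 0 - \<gamma> \<in> cbox (- x - (\<chi> i. R)) (- x) \<times> {- a..a}}"
    using inj_fst by (rule inj_on_subset) auto
  ultimately show ?thesis by (simp add: card_image)
qed

text \<open>Every point of the space can be moved into a flat box by the lattice. Hence the number of lattice
  points in a box is at most that in any translate of a slightly enlarged box, and averaging the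
  latter over a cell gives a volume.\<close>

lemma model_set_density_bounds:
  assumes "0 < \<delta>" "\<delta> < a"
  shows "\<exists>S>0. \<forall>x R. 2 * S < R \<longrightarrow>
    covol * real (card (model_set lat \<Omega> \<inter> (\<lambda>u. x + R *\<^sub>R u) ` cbox 0 (\<chi> i. 1))) \<le> (R + 2 * S) ^ CARD('m) * (2 * a + 2 * \<delta>) \<and>
    (R - 2 * S) ^ CARD('m) * (2 * a - 2 * \<delta>) \<le> covol * real (card (model_set lat \<Omega> \<inter> (\<lambda>u. x + R *\<^sub>R u) ` cbox 0 (\<chi> i. 1)))"
proof -
  obtain S where S: "0 < S" "\<And>z. \<exists>\<gamma>\<in>lat. norm (fst (z - \<gamma>)) \<le> S \<and> \<bar>snd (z - \<gamma>)\<bar> \<le> \<delta>"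
    using thin_slab_covering[OF assms(1)] by blast
  have enlarge: "w + p \<in> cbox (l - (\<chi> i. S)) (u + (\<chi> i. S)) \<times> {c - \<delta>..d + \<delta>}"
    if "p \<in> cbox l u \<times> {c..d}" "norm (fst w) \<le> S" "\<bar>snd w\<bar> \<le> \<delta>"
    for w p :: "(real ^ 'm) \<times> real" and l u c d
  proof -
    have "l $ i - S \<le> fst w $ i + fst p $ i \<and> fst w $ i + fst p $ i \<le> u $ i + S" for i
    proof -
      have "l $ i \<le> fst p $ i" "fst p $ i \<le> u $ i" using that(1) by (auto simp: mem_Times_iff mem_box_cart)
      moreover have "\<bar>fst w $ i\<bar> \<le> S" using component_le_norm_cart[of "fst w" i] that(2) by linarith
      ultimately show ?thesis by linarith
    qed
    moreover have "c - \<delta> \<le> snd w + snd p" "snd w + snd p \<le> d + \<delta>"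
      using that(1,3) by (auto simp: mem_Times_iff)
    ultimately show ?thesis by (simp add: mem_Times_iff mem_box_cart)
  qed
  show ?thesis
  proof (intro exI[of _ S] conjI allI impI S(1))
    fix x :: "real ^ 'm" and R :: real assume R: "2 * S < R"
    define l where "l = - x - (\<chi> i. R)"
    let ?Y = "cbox l (- x) \<times> {- a..a}"
    let ?Yp = "cbox (l - (\<chi> i. S)) (- x + (\<chi> i. S)) \<times> {- a - \<delta>..a + \<delta>}"
    let ?Ym = "cbox (l + (\<chi> i. S)) (- x - (\<chi> i. S)) \<times> {- a + \<delta>..a - \<delta>}"
    have R0: "0 < R" using R S(1) by linarith
    have bd: "bounded ?Y" "bounded ?Yp" "bounded ?Ym"
      by (intro bounded_Times bounded_cbox bounded_closed_interval)+
    have bor: "?Yp \<in> sets borel" "?Ym \<in> sets borel"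
      by (intro borel_closed closed_Times closed_cbox closed_atLeastAtMost)+
    have "covol * real (card {\<gamma>\<in>lat. 0 - \<gamma> \<in> ?Y}) \<le> measure lborel ?Yp"
    proof (rule lat_card_le_measure[OF bor(1) bd(2)])
      fix z
      obtain \<gamma>\<^sub>0 where \<gamma>\<^sub>0: "\<gamma>\<^sub>0 \<in> lat" "norm (fst (z - \<gamma>\<^sub>0)) \<le> S" "\<bar>snd (z - \<gamma>\<^sub>0)\<bar> \<le> \<delta>" using S(2) by blast
      have "card {\<gamma>\<in>lat. 0 - \<gamma> \<in> ?Y} \<le> card {\<gamma>\<in>lat. z - \<gamma>\<^sub>0 - \<gamma> \<in> ?Yp}"
      proof (rule card_mono[OF finite_lat_Int[OF bd(2)]], rule subsetI)
        fix \<gamma> assume "\<gamma> \<in> {\<gamma>\<in>lat. 0 - \<gamma> \<in> ?Y}"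
        then show "\<gamma> \<in> {\<gamma>\<in>lat. z - \<gamma>\<^sub>0 - \<gamma> \<in> ?Yp}"
          using enlarge[OF _ \<gamma>\<^sub>0(2,3), of "0 - \<gamma>" l "- x" "- a" a] by simp
      qed
      then show "card {\<gamma>\<in>lat. 0 - \<gamma> \<in> ?Y} \<le> card {\<gamma>\<in>lat. z - \<gamma> \<in> ?Yp}"
        using lat_card_shift[OF \<gamma>\<^sub>0(1)] by simp
    qed
    also have "\<dots> = (R + 2 * S) ^ CARD('m) * (2 * a + 2 * \<delta>)"
      using R S(1) assms a_pos by (subst measure_cbox_Times) (auto simp: l_def add.commute)
    finally show "covol * real (card (model_set lat \<Omega> \<inter> (\<lambda>u. x + R *\<^sub>R u) ` cbox 0 (\<chi> i. 1))) \<le> (R + 2 * S) ^ CARD('m) * (2 * a + 2 * \<delta>)"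
      by (simp only: card_model_set_cube[OF R0] l_def)
    have "(R - 2 * S) ^ CARD('m) * (2 * a - 2 * \<delta>) = measure lborel ?Ym"
      using R S(1) assms a_pos by (subst measure_cbox_Times) (auto simp: l_def)
    also have "\<dots> \<le> covol * real (card {\<gamma>\<in>lat. 0 - \<gamma> \<in> ?Y})"
    proof (rule measure_le_lat_card[OF bor(2) bd(3)])
      fix z
      obtain \<gamma>\<^sub>0 where \<gamma>\<^sub>0: "\<gamma>\<^sub>0 \<in> lat" "norm (fst (z - \<gamma>\<^sub>0)) \<le> S" "\<bar>snd (z - \<gamma>\<^sub>0)\<bar> \<le> \<delta>" using S(2) by blast
      \<comment> \<open>The lower bound moves points from the shrunken box \<open>?Ym\<close> back
        into \<open>?Y\<close>, hence by the negated displacement.\<close>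
      have w: "norm (fst (- (z - \<gamma>\<^sub>0))) \<le> S" "\<bar>snd (- (z - \<gamma>\<^sub>0))\<bar> \<le> \<delta>"
        using \<gamma>\<^sub>0 by (simp_all add: norm_minus_commute abs_minus_commute)
      have "card {\<gamma>\<in>lat. z - \<gamma>\<^sub>0 - \<gamma> \<in> ?Ym} \<le> card {\<gamma>\<in>lat. 0 - \<gamma> \<in> ?Y}"
      proof (rule card_mono[OF finite_lat_Int[OF bd(1)]], rule subsetI)
        fix \<gamma> assume "\<gamma> \<in> {\<gamma>\<in>lat. z - \<gamma>\<^sub>0 - \<gamma> \<in> ?Ym}"
        then show "\<gamma> \<in> {\<gamma>\<in>lat. 0 - \<gamma> \<in> ?Y}"
          using enlarge[OF _ w, of "z - \<gamma>\<^sub>0 - \<gamma>" "l + (\<chi> i. S)" "- x - (\<chi> i. S)" "- a + \<delta>" "a - \<delta>"] by simp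
      qed
      then show "card {\<gamma>\<in>lat. z - \<gamma> \<in> ?Ym} \<le> card {\<gamma>\<in>lat. 0 - \<gamma> \<in> ?Y}"
        using lat_card_shift[OF \<gamma>\<^sub>0(1)] by simp
    qed
    finally show "(R - 2 * S) ^ CARD('m) * (2 * a - 2 * \<delta>) \<le> covol * real (card (model_set lat \<Omega> \<inter> (\<lambda>u. x + R *\<^sub>R u) ` cbox 0 (\<chi> i. 1)))"
      by (simp only: card_model_set_cube[OF R0] l_def)
  qed
qed

lemma model_set_density:
  "((\<lambda>R. real (card (model_set lat \<Omega> \<inter> (\<lambda>u. x + R *\<^sub>R u) ` cbox 0 (\<chi> i. 1))) / R ^ CARD('m))
      \<longlongrightarrow> 2 * a / covol) at_top"
proof -
  let ?m = "CARD('m)"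
  let ?N = "\<lambda>R. real (card (model_set lat \<Omega> \<inter> (\<lambda>u. x + R *\<^sub>R u) ` cbox 0 (\<chi> i. 1)))"
  have lim: "((\<lambda>R. (1 + s / R) ^ ?m * (c / covol)) \<longlongrightarrow> (1 + 0) ^ ?m * (c / covol)) at_top" for s c :: real
    by (intro tendsto_intros tendsto_divide_0[OF tendsto_const] filterlim_at_top_imp_at_infinity filterlim_ident)
  show ?thesis
  proof (rule order_tendstoI)
    fix u assume u: "2 * a / covol < u"
    \<comment> \<open>Small enough that the limiting bound
      \<open>(2 * a + 2 * \<delta>) / covol\<close> stays below \<open>u\<close>. The radius
      \<open>S\<close> depends on \<delta>, but its effect vanishes as \<open>R\<close>
      grows.\<close>
    define \<delta> where "\<delta> = min (a / 2) ((u * covol - 2 * a) / 4)"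
    have up: "0 < u * covol - 2 * a" using u covol_pos by (simp add: pos_divide_less_eq)
    then have \<delta>: "0 < \<delta>" "\<delta> < a" "2 * \<delta> < u * covol - 2 * a" using a_pos by (auto simp: \<delta>_def min_def)
    obtain S where S: "0 < S" and le: "\<And>x R. 2 * S < R \<Longrightarrow>
      covol * real (card (model_set lat \<Omega> \<inter> (\<lambda>u. x + R *\<^sub>R u) ` cbox 0 (\<chi> i. 1))) \<le> (R + 2 * S) ^ ?m * (2 * a + 2 * \<delta>)"
      using model_set_density_bounds[OF \<delta>(1,2)] by blast
    have "(1 + 0) ^ ?m * ((2 * a + 2 * \<delta>) / covol) < u" using \<delta>(3) covol_pos by (simp add: pos_divide_less_eq)
    from order_tendstoD(2)[OF lim this, of "2 * S"]
    show "\<forall>\<^sub>F R in at_top. ?N R / R ^ ?m < u"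
      using eventually_gt_at_top[of "2 * S"]
    proof eventually_elim
      case (elim R)
      have R: "0 < R" using elim S by linarith
      have "?N R \<le> (R + 2 * S) ^ ?m * (2 * a + 2 * \<delta>) / covol"
        using le[OF elim(2), of x] covol_pos by (simp add: pos_le_divide_eq mult.commute)
      then have "?N R / R ^ ?m \<le> ((R + 2 * S) ^ ?m * (2 * a + 2 * \<delta>) / covol) / R ^ ?m"
        using R by (intro divide_right_mono) auto
      also have "\<dots> = ((R + 2 * S) / R) ^ ?m * ((2 * a + 2 * \<delta>) / covol)" by (simp add: power_divide)
      also have "(R + 2 * S) / R = 1 + 2 * S / R" using R by (simp add: add_divide_distrib)
      finally show ?case using elim(1) by linarith
    qed
  next
    fix u assume u: "u < 2 * a / covol"
    define \<delta> where "\<delta> = min (a / 2) ((2 * a - u * covol) / 4)"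
    have up: "0 < 2 * a - u * covol" using u covol_pos by (simp add: pos_less_divide_eq)
    then have \<delta>: "0 < \<delta>" "\<delta> < a" "2 * \<delta> < 2 * a - u * covol" using a_pos by (auto simp: \<delta>_def min_def)
    obtain S where S: "0 < S" and le: "\<And>x R. 2 * S < R \<Longrightarrow> (R - 2 * S) ^ ?m * (2 * a - 2 * \<delta>) \<le>
      covol * real (card (model_set lat \<Omega> \<inter> (\<lambda>u. x + R *\<^sub>R u) ` cbox 0 (\<chi> i. 1)))"
      using model_set_density_bounds[OF \<delta>(1,2)] by blast
    have "u < (1 + 0) ^ ?m * ((2 * a - 2 * \<delta>) / covol)" using \<delta>(3) covol_pos by (simp add: pos_less_divide_eq)
    from order_tendstoD(1)[OF lim this, of "- (2 * S)"]
    show "\<forall>\<^sub>F R in at_top. u < ?N R / R ^ ?m"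
      using eventually_gt_at_top[of "2 * S"]
    proof eventually_elim
      case (elim R)
      have R: "0 < R" using elim S by linarith
      have "(R - 2 * S) ^ ?m * (2 * a - 2 * \<delta>) / covol \<le> ?N R"
        using le[OF elim(2), of x] covol_pos by (simp add: pos_divide_le_eq mult.commute)
      then have "((R - 2 * S) ^ ?m * (2 * a - 2 * \<delta>) / covol) / R ^ ?m \<le> ?N R / R ^ ?m"
        using R by (intro divide_right_mono) auto
      also have "((R - 2 * S) ^ ?m * (2 * a - 2 * \<delta>) / covol) / R ^ ?m = ((R - 2 * S) / R) ^ ?m * ((2 * a - 2 * \<delta>) / covol)"
        by (simp add: power_divide)
      also have "(R - 2 * S) / R = 1 + - (2 * S) / R" using R by (simp add: diff_divide_distrib)
      finally show ?case using elim(1) by linarith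
    qed
  qed
qed

lemma point_density_model_set: "point_density (model_set lat \<Omega>) = 2 * a / covol"
  unfolding point_density_def
proof (rule the_equality)
  fix d assume H: "\<forall>x. ((\<lambda>R. real (card (model_set lat \<Omega> \<inter> (\<lambda>u. x + R *\<^sub>R u) ` cbox 0 (\<chi> i. 1))) / R ^ CARD('m)) \<longlongrightarrow> d) at_top"
  show "d = 2 * a / covol"
    using tendsto_unique[OF trivial_limit_at_top_linorder H[rule_format, of 0] model_set_density[of 0]] .
qed (use model_set_density in blast)

end

section \<open>The function \<open>\<Phi>\<close>\<close>

lemma has_sum_count_space:
  fixes f :: "'i \<Rightarrow> complex"
  assumes "integrable (count_space A) f"
  shows "(f has_sum (\<integral>x. f x \<partial>count_space A)) A"
proof -
  have 1: "Infinite_Set_Sum.abs_summable_on f A" using assms by (simp add: Infinite_Set_Sum.abs_summable_on_def)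
  then have "Infinite_Sum.abs_summable_on f A" by (simp add: abs_summable_equivalent)
  then have "f summable_on A" by (rule abs_summable_summable)
  then have "(f has_sum infsum f A) A" by (rule has_sum_infsum)
  then show ?thesis using infsetsum_infsum[OF 1] by (simp add: infsetsum_def)
qed

text \<open>Unordered summability of a complex family is absolute, so a sum produced by Parseval's
  identity can be fed into Fubini's theorem.\<close>

lemma integrable_count_space_has_sum:
  fixes f :: "'i \<Rightarrow> complex"
  assumes "(f has_sum s) A"
  shows "integrable (count_space A) f" "(\<integral>x. f x \<partial>count_space A) = s"
proof -
  have "f summable_on A" using assms by (rule has_sum_imp_summable)
  then have "Infinite_Sum.abs_summable_on f A" by (simp add: summable_on_iff_abs_summable_on_complex)
  then show 1: "integrable (count_space A) f"
    by (simp add: abs_summable_equivalent Infinite_Set_Sum.abs_summable_on_def)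
  show "(\<integral>x. f x \<partial>count_space A) = s"
    using has_sum_unique[OF has_sum_count_space[OF 1] assms] .
qed

lemma borel_measurable_fourier [measurable]:
  assumes [measurable]: "f \<in> borel_measurable borel"
  shows "fourier f \<in> borel_measurable borel"
  unfolding fourier_def[abs_def] by measurable

section \<open>Normalized windows and their reproducing formula\<close>

definition window_density :: "real \<Rightarrow> real \<Rightarrow> complex" where
  "window_density b x = of_real (indicator {- b..b} x / (2 * b))"

lemma window_density_measurable [measurable]: "window_density b \<in> borel_measurable borel"
  unfolding window_density_def[abs_def] by measurable

lemma integrable_indicator_Icc: "integrable lborel (indicat_real {c..d :: real})"
  by (rule integrable_real_indicator) (auto simp: emeasure_lborel_Icc_eq)

lemma window_density_integrable: "integrable lborel (window_density b)"
  unfolding window_density_def[abs_def]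
  by (intro integrable_of_real integrable_divide integrable_indicator_Icc)

lemma norm_window_density: "0 < b \<Longrightarrow> norm (window_density b x) = indicator {- b..b} x / (2 * b)"
  unfolding window_density_def norm_of_real by (simp add: indicator_def)

lemma nn_integral_window_density: "0 < b \<Longrightarrow> (\<integral>\<^sup>+x. ennreal (norm (window_density b x)) \<partial>lborel) = 1"
proof -
  assume b: "0 < b"
  have "(\<integral>\<^sup>+x. ennreal (norm (window_density b x)) \<partial>lborel) = (\<integral>\<^sup>+x. ennreal (1 / (2 * b)) * indicator {- b..b} x \<partial>lborel)"
    using b by (intro nn_integral_cong) (auto simp: norm_window_density indicator_def)
  also have "\<dots> = ennreal (1 / (2 * b)) * ennreal (2 * b)" using b by (subst nn_integral_cmult_indicator) auto
  also have "\<dots> = 1" using b by (simp add: ennreal_mult[symmetric])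
  finally show ?thesis .
qed

lemma cnj_fourier_window_density: "cnj (fourier (window_density b) r) = fourier (window_density b) (- r)"
  unfolding fourier_def by (subst Bochner_Integration.integral_cnj[symmetric])
    (simp add: cis_cnj window_density_def)

text \<open>Sampling the Fourier transform of the window along \<open>s + T\<^sup>-\<^sup>1 \<int>\<close> with a period \<open>T\<close> exceeding the
  length of the window turns Parseval's identity into the reproducing formula for \<open>\<Psi> * \<Psi>\<close>.\<close>

lemma convol_fourier_window:
  assumes a: "0 < a"
  shows "convol (fourier (window_density a)) (fourier (window_density a)) t = fourier (window_density a) t / (2 * a)"
proof -
  let ?u = "window_density a"
  let ?\<Psi> = "fourier ?u"
  \<comment> \<open>Any period above the window length \<open>2 * a\<close> would do: shifted by
    \<open>a\<close>, the closed window has to fit into the half-open cell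
    \<open>{0..<T}\<close>.\<close>
  define T where "T = 4 * a"
  have T: "0 < T" using a by (simp add: T_def)
  interpret L: lattice_coords "\<lambda>x::real. x / T"
    by unfold_locales (use T in \<open>auto intro!: linearI injI simp: add_divide_distrib\<close>)
  interpret D: lattice_coords "\<lambda>x::real. T * x"
    by unfold_locales (use T in \<open>auto intro!: linearI injI simp: distrib_left\<close>)
  have Lcell: "L.cell = {0..<T}" unfolding L.cell_def Basis_real_def using T by (auto simp: field_simps)
  have Dcell: "D.cell = {0..<1 / T}" unfolding D.cell_def Basis_real_def using T by (auto simp: field_simps zero_le_mult_iff)
  have Lcovol: "L.covol = T" using T by (simp add: L.covol_def Lcell)
  have Dcovol: "D.covol = 1 / T" using T by (simp add: D.covol_def Dcell)
  have dual: "dual_lattice L.lat = D.lat"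
  proof (intro set_eqI iffI)
    fix y assume "y \<in> dual_lattice L.lat"
    moreover have "T \<in> L.lat" using T by (simp add: L.lat_def Basis_real_def)
    ultimately show "y \<in> D.lat" by (auto simp: dual_lattice_def D.lat_def Basis_real_def)
  next
    fix y assume y: "y \<in> D.lat"
    show "y \<in> dual_lattice L.lat"
      unfolding dual_lattice_def
    proof safe
      fix \<gamma> assume "\<gamma> \<in> L.lat"
      then have "\<gamma> / T \<in> \<int>" "T * y \<in> \<int>" using y by (auto simp: L.lat_def D.lat_def Basis_real_def)
      then have "(\<gamma> / T) * (T * y) \<in> \<int>" by (rule Ints_mult)
      then show "\<gamma> \<bullet> y \<in> \<int>" using T by simp
    qed
  qed
  \<comment> \<open>A modulated window, whose transform is \<open>?\<Psi>\<close> translated by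
    \<open>s\<close>; its coefficients on the dual lattice are thus samples of
    \<open>?\<Psi>\<close>.\<close>
  define w where "w s x = cis (- (2 * pi * (x * s))) * ?u x" for s x
  have uL2: "?u \<in> Lp 2"
  proof -
    have eq: "(norm (?u x))\<^sup>2 = indicator {- a..a} x / (2 * a)\<^sup>2" for x
      unfolding norm_window_density[OF a] by (simp add: indicator_def power_divide)
    have "integrable lborel (\<lambda>x. indicat_real {- a..a} x / (2 * a)\<^sup>2)"
      by (intro integrable_divide integrable_indicator_Icc)
    then show ?thesis unfolding Lp_2_iff eq by simp
  qed
  have wL2: "w s \<in> Lp 2" for s
    by (rule Lp_2_bound[OF uL2]) (auto simp: w_def[abs_def] norm_mult)
  have fw: "fourier (w s) \<eta> = ?\<Psi> (s + \<eta>)" for s \<eta>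
    unfolding fourier_def w_def
    by (intro Bochner_Integration.integral_cong refl) (simp add: cis_mult algebra_simps)
  have inner: "L2_inner (w s) (w (s - t)) = ?\<Psi> t / (2 * a)" for s t
  proof -
    have "L2_inner (w s) (w (s - t)) = (\<integral>x. (?u x * cis (- (2 * pi * (x \<bullet> t)))) / (2 * a) \<partial>lborel)"
      unfolding L2_inner_def
    proof (rule Bochner_Integration.integral_cong[OF refl])
      fix x
      \<comment> \<open>An indicator is idempotent, so the squared window is the window again up to
        \<open>2 * a\<close>. This makes the inner product a value of
        \<open>?\<Psi>\<close>.\<close>
      have "?u x * cnj (?u x) = ?u x / (2 * a)" using a by (simp add: window_density_def indicator_def)
      moreover have "cis (- (2 * pi * (x * s))) * cnj (cis (- (2 * pi * (x * (s - t))))) = cis (- (2 * pi * (x \<bullet> t)))"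
        by (simp add: cis_cnj cis_mult algebra_simps)
      moreover have "w s x * cnj (w (s - t) x) = (?u x * cnj (?u x)) *
          (cis (- (2 * pi * (x * s))) * cnj (cis (- (2 * pi * (x * (s - t))))))"
        by (simp add: w_def mult_ac)
      ultimately show "w s x * cnj (w (s - t) x) = (?u x * cis (- (2 * pi * (x \<bullet> t)))) / (2 * a)"
        by simp
    qed
    then show ?thesis by (simp add: fourier_def)
  qed
  \<comment> \<open>The value does not involve \<open>s\<close>: the periodization of
    \<open>\<lambda>s. ?\<Psi> s * cnj (?\<Psi> (s - t))\<close> is constant, and the integral is
    this constant times the covolume \<open>1 / T\<close>.\<close>
  let ?K = "\<lambda>t. of_real T * (?\<Psi> t / (2 * a))"
  have sum: "((\<lambda>\<gamma>. ?\<Psi> (s + - \<gamma>) * cnj (?\<Psi> (s + - \<gamma> - t))) has_sum ?K t) D.lat" for s t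
  proof -
    have w0: "w s x = 0" if "x - - a \<notin> L.cell" for x s
      using that a unfolding Lcell by (auto simp: w_def window_density_def indicator_def T_def)
    have "((\<lambda>\<eta>. fourier (w s) \<eta> * cnj (fourier (w (s - t)) \<eta>)) has_sum of_real L.covol * L2_inner (w s) (w (s - t))) (dual_lattice L.lat)"
      by (rule L.Parseval[where z = "- a"]) (rule wL2 w0; assumption?)+
    then have "((\<lambda>\<eta>. ?\<Psi> (s + \<eta>) * cnj (?\<Psi> (s - t + \<eta>))) has_sum ?K t) D.lat"
      by (simp add: fw inner dual Lcovol)
    moreover have "bij_betw uminus D.lat D.lat"
      by (rule bij_betw_byWitness[where f' = uminus]) (auto intro: D.lat_uminus)
    ultimately have "((\<lambda>\<eta>. ?\<Psi> (s + - \<eta>) * cnj (?\<Psi> (s - t + - \<eta>))) has_sum ?K t) D.lat"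
      by (subst has_sum_reindex_bij_betw[of uminus D.lat D.lat "\<lambda>\<eta>. ?\<Psi> (s + \<eta>) * cnj (?\<Psi> (s - t + \<eta>))"])
    then show ?thesis by (simp add: algebra_simps)
  qed
  \<comment> \<open>For \<open>t = 0\<close> the periodization of the squared modulus is constant,
    so its integral over the line is finite. Unfolding the convolution integral relies on this
    integrability.\<close>
  have \<Psi>L2: "?\<Psi> \<in> Lp 2"
    unfolding Lp_2_iff
  proof (intro conjI integrableI_bounded)
    interpret pair_sigma_finite "count_space D.lat" "lborel :: real measure" by (rule D.pair_sigma_finite_lat)
    show "?\<Psi> \<in> borel_measurable borel" "(\<lambda>t. (norm (?\<Psi> t))\<^sup>2) \<in> borel_measurable lborel" by measurable
    have in_sum: "(\<integral>\<^sup>+\<gamma>. ennreal ((norm (?\<Psi> (s + - \<gamma>)))\<^sup>2) \<partial>count_space D.lat) = ennreal (Re (?K 0))" for s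
    proof -
      note S = sum[of s 0]
      have "(\<integral>\<^sup>+\<gamma>. ennreal ((norm (?\<Psi> (s + - \<gamma>)))\<^sup>2) \<partial>count_space D.lat)
        = (\<integral>\<^sup>+\<gamma>. ennreal (Re (?\<Psi> (s + - \<gamma>) * cnj (?\<Psi> (s + - \<gamma> - 0)))) \<partial>count_space D.lat)"
        by (intro nn_integral_cong) (simp add: complex_norm_square[symmetric] del: of_real_power)
      also have "\<dots> = ennreal (\<integral>\<gamma>. Re (?\<Psi> (s + - \<gamma>) * cnj (?\<Psi> (s + - \<gamma> - 0))) \<partial>count_space D.lat)"
        by (intro nn_integral_eq_integral integrable_Re integrable_count_space_has_sum(1)[OF S]) auto
      also have "(\<integral>\<gamma>. Re (?\<Psi> (s + - \<gamma>) * cnj (?\<Psi> (s + - \<gamma> - 0))) \<partial>count_space D.lat) = Re (?K 0)"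
        using integrable_count_space_has_sum[OF S] by (simp only: integral_Re)
      finally show ?thesis .
    qed
    have "(\<integral>\<^sup>+t. ennreal (norm ((norm (?\<Psi> t))\<^sup>2)) \<partial>lborel) = (\<integral>\<^sup>+\<gamma>. \<integral>\<^sup>+x. ennreal ((norm (?\<Psi> (x + - \<gamma>)))\<^sup>2) * indicator D.cell x \<partial>lborel \<partial>count_space D.lat)"
      by (subst D.nn_integral_unfold) auto
    also have "\<dots> = (\<integral>\<^sup>+x. \<integral>\<^sup>+\<gamma>. ennreal ((norm (?\<Psi> (x + - \<gamma>)))\<^sup>2) * indicator D.cell x \<partial>count_space D.lat \<partial>lborel)"
    proof (rule Fubini'[symmetric])
      show "(\<lambda>(\<gamma>, x). ennreal ((norm (?\<Psi> (x + - \<gamma>)))\<^sup>2) * indicator D.cell x) \<in> borel_measurable (count_space D.lat \<Otimes>\<^sub>M lborel)"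
        by (intro measurable_pair_measure_countable1 D.countable_lat) (simp, measurable)
    qed
    also have "\<dots> = (\<integral>\<^sup>+x. ennreal (Re (?K 0)) * indicator D.cell x \<partial>lborel)"
      by (intro nn_integral_cong) (simp only: nn_integral_multc borel_measurable_count_space in_sum)
    also have "\<dots> < \<infinity>"
      by (subst nn_integral_cmult_indicator) (auto simp: D.emeasure_cell ennreal_mult_less_top)
    finally show "(\<integral>\<^sup>+t. ennreal (norm ((norm (?\<Psi> t))\<^sup>2)) \<partial>lborel) < \<infinity>" .
  qed
  let ?f = "\<lambda>s. ?\<Psi> s * cnj (?\<Psi> (s - t))"
  have "convol ?\<Psi> ?\<Psi> t = (\<integral>s. ?f s * 1 \<partial>lborel)"
    by (simp add: convol_def cnj_fourier_window_density)
  also have "\<dots> = (\<integral>s. D.periodize ?f s * 1 * indicator D.cell s \<partial>lborel)"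
  proof (rule D.periodize_integral[symmetric])
    show "integrable lborel (\<lambda>s. ?f s * 1)"
      using Lp_2_mult_integrable[OF \<Psi>L2 Lp_2_translate[OF \<Psi>L2, of "- t"]] by simp
    show "?f \<in> borel_measurable borel" by measurable
  qed simp_all
  also have "\<dots> = (\<integral>s. ?K t * of_real (indicat_real D.cell s) \<partial>lborel)"
    unfolding D.periodize_def using integrable_count_space_has_sum(2)[OF sum]
    by (intro Bochner_Integration.integral_cong refl) (simp add: of_real_indicator)
  also have "\<dots> = ?K t * of_real D.covol"
    by (simp only: integral_mult_right_zero integral_complex_of_real) (simp add: D.covol_def)
  also have "\<dots> = ?\<Psi> t / (2 * a)" using T by (simp add: Dcovol)
  finally show ?thesis .
qed

subsection \<open>Convolutions with short windows\<close>

text \<open>A Lipschitz condition for translations in L1, suited to discontinuous functions such as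
  windows. It survives convolution with a window with the same constant, and such a convolution
  displaces the function in L1 by at most \<open>K\<close> times the half-length of the
  window.\<close>

definition shift_bounded :: "real \<Rightarrow> (real \<Rightarrow> complex) \<Rightarrow> bool" where
  "shift_bounded K p \<longleftrightarrow> (\<forall>s. (\<integral>\<^sup>+x. ennreal (norm (p (x + s) - p x)) \<partial>lborel) \<le> ennreal (K * \<bar>s\<bar>))"

text \<open>The window and its translate differ only inside two intervals of length
  \<open>\<bar>s\<bar>\<close> at the endpoints, where the difference has modulus at most
  \<open>1 / (2 * b)\<close>.\<close>

lemma shift_bounded_window:
  assumes b: "0 < b"
  shows "shift_bounded (1 / b) (window_density b)"
  unfolding shift_bounded_def
proof
  fix s
  let ?I = "{min (- b - s) (- b)..max (- b - s) (- b)}" and ?J = "{min (b - s) b..max (b - s) b}"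
  have "(\<integral>\<^sup>+x. ennreal (norm (window_density b (x + s) - window_density b x)) \<partial>lborel)
    \<le> (\<integral>\<^sup>+x. ennreal (1 / (2 * b)) * indicator ?I x + ennreal (1 / (2 * b)) * indicator ?J x \<partial>lborel)"
  proof (rule nn_integral_mono)
    fix x
    show "ennreal (norm (window_density b (x + s) - window_density b x))
      \<le> ennreal (1 / (2 * b)) * indicator ?I x + ennreal (1 / (2 * b)) * indicator ?J x"
    proof (cases "x + s \<in> {- b..b} \<longleftrightarrow> x \<in> {- b..b}")
      case True
      then have "window_density b (x + s) - window_density b x = 0" by (auto simp: window_density_def indicator_def)
      then show ?thesis by simp
    next
      case False
      then have "x \<in> ?I \<or> x \<in> ?J" by auto
      moreover have "norm (window_density b (x + s) - window_density b x) = 1 / (2 * b)"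
        using False b
        by (simp only: window_density_def of_real_diff[symmetric] norm_of_real) (auto simp: indicator_def)
      ultimately show ?thesis by (auto simp: indicator_def)
    qed
  qed
  also have "\<dots> = ennreal (1 / (2 * b)) * ennreal \<bar>s\<bar> + ennreal (1 / (2 * b)) * ennreal \<bar>s\<bar>"
  proof -
    have "emeasure lborel ?I = ennreal \<bar>s\<bar>" "emeasure lborel ?J = ennreal \<bar>s\<bar>"
      by (auto simp: max_def min_def abs_if)
    then show ?thesis by (subst nn_integral_add) (auto simp: nn_integral_cmult_indicator)
  qed
  also have "\<dots> = ennreal (1 / b * \<bar>s\<bar>)" using b by (simp add: ennreal_mult[symmetric] ennreal_plus[symmetric] field_simps del: ennreal_plus)
  finally show "(\<integral>\<^sup>+x. ennreal (norm (window_density b (x + s) - window_density b x)) \<partial>lborel) \<le> ennreal (1 / b * \<bar>s\<bar>)" .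
qed

context
  fixes p :: "real \<Rightarrow> complex" and b B K :: real
  assumes b: "0 < b" and p [measurable]: "p \<in> borel_measurable borel" and pB: "\<And>x. norm (p x) \<le> B"
    and int_p: "integrable lborel p" and K: "0 \<le> K" and shift: "shift_bounded K p"
begin

lemma convol_window_eq: "convol p (window_density b) x = (\<integral>r. p (x - r) * window_density b r \<partial>lborel)"
  unfolding convol_def
  by (subst lborel_integral_real_affine[where c = "- 1" and t = x]) auto

lemma convol_window_integrable: "integrable lborel (\<lambda>r. p (x - r) * window_density b r)"
proof (rule Bochner_Integration.integrable_bound)
  show "integrable lborel (\<lambda>r. B * norm (window_density b r))"
    using window_density_integrable[of b] by auto
  show "AE r in lborel. norm (p (x - r) * window_density b r) \<le> norm (B * norm (window_density b r))"
    using pB order_trans[OF norm_ge_zero pB[of 0]] by (auto simp: norm_mult intro!: mult_right_mono)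
qed measurable

lemma convol_window_measurable: "convol p (window_density b) \<in> borel_measurable borel"
  unfolding convol_window_eq[abs_def] by measurable

lemma integral_window_density: "(\<integral>r. window_density b r \<partial>lborel) = 1"
  unfolding window_density_def using b by (subst integral_complex_of_real) simp

lemma convol_window_bound: "norm (convol p (window_density b) x) \<le> B"
proof -
  have B: "0 \<le> B" using order_trans[OF norm_ge_zero pB[of 0]] .
  have "ennreal (norm (convol p (window_density b) x)) \<le> (\<integral>\<^sup>+r. norm (p (x - r) * window_density b r) \<partial>lborel)"
    unfolding convol_window_eq by (rule integral_norm_bound_ennreal[OF convol_window_integrable])
  also have "\<dots> \<le> (\<integral>\<^sup>+r. ennreal B * ennreal (norm (window_density b r)) \<partial>lborel)"
    using pB B by (intro nn_integral_mono) (auto simp: norm_mult ennreal_mult[symmetric] intro!: ennreal_leI mult_right_mono)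
  also have "\<dots> = ennreal B * (\<integral>\<^sup>+r. ennreal (norm (window_density b r)) \<partial>lborel)" by (rule nn_integral_cmult) measurable
  also have "\<dots> = ennreal B" using nn_integral_window_density[OF b] by simp
  finally show ?thesis using B by simp
qed

text \<open>Minkowski's integral inequality: \<open>q\<close> is an average of differences over the
  window, so its L1 norm is at most the largest norm of a difference. With
  \<open>p' x r = p x\<close> this gives the displacement by convolution, with
  \<open>p' x r = p (x - r)\<close> the effect of a translation on the convolution.\<close>

lemma convol_window_L1_aux:
  assumes [measurable]: "q \<in> borel_measurable borel" and q: "\<And>x. q x = (\<integral>r. p (x + s - r) * window_density b r \<partial>lborel) - (\<integral>r. p' x r * window_density b r \<partial>lborel)"
    and [measurable]: "(\<lambda>z. p' (fst z) (snd z)) \<in> borel_measurable (borel \<Otimes>\<^sub>M borel)"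
    and int: "\<And>x. integrable lborel (\<lambda>r. p' x r * window_density b r)"
    and le: "\<And>r. \<bar>r\<bar> \<le> b \<Longrightarrow> (\<integral>\<^sup>+x. ennreal (norm (p (x + s - r) - p' x r)) \<partial>lborel) \<le> ennreal M"
  shows "(\<integral>\<^sup>+x. ennreal (norm (q x)) \<partial>lborel) \<le> ennreal M"
proof -
  have [measurable]: "(\<lambda>x. p' x r) \<in> borel_measurable borel" for r
    using measurable_compose[OF _ assms(3), of "\<lambda>x. (x, r)" borel] by simp
  have "(\<integral>\<^sup>+x. ennreal (norm (q x)) \<partial>lborel) \<le> (\<integral>\<^sup>+x. \<integral>\<^sup>+r. ennreal (norm (p (x + s - r) - p' x r)) * ennreal (norm (window_density b r)) \<partial>lborel \<partial>lborel)"
  proof (rule nn_integral_mono)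
    fix x
    have "q x = (\<integral>r. p (x + s - r) * window_density b r - p' x r * window_density b r \<partial>lborel)"
      unfolding q by (rule Bochner_Integration.integral_diff[symmetric, OF convol_window_integrable int])
    then have "ennreal (norm (q x)) \<le> (\<integral>\<^sup>+r. norm (p (x + s - r) * window_density b r - p' x r * window_density b r) \<partial>lborel)"
      by (simp only:) (intro integral_norm_bound_ennreal Bochner_Integration.integrable_diff convol_window_integrable int)
    also have "\<dots> = (\<integral>\<^sup>+r. ennreal (norm (p (x + s - r) - p' x r)) * ennreal (norm (window_density b r)) \<partial>lborel)"
      by (intro nn_integral_cong) (simp add: ennreal_mult[symmetric] norm_mult[symmetric] left_diff_distrib)
    finally show "ennreal (norm (q x)) \<le> (\<integral>\<^sup>+r. ennreal (norm (p (x + s - r) - p' x r)) * ennreal (norm (window_density b r)) \<partial>lborel)" .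
  qed
  also have "\<dots> = (\<integral>\<^sup>+r. \<integral>\<^sup>+x. ennreal (norm (p (x + s - r) - p' x r)) * ennreal (norm (window_density b r)) \<partial>lborel \<partial>lborel)"
    by (rule lborel_pair.Fubini'[symmetric]) measurable
  also have "\<dots> \<le> (\<integral>\<^sup>+r. ennreal M * ennreal (norm (window_density b r)) \<partial>lborel)"
  proof (rule nn_integral_mono)
    fix r
    have "(\<integral>\<^sup>+x. ennreal (norm (p (x + s - r) - p' x r)) * ennreal (norm (window_density b r)) \<partial>lborel)
      = (\<integral>\<^sup>+x. ennreal (norm (p (x + s - r) - p' x r)) \<partial>lborel) * ennreal (norm (window_density b r))"
      by (rule nn_integral_multc) measurable
    also have "\<dots> \<le> ennreal M * ennreal (norm (window_density b r))"
      \<comment> \<open>For \<open>r\<close> outside \<open>{- b..b}\<close> the density is 0, so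
        the bound \<open>M\<close> enters only inside.\<close>
      using le[of r] by (cases "\<bar>r\<bar> \<le> b") (auto intro!: mult_right_mono simp: window_density_def indicator_def abs_le_iff)
    finally show "(\<integral>\<^sup>+x. ennreal (norm (p (x + s - r) - p' x r)) * ennreal (norm (window_density b r)) \<partial>lborel) \<le> \<dots>" .
  qed
  also have "\<dots> = ennreal M * (\<integral>\<^sup>+r. ennreal (norm (window_density b r)) \<partial>lborel)" by (rule nn_integral_cmult) measurable
  also have "\<dots> = ennreal M" using nn_integral_window_density[OF b] by simp
  finally show ?thesis .
qed

lemma convol_window_L1: "(\<integral>\<^sup>+x. ennreal (norm (convol p (window_density b) x - p x)) \<partial>lborel) \<le> ennreal (K * b)"
proof (rule convol_window_L1_aux[where s = 0 and p' = "\<lambda>x r. p x"])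
  have [measurable]: "convol p (window_density b) \<in> borel_measurable borel" by (rule convol_window_measurable)
  show "(\<lambda>x. convol p (window_density b) x - p x) \<in> borel_measurable borel" by measurable
  show "convol p (window_density b) x - p x = (\<integral>r. p (x + 0 - r) * window_density b r \<partial>lborel) - (\<integral>r. p x * window_density b r \<partial>lborel)" for x
    by (simp add: convol_window_eq integral_window_density)
  show "integrable lborel (\<lambda>r. p x * window_density b r)" for x using window_density_integrable by auto
  show "(\<integral>\<^sup>+x. ennreal (norm (p (x + 0 - r) - p x)) \<partial>lborel) \<le> ennreal (K * b)" if "\<bar>r\<bar> \<le> b" for r
  proof -
    have "(\<integral>\<^sup>+x. ennreal (norm (p (x + - r) - p x)) \<partial>lborel) \<le> ennreal (K * \<bar>- r\<bar>)"
      using shift unfolding shift_bounded_def by blast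
    also have "\<dots> \<le> ennreal (K * b)" using that K by (intro ennreal_leI mult_left_mono) auto
    finally show ?thesis by simp
  qed
qed measurable

lemma convol_window_shift_bounded: "shift_bounded K (convol p (window_density b))"
  unfolding shift_bounded_def
proof
  fix s
  show "(\<integral>\<^sup>+x. ennreal (norm (convol p (window_density b) (x + s) - convol p (window_density b) x)) \<partial>lborel) \<le> ennreal (K * \<bar>s\<bar>)"
  proof (rule convol_window_L1_aux[where s = s and p' = "\<lambda>x r. p (x - r)"])
    have [measurable]: "convol p (window_density b) \<in> borel_measurable borel" by (rule convol_window_measurable)
    show "(\<lambda>x. convol p (window_density b) (x + s) - convol p (window_density b) x) \<in> borel_measurable borel" by measurable
    show "(\<integral>\<^sup>+x. ennreal (norm (p (x + s - r) - p (x - r))) \<partial>lborel) \<le> ennreal (K * \<bar>s\<bar>)" for r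
    proof -
      have "(\<integral>\<^sup>+x. ennreal (norm (p (x + s - r) - p (x - r))) \<partial>lborel) = (\<integral>\<^sup>+x. ennreal (norm (p (x + s) - p x)) \<partial>lborel)"
        using nn_integral_translate[of "\<lambda>x. ennreal (norm (p (x + s) - p x))" "- r"] by (simp add: algebra_simps)
      then show ?thesis using shift unfolding shift_bounded_def by simp
    qed
  qed (simp_all add: convol_window_eq convol_window_integrable)
qed

lemma integrable_convol_window: "integrable lborel (convol p (window_density b))"
proof -
  have [measurable]: "convol p (window_density b) \<in> borel_measurable borel" by (rule convol_window_measurable)
  have "integrable lborel (\<lambda>x. convol p (window_density b) x - p x)"
  proof (rule integrableI_bounded)
    show "(\<integral>\<^sup>+x. ennreal (norm (convol p (window_density b) x - p x)) \<partial>lborel) < \<infinity>"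
      using convol_window_L1 by (rule le_less_trans) simp
  qed measurable
  from Bochner_Integration.integrable_add[OF this int_p] show ?thesis by simp
qed

end

section \<open>The infinite convolution products and their limit\<close>

lemma normalized_indicator_interval: "0 < b \<Longrightarrow> normalized_indicator {- b..b} = window_density b"
  by (auto simp: normalized_indicator_def window_density_def)

lemma psi_factor_eq:
  assumes "0 < a" "0 < \<epsilon>" "\<epsilon> < 1" "0 < n"
  shows "psi_factor {- a..a} \<epsilon> n s = window_density ((\<epsilon> ^ n) ^ s * ((1 - \<epsilon> ^ n) * a))"
proof -
  have "\<epsilon> ^ n < 1" using assms by (simp add: power_less_one_iff)
  then have c: "0 < 1 - \<epsilon> ^ n" "0 < \<epsilon> ^ (n * s)" using assms by auto
  have "(*) (\<epsilon> ^ (n * s)) ` (*) (1 - \<epsilon> ^ n) ` {- a..a} =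
    {- ((\<epsilon> ^ n) ^ s * ((1 - \<epsilon> ^ n) * a))..(\<epsilon> ^ n) ^ s * ((1 - \<epsilon> ^ n) * a)}"
    using c by (simp add: image_mult_atLeastAtMost power_mult)
  then show ?thesis using c assms by (simp add: psi_factor_def normalized_indicator_interval)
qed

text \<open>Both densities have mass 1: the excess of the taller one on \<open>{- b..b}\<close> and
  the part of the flatter one outside each have mass \<open>1 - b / a\<close>.\<close>

lemma L1_dist_window:
  assumes "0 < b" "b \<le> a"
  shows "(\<integral>x. norm (window_density b x - window_density a x) \<partial>lborel) \<le> 2 * (1 - b / a)"
proof -
  have a: "0 < a" using assms by linarith
  have i: "integrable lborel (\<lambda>x. (1 / (2 * b) - 1 / (2 * a)) * indicat_real {- b..b} x + 1 / (2 * a) * (indicat_real {- a..a} x - indicat_real {- b..b} x))"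
    by (intro Bochner_Integration.integrable_add Bochner_Integration.integrable_diff integrable_mult_right integrable_indicator_Icc)
  have "(\<integral>x. norm (window_density b x - window_density a x) \<partial>lborel)
    \<le> (\<integral>x. (1 / (2 * b) - 1 / (2 * a)) * indicat_real {- b..b} x + 1 / (2 * a) * (indicat_real {- a..a} x - indicat_real {- b..b} x) \<partial>lborel)"
  proof (rule integral_mono[OF _ i])
    show "integrable lborel (\<lambda>x. norm (window_density b x - window_density a x))"
      using window_density_integrable by auto
    fix x
    have "1 / (2 * a) \<le> 1 / (2 * b)" using assms by (intro divide_left_mono) auto
    moreover have "norm (window_density b x - window_density a x) = \<bar>indicat_real {- b..b} x / (2 * b) - indicat_real {- a..a} x / (2 * a)\<bar>"
      by (simp only: window_density_def of_real_diff[symmetric] norm_of_real)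
    ultimately show "norm (window_density b x - window_density a x) \<le> (1 / (2 * b) - 1 / (2 * a)) * indicat_real {- b..b} x + 1 / (2 * a) * (indicat_real {- a..a} x - indicat_real {- b..b} x)"
      using assms a by (auto simp: indicator_def)
  qed
  also have "\<dots> = (1 / (2 * b) - 1 / (2 * a)) * (2 * b) + 1 / (2 * a) * (2 * a - 2 * b)"
    using assms a integrable_indicator_Icc by (subst Bochner_Integration.integral_add) auto
  also have "\<dots> = 2 * (1 - b / a)" using assms a by (simp add: field_simps)
  finally show ?thesis .
qed

text \<open>With \<open>\<theta> = \<epsilon> ^ n\<close>, the factor of index \<open>s > 0\<close>
  is a window of half-length \<open>\<theta> ^ s * b\<close>; it displaces the partial product,
  whose translation constant is \<open>1 / b\<close>, by at most \<open>\<theta> ^ s\<close>. The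
  geometric series gives \<open>\<theta> / (1 - \<theta>)\<close>. The remaining
  \<open>2 * \<theta>\<close> is the distance of the first window, of half-length
  \<open>b = (1 - \<theta>) * a\<close>, from the one of half-length \<open>a\<close>. As
  \<open>psi\<close> is an arbitrary L1 limit, the estimate is passed to it through that property
  alone.\<close>

lemma psi_L1:
  assumes a: "0 < a" and \<epsilon>: "0 < \<epsilon>" "\<epsilon> < 1" and n: "0 < n"
  shows "integrable lborel (psi {- a..a} \<epsilon> n)"
    "(\<integral>x. norm (psi {- a..a} \<epsilon> n x - window_density a x) \<partial>lborel) \<le> \<epsilon> ^ n / (1 - \<epsilon> ^ n) + 2 * \<epsilon> ^ n"
proof -
  define \<theta> where "\<theta> = \<epsilon> ^ n"
  have \<theta>: "0 < \<theta>" "\<theta> < 1" using \<epsilon> n by (auto simp: \<theta>_def power_less_one_iff)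
  define b where "b = (1 - \<theta>) * a"
  have b: "0 < b" "b \<le> a" using \<theta> a by (auto simp: b_def mult_le_cancel_right1)
  define p where "p = psi_partial {- a..a} \<epsilon> n"
  have fac: "psi_factor {- a..a} \<epsilon> n s = window_density (\<theta> ^ s * b)" for s
    using psi_factor_eq[OF a \<epsilon> n] by (simp add: \<theta>_def b_def)
  have p0: "p 0 = window_density b" by (simp add: p_def fac)
  have pS: "p (Suc N) = convol (p N) (window_density (\<theta> ^ Suc N * b))" for N by (simp add: p_def fac del: power_Suc)
  have bN: "0 < \<theta> ^ N * b" for N using \<theta> b by simp
  have inv: "p N \<in> borel_measurable borel \<and> (\<forall>x. norm (p N x) \<le> 1 / (2 * b)) \<and> integrable lborel (p N) \<and> shift_bounded (1 / b) (p N)" for N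
  proof (induction N)
    case 0
    then show ?case using b window_density_integrable[of b] shift_bounded_window[OF b(1)]
      by (auto simp: p0 norm_window_density indicator_def)
  next
    case (Suc N)
    note I = bN[of "Suc N"] Suc[THEN conjunct1] Suc[THEN conjunct2, THEN conjunct1, rule_format]
      Suc[THEN conjunct2, THEN conjunct2, THEN conjunct1] _ Suc[THEN conjunct2, THEN conjunct2, THEN conjunct2]
    have "0 \<le> 1 / b" using b by simp
    then show ?case
      unfolding pS using convol_window_measurable[OF I] convol_window_bound[OF I] integrable_convol_window[OF I]
        convol_window_shift_bounded[OF I] by blast
  qed
  have int: "integrable lborel (p N)" for N using inv by blast
  have step: "(\<integral>x. norm (p (Suc N) x - p N x) \<partial>lborel) \<le> \<theta> ^ Suc N" for N
  proof -
    have "ennreal (\<integral>x. norm (p (Suc N) x - p N x) \<partial>lborel) = (\<integral>\<^sup>+x. ennreal (norm (p (Suc N) x - p N x)) \<partial>lborel)"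
      using int by (intro nn_integral_eq_integral[symmetric]) auto
    also have "\<dots> \<le> ennreal (1 / b * (\<theta> ^ Suc N * b))"
      unfolding pS by (rule convol_window_L1[OF bN]) (use inv[of N] b in auto)
    also have "1 / b * (\<theta> ^ Suc N * b) = \<theta> ^ Suc N" using b by simp
    finally show ?thesis using \<theta> by (simp add: ennreal_le_iff)
  qed
  have "summable (\<lambda>N. \<integral>x. norm (p (Suc N) x - p N x) \<partial>lborel)"
  proof (rule summable_comparison_test')
    show "summable (\<lambda>N. \<theta> ^ Suc N)" using \<theta> by (subst summable_Suc_iff) (simp add: summable_geometric)
    show "norm (\<integral>x. norm (p (Suc N) x - p N x) \<partial>lborel) \<le> \<theta> ^ Suc N" if "0 \<le> N" for N
      using step[of N] by (simp add: integral_nonneg_AE)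
  qed
  then obtain f where "integrable lborel f" "(\<lambda>N. \<integral>x. norm (p N x - f x) \<partial>lborel) \<longlonglongrightarrow> 0"
    by (rule L1_convergent[of lborel p, OF int]) (blast intro: that)
  then have "\<exists>f. integrable lborel f \<and> (\<lambda>N. \<integral>t. norm (psi_partial {- a..a} \<epsilon> n N t - f t) \<partial>lborel) \<longlonglongrightarrow> 0"
    unfolding p_def by blast
  from someI_ex[OF this] have psi: "integrable lborel (psi {- a..a} \<epsilon> n)"
    and lim: "(\<lambda>N. \<integral>t. norm (p N t - psi {- a..a} \<epsilon> n t) \<partial>lborel) \<longlonglongrightarrow> 0"
    unfolding psi_def p_def by blast+
  show "integrable lborel (psi {- a..a} \<epsilon> n)" by (rule psi)
  have tri: "(\<integral>x. norm (f x - h x) \<partial>lborel) \<le> (\<integral>x. norm (f x - g x) \<partial>lborel) + (\<integral>x. norm (g x - h x) \<partial>lborel)"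
    if [simp]: "integrable lborel f" "integrable lborel g" "integrable lborel h" for f g h :: "real \<Rightarrow> complex"
  proof -
    have "(\<integral>x. norm (f x - h x) \<partial>lborel) \<le> (\<integral>x. norm (f x - g x) + norm (g x - h x) \<partial>lborel)"
      by (rule integral_mono) (auto intro: norm_triangle_sub order_trans[OF _ norm_triangle_ineq])
    then show ?thesis by simp
  qed
  have sumle: "(\<Sum>j<N. \<theta> ^ Suc j) \<le> \<theta> / (1 - \<theta>)" for N
  proof -
    have "(\<Sum>j<N. \<theta> ^ Suc j) = \<theta> * (\<Sum>j<N. \<theta> ^ j)" by (simp add: sum_distrib_left)
    also have "(\<Sum>j<N. \<theta> ^ j) \<le> (\<Sum>j. \<theta> ^ j)" using \<theta> by (intro sum_le_suminf summable_geometric) auto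
    also have "\<dots> = 1 / (1 - \<theta>)" using \<theta> by (intro suminf_geometric) auto
    finally show ?thesis using \<theta> by simp
  qed
  have pN: "(\<integral>x. norm (p N x - p 0 x) \<partial>lborel) \<le> (\<Sum>j<N. \<theta> ^ Suc j)" for N
  proof (induction N)
    case (Suc N)
    then show ?case using tri[OF int[of "Suc N"] int[of N] int[of 0]] step[of N] by simp
  qed simp
  have "(\<integral>x. norm (psi {- a..a} \<epsilon> n x - p 0 x) \<partial>lborel) \<le> (\<integral>t. norm (p N t - psi {- a..a} \<epsilon> n t) \<partial>lborel) + \<theta> / (1 - \<theta>)" for N
    using tri[OF psi int[of N] int[of 0]] pN[of N] sumle[of N] by (simp add: norm_minus_commute)
  then have "(\<integral>x. norm (psi {- a..a} \<epsilon> n x - p 0 x) \<partial>lborel) \<le> 0 + \<theta> / (1 - \<theta>)"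
    by (intro LIMSEQ_le_const[OF tendsto_add[OF lim tendsto_const]]) auto
  moreover have "(\<integral>x. norm (p 0 x - window_density a x) \<partial>lborel) \<le> 2 * \<theta>"
    using L1_dist_window[OF b] a unfolding p0 by (simp add: b_def)
  ultimately show "(\<integral>x. norm (psi {- a..a} \<epsilon> n x - window_density a x) \<partial>lborel) \<le> \<epsilon> ^ n / (1 - \<epsilon> ^ n) + 2 * \<epsilon> ^ n"
    using tri[OF psi int[of 0] window_density_integrable[of a]] by (simp add: \<theta>_def)
qed

lemma Psi_eq:
  assumes a: "0 < a" and \<epsilon>: "0 < \<epsilon>" "\<epsilon> < 1"
  shows "Psi {- a..a} \<epsilon> = fourier (window_density a)"
proof -
  have unif: "uniform_limit UNIV (\<lambda>n. fourier (psi {- a..a} \<epsilon> n)) (fourier (window_density a)) sequentially"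
  proof (rule uniform_limitI)
    fix e :: real assume "0 < e"
    have "(\<lambda>n. \<epsilon> ^ n) \<longlonglongrightarrow> 0" using \<epsilon> by (intro LIMSEQ_power_zero) simp
    then have "(\<lambda>n. \<epsilon> ^ n / (1 - \<epsilon> ^ n) + 2 * \<epsilon> ^ n) \<longlonglongrightarrow> 0 / (1 - 0) + 2 * 0"
      by (intro tendsto_add tendsto_divide tendsto_mult tendsto_diff tendsto_const) auto
    then have "\<forall>\<^sub>F n in sequentially. \<epsilon> ^ n / (1 - \<epsilon> ^ n) + 2 * \<epsilon> ^ n < e"
      using \<open>0 < e\<close> by (intro order_tendstoD(2)) auto
    then show "\<forall>\<^sub>F n in sequentially. \<forall>x\<in>UNIV. dist (fourier (psi {- a..a} \<epsilon> n) x) (fourier (window_density a) x) < e"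
      \<comment> \<open>This excludes \<open>n = 0\<close>, where the factors are
        degenerate.\<close>
      using eventually_gt_at_top[of 0]
    proof eventually_elim
      case (elim n)
      note P = psi_L1[OF a \<epsilon> elim(2)]
      show ?case
      proof
        fix x
        have "dist (fourier (psi {- a..a} \<epsilon> n) x) (fourier (window_density a) x) =
          norm (fourier (\<lambda>t. psi {- a..a} \<epsilon> n t - window_density a t) x)"
          by (simp add: dist_norm fourier_diff P window_density_integrable)
        also have "\<dots> \<le> (\<integral>t. norm (psi {- a..a} \<epsilon> n t - window_density a t) \<partial>lborel)" by (rule norm_fourier_le)
        also have "\<dots> < e" using P(2) elim(1) by linarith
        finally show "dist (fourier (psi {- a..a} \<epsilon> n) x) (fourier (window_density a) x) < e" .
      qed
    qed
  qed
  show ?thesis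
    unfolding Psi_def
  proof (rule the_equality)
    show "uniform_limit UNIV (\<lambda>n. fourier (psi {- a..a} \<epsilon> n)) (fourier (window_density a)) sequentially"
      by (rule unif)
    fix F assume F: "uniform_limit UNIV (\<lambda>n. fourier (psi {- a..a} \<epsilon> n)) F sequentially"
    show "F = fourier (window_density a)"
    proof
      fix x
      show "F x = fourier (window_density a) x"
        by (rule LIMSEQ_unique[OF tendsto_uniform_limitI[OF F UNIV_I] tendsto_uniform_limitI[OF unif UNIV_I]])
    qed
  qed
qed

text \<open>By the reproducing formula, the prefactor \<open>2 * a\<close> undoes the division in
  the convolution of \<Psi> with itself, so \<Phi> coincides with \<Psi>.\<close>

theorem Phi_eq:
  assumes a: "0 < a" and \<epsilon>: "0 < \<epsilon>" "\<epsilon> < 1"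
  shows "Phi {- a..a} \<epsilon> t = fourier (indicator {- a..a}) t / (2 * a)"
proof -
  have "Phi {- a..a} \<epsilon> t = fourier (window_density a) t"
    using a by (simp add: Phi_def Psi_eq[OF assms] convol_fourier_window)
  also have "\<dots> = (\<integral>x. indicator {- a..a} x * cis (- (2 * pi * (x \<bullet> t))) / (2 * a) \<partial>lborel)"
    unfolding fourier_def window_density_def
    by (intro Bochner_Integration.integral_cong refl) (auto simp: indicator_def)
  also have "\<dots> = fourier (indicator {- a..a}) t / (2 * a)"
    unfolding fourier_def by (rule integral_divide_zero)
  finally show ?thesis .
qed

section \<open>Lattice bases, windows and amalgam spaces\<close>

text \<open>The lattice basis has as many elements as the standard basis, so a linear map
  \<open>C\<close> can send the one to the other; the coordinates of \<open>C x\<close> are then the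
  coefficients of \<open>x\<close> in the lattice basis.\<close>

lemma is_lattice_coords:
  fixes \<Gamma> :: "'a::euclidean_space set"
  assumes "is_lattice \<Gamma>"
  obtains C :: "'a \<Rightarrow> 'a" where "linear C" "inj C" "\<Gamma> = {x. \<forall>i\<in>Basis. C x \<bullet> i \<in> \<int>}"
proof -
  obtain B where B: "independent B" "span B = UNIV"
    and \<Gamma>: "\<Gamma> = range (\<lambda>c :: 'a \<Rightarrow> int. \<Sum>b\<in>B. of_int (c b) *\<^sub>R b)"
    using assms unfolding is_lattice_def by blast
  have fin: "finite B" using B(1) independent_bound by blast
  have "card B = dim (span B)" using B(1) by (simp add: dim_eq_card_independent)
  then have "card B = card (Basis :: 'a set)" by (simp add: B(2))
  then obtain \<tau> where \<tau>: "bij_betw \<tau> B (Basis :: 'a set)"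
    using fin finite_same_card_bij by (metis finite_Basis)
  obtain C where C: "linear C" "\<And>b. b \<in> B \<Longrightarrow> C b = \<tau> b"
    using linear_independent_extend[OF B(1), of \<tau>] by blast
  have "range C = span (C ` B)" using linear_span_image[OF C(1), of B] B(2) by simp
  also have "C ` B = Basis" using C(2) \<tau> by (auto simp: bij_betw_def image_def)
  finally have "surj C" by simp
  then have inj: "inj C" using linear_surjective_imp_injective[OF C(1)] by blast
  have C_sum: "C (\<Sum>b\<in>B. of_int (c b) *\<^sub>R b) \<bullet> \<tau> b' = of_int (c b')" if "b' \<in> B" for c :: "'a \<Rightarrow> int" and b'
  proof -
    have "C (\<Sum>b\<in>B. of_int (c b) *\<^sub>R b) = (\<Sum>b\<in>B. of_int (c b) *\<^sub>R \<tau> b)"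
      using C by (simp add: linear_sum linear_scale)
    then have "C (\<Sum>b\<in>B. of_int (c b) *\<^sub>R b) \<bullet> \<tau> b' = (\<Sum>b\<in>B. of_int (c b) * (\<tau> b \<bullet> \<tau> b'))"
      by (simp add: inner_sum_left)
    also have "\<dots> = (\<Sum>b\<in>B. if b = b' then of_int (c b) else 0)"
    proof (rule sum.cong[OF refl])
      fix b assume b: "b \<in> B"
      have "\<tau> b \<in> Basis" "\<tau> b' \<in> Basis" "\<tau> b = \<tau> b' \<longleftrightarrow> b = b'"
        using \<tau> b that by (auto simp: bij_betw_def inj_on_eq_iff)
      then show "of_int (c b) * (\<tau> b \<bullet> \<tau> b') = (if b = b' then of_int (c b) else 0)"
        by (simp add: inner_Basis)
    qed
    finally show ?thesis using fin that by simp
  qed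
  have "\<Gamma> = {x. \<forall>i\<in>Basis. C x \<bullet> i \<in> \<int>}"
  proof (intro set_eqI iffI)
    fix x assume "x \<in> \<Gamma>"
    then obtain c :: "'a \<Rightarrow> int" where x: "x = (\<Sum>b\<in>B. of_int (c b) *\<^sub>R b)" by (auto simp: \<Gamma>)
    have "C x \<bullet> i \<in> \<int>" if "i \<in> Basis" for i
      using C_sum[of _ c] that \<tau> unfolding x bij_betw_def by force
    then show "x \<in> {x. \<forall>i\<in>Basis. C x \<bullet> i \<in> \<int>}" by blast
  next
    fix x assume x: "x \<in> {x. \<forall>i\<in>Basis. C x \<bullet> i \<in> \<int>}"
    define c where "c b = \<lfloor>C x \<bullet> \<tau> b\<rfloor>" for b
    have "C (\<Sum>b\<in>B. of_int (c b) *\<^sub>R b) \<bullet> i = C x \<bullet> i" if "i \<in> Basis" for i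
    proof -
      have "i \<in> \<tau> ` B" using that \<tau> by (simp add: bij_betw_def)
      then obtain b where b: "b \<in> B" "i = \<tau> b" by blast
      have "C x \<bullet> i \<in> \<int>" using x that by blast
      then show ?thesis using C_sum[OF b(1), of c] by (simp add: c_def b(2)[symmetric])
    qed
    then have "C (\<Sum>b\<in>B. of_int (c b) *\<^sub>R b) = C x" by (rule euclidean_eqI)
    then have "x = (\<Sum>b\<in>B. of_int (c b) *\<^sub>R b)" using inj by (simp add: inj_eq)
    then show "x \<in> \<Gamma>" by (auto simp: \<Gamma>)
  qed
  with C(1) inj show ?thesis by (rule that)
qed

lemma symmetric_window:
  fixes \<Omega> :: "real set"
  assumes "compact \<Omega>" "is_interval \<Omega>" "interior \<Omega> \<noteq> {}" "uminus ` \<Omega> = \<Omega>"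
  obtains a where "0 < a" "\<Omega> = {- a..a}"
proof -
  have "connected \<Omega>" using assms(2) by (simp add: is_interval_connected_1)
  then obtain l u where lu: "\<Omega> = {l..u}" using connected_compact_interval_1[of \<Omega>] assms(1) by auto
  have "interior \<Omega> = {l<..<u}" by (simp add: lu interior_atLeastAtMost_real)
  then have less: "l < u" using assms(3) by auto
  have "{- u..- l} = {l..u}" using assms(4) by (simp add: lu)
  then have "l = - u" using less by (simp add: Icc_eq_Icc)
  then show ?thesis using less lu by (intro that[of u]) auto
qed

section \<open>Amalgam spaces and square integrability\<close>

lemma integrable_count_space_summable:
  fixes f :: "'i \<Rightarrow> real"
  assumes "f summable_on A" "\<And>x. x \<in> A \<Longrightarrow> 0 \<le> f x"
  shows "integrable (count_space A) f"
proof -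
  have "(\<lambda>x. norm (f x)) summable_on A"
    using assms(1) by (rule summable_on_cong[THEN iffD1, rotated]) (simp add: assms(2))
  then have "Infinite_Set_Sum.abs_summable_on f A" by (rule abs_summable_equivalent[THEN iffD1])
  then show ?thesis by (simp add: Infinite_Set_Sum.abs_summable_on_def)
qed

lemma int_vecs_eq: "int_vecs = {x. \<forall>i\<in>Basis. x \<bullet> i \<in> \<int>}"
  by (auto simp: int_vecs_def Basis_vec_def inner_axis)

text \<open>Summable local norms are bounded by their sum and hence square-summable. The closed
  cubes overlap on their faces, so the sum over the cubes dominates the squared modulus instead of
  equalling it.\<close>

lemma amalgam_2_1_subset_Lp_2:
  fixes f :: "real ^ 'm \<Rightarrow> complex"
  assumes f: "f \<in> amalgam 2 1"
  shows "f \<in> Lp 2"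
proof -
  interpret I: lattice_coords "\<lambda>x::real^'m. x"
    by unfold_locales (auto intro: linearI)
  note [simp del] = I.C_simps I.C_inv I.inv_C
  have lat: "I.lat = int_vecs" by (simp add: I.lat_def int_vecs_eq)
  interpret pair_sigma_finite "count_space I.lat" "lborel :: (real^'m) measure" by (rule I.pair_sigma_finite_lat)
  have [measurable]: "f \<in> borel_measurable borel" using f by (simp add: amalgam_def)
  have cube [measurable]: "(+) k ` cbox 0 (\<chi> i. 1) \<in> sets borel" for k :: "real ^ 'm"
    by (intro borel_closed closed_translation closed_cbox)
  define b where "b k = Lp_norm 2 (cell_restrict k f)" for k
  have L2: "cell_restrict k f \<in> Lp 2" if "k \<in> int_vecs" for k using f that by (simp add: amalgam_def)
  have b0: "0 \<le> b k" for k by (simp add: b_def)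
  have "(\<lambda>k. b k powr 1) summable_on int_vecs" using f by (simp add: amalgam_def b_def)
  then have sb: "b summable_on int_vecs" by (simp add: b0)
  have b_le: "b k \<le> infsum b int_vecs" if "k \<in> int_vecs" for k
    using finite_sum_le_infsum[OF sb, of "{k}"] that b0 by simp
  have "(\<integral>\<^sup>+x. ennreal ((norm (f x))\<^sup>2) \<partial>lborel) \<le>
    (\<integral>\<^sup>+x. \<integral>\<^sup>+k. ennreal ((norm (cell_restrict k f x))\<^sup>2) \<partial>count_space I.lat \<partial>lborel)"
  proof (rule nn_integral_mono)
    fix x
    have "0 \<le> (x - I.base_pt x) $ i \<and> (x - I.base_pt x) $ i < 1" for i
    proof -
      have "axis i (1::real) \<in> Basis" by (simp add: axis_in_Basis_iff)
      moreover have "\<forall>j\<in>Basis. 0 \<le> (x - I.base_pt x) \<bullet> j \<and> (x - I.base_pt x) \<bullet> j < 1"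
        using I.base_pt_cell[of x] unfolding I.cell_def by (rule CollectD)
      ultimately have "0 \<le> (x - I.base_pt x) \<bullet> axis i 1 \<and> (x - I.base_pt x) \<bullet> axis i 1 < 1"
        by (rule bspec[rotated])
      then show ?thesis by (simp only: inner_axis inner_real_def mult_1_right)
    qed
    then have "x - I.base_pt x \<in> cbox 0 (\<chi> i. 1)"
      by (simp add: mem_box_cart less_imp_le)
    then have x: "x \<in> (+) (I.base_pt x) ` cbox 0 (\<chi> i. 1)" by (rule rev_image_eqI) simp
    have "ennreal ((norm (f x))\<^sup>2) = (\<integral>\<^sup>+k. ennreal ((norm (f x))\<^sup>2) * indicator {I.base_pt x} k \<partial>count_space I.lat)"
      using I.base_pt_lat[of x] by (subst nn_integral_cmult_indicator) auto
    also have "\<dots> \<le> (\<integral>\<^sup>+k. ennreal ((norm (cell_restrict k f x))\<^sup>2) \<partial>count_space I.lat)"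
      using x by (intro nn_integral_mono) (auto simp: cell_restrict_def indicator_def)
    finally show "ennreal ((norm (f x))\<^sup>2) \<le> (\<integral>\<^sup>+k. ennreal ((norm (cell_restrict k f x))\<^sup>2) \<partial>count_space I.lat)" .
  qed
  also have "\<dots> = (\<integral>\<^sup>+k. \<integral>\<^sup>+x. ennreal ((norm (cell_restrict k f x))\<^sup>2) \<partial>lborel \<partial>count_space I.lat)"
  proof (rule Fubini')
    show "(\<lambda>(k, x). ennreal ((norm (cell_restrict k f x))\<^sup>2)) \<in> borel_measurable (count_space I.lat \<Otimes>\<^sub>M lborel)"
      unfolding cell_restrict_def
      by (intro measurable_pair_measure_countable1 I.countable_lat) (simp, measurable)
  qed
  also have "\<dots> = (\<integral>\<^sup>+k. ennreal ((b k)\<^sup>2) \<partial>count_space I.lat)"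
  proof (rule nn_integral_cong)
    fix k assume "k \<in> space (count_space I.lat)"
    then have "cell_restrict k f \<in> Lp 2" using L2 lat by simp
    then show "(\<integral>\<^sup>+x. ennreal ((norm (cell_restrict k f x))\<^sup>2) \<partial>lborel) = ennreal ((b k)\<^sup>2)"
      unfolding b_def Lp_norm_2_sq by (intro nn_integral_eq_integral) (auto simp: Lp_2_iff)
  qed
  also have "\<dots> \<le> (\<integral>\<^sup>+k. ennreal (infsum b int_vecs) * ennreal (b k) \<partial>count_space I.lat)"
  proof (rule nn_integral_mono)
    fix k assume "k \<in> space (count_space I.lat)"
    then have "b k \<le> infsum b int_vecs" using b_le lat by simp
    then have "(b k)\<^sup>2 \<le> infsum b int_vecs * b k" using b0 by (simp add: power2_eq_square mult_right_mono)
    moreover have "0 \<le> infsum b int_vecs" using b0 by (simp add: infsum_nonneg)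
    ultimately show "ennreal ((b k)\<^sup>2) \<le> ennreal (infsum b int_vecs) * ennreal (b k)"
      using b0 by (simp add: ennreal_mult[symmetric] ennreal_leI)
  qed
  also have "\<dots> = ennreal (infsum b int_vecs) * (\<integral>\<^sup>+k. ennreal (b k) \<partial>count_space I.lat)"
    by (rule nn_integral_cmult) simp
  also have "\<dots> < \<infinity>"
    using integrable_count_space_summable[OF sb b0] b0 lat
    by (simp add: integrable_iff_bounded ennreal_mult_less_top)
  finally have "integrable lborel (\<lambda>x. (norm (f x))\<^sup>2)" by (intro integrableI_bounded) auto
  then show ?thesis by (simp add: Lp_2_iff)
qed

section \<open>Reduction to functions supported in a tile\<close>

context lattice_coords
begin

text \<open>Boundedness makes the product with a translate of a square-integrable window
  square-integrable again; the support condition places it in one fundamental domain, where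
  Parseval's identity applies.\<close>

definition tile_fun :: "'a \<Rightarrow> ('a \<Rightarrow> complex) \<Rightarrow> bool" where
  "tile_fun w f \<longleftrightarrow> f \<in> borel_measurable borel \<and> (\<forall>x. x - w \<notin> cell \<longrightarrow> f x = 0) \<and> (\<exists>B. \<forall>x. norm (f x) \<le> B)"

lemma integrable_tile: "integrable lborel (\<lambda>x. indicat_real cell (x - w))"
  using integrable_translate[of "indicat_real cell" "- w"] emeasure_cell_finite
  by (simp add: integrable_real_indicator)

lemma tile_fun_Lp_2:
  assumes "tile_fun w f"
  shows "f \<in> Lp 2"
proof -
  obtain B where B: "\<And>x. norm (f x) \<le> B" using assms by (auto simp: tile_fun_def)
  have [measurable]: "f \<in> borel_measurable borel" using assms by (simp add: tile_fun_def)
  have "integrable lborel (\<lambda>x. (norm (f x))\<^sup>2)"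
  proof (rule Bochner_Integration.integrable_bound)
    show "integrable lborel (\<lambda>x. B\<^sup>2 * indicat_real cell (x - w))" using integrable_tile by simp
    show "AE x in lborel. norm ((norm (f x))\<^sup>2) \<le> norm (B\<^sup>2 * indicat_real cell (x - w))"
      using assms power_mono[OF B norm_ge_zero, of _ 2] by (auto simp: tile_fun_def indicator_def)
  qed measurable
  then show ?thesis by (simp add: Lp_2_iff)
qed

lemma weak_dual_tile_sum:
  assumes "finite F" "\<And>\<gamma>. \<gamma> \<in> F \<Longrightarrow> tile_fun \<gamma> (f \<gamma>)" "\<And>\<gamma>. \<gamma> \<in> F \<Longrightarrow> weak_dual J d e (f \<gamma>) f'"
    and f': "f' \<in> Lp 2" and eL: "\<And>j. j \<in> J \<Longrightarrow> e j \<in> Lp 2"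
  shows "weak_dual J d e (\<lambda>x. \<Sum>\<gamma>\<in>F. f \<gamma> x) f'"
  using assms(1-3)
proof (induction F)
  case empty
  then show ?case by (simp add: weak_dual_def L2_inner_def)
next
  case (insert \<gamma> F)
  have "weak_dual J d e (\<lambda>x. f \<gamma> x + (\<Sum>\<gamma>\<in>F. f \<gamma> x)) f'"
    using insert by (intro weak_dual_add_left f' eL Lp_2_sum) (auto intro: tile_fun_Lp_2)
  then show ?case using insert by simp
qed

text \<open>Cutting \<open>f\<close> to the finitely many tiles with base point of norm at most
  \<open>k\<close>, and to points where its modulus is at most \<open>k\<close>, gives finite sums
  of tile functions. They converge to \<open>f\<close> in L2 by dominated convergence.\<close>

lemma weak_dual_of_tiles_left:
  assumes bessel: "bessel_sequence J e" "bessel_sequence J d"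
    and eL: "\<And>j. j \<in> J \<Longrightarrow> e j \<in> Lp 2" and f': "f' \<in> Lp 2" and f: "f \<in> Lp 2"
    and tile: "\<And>w f. w \<in> lat \<Longrightarrow> tile_fun w f \<Longrightarrow> weak_dual J d e f f'"
  shows "weak_dual J d e f f'"
proof -
  have [measurable]: "f \<in> borel_measurable borel" using f by (simp add: Lp_2_iff)
  define F where "F k = {\<gamma>\<in>lat. norm \<gamma> \<le> real k}" for k :: nat
  have fin: "finite (F k)" for k
    using finite_lat_Int[of "cball 0 (real k)" 0] by (simp add: F_def)
  define p where "p k \<gamma> x = (if norm (f x) \<le> real k then f x * indicator cell (x - \<gamma>) else 0)" for k \<gamma> x
  have p: "tile_fun \<gamma> (p k \<gamma>)" for k \<gamma>
    unfolding tile_fun_def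
  proof (intro conjI)
    show "p k \<gamma> \<in> borel_measurable borel" unfolding p_def[abs_def] by measurable
    show "\<exists>B. \<forall>x. norm (p k \<gamma> x) \<le> B" by (rule exI[of _ "real k"]) (auto simp: p_def norm_mult indicator_def)
  qed (simp add: p_def)
  define fk where "fk k x = (\<Sum>\<gamma>\<in>F k. p k \<gamma> x)" for k x
  have fk_eq: "fk k x = (if norm (f x) \<le> real k \<and> base_pt x \<in> F k then f x else 0)" for k x
  proof -
    have "fk k x = (\<Sum>\<gamma>\<in>F k. if \<gamma> = base_pt x then (if norm (f x) \<le> real k then f x else 0) else 0)"
      unfolding fk_def p_def by (intro sum.cong refl) (auto simp: indicator_def in_cell_iff F_def)
    then show ?thesis using fin by simp
  qed
  have fkL: "fk k \<in> Lp 2" for k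
    unfolding fk_def[abs_def] by (intro Lp_2_sum tile_fun_Lp_2[OF p])
  then have [measurable]: "fk k \<in> borel_measurable borel" for k by (simp add: Lp_2_iff)
  have wk: "weak_dual J d e (fk k) f'" for k
    unfolding fk_def[abs_def] by (rule weak_dual_tile_sum[OF fin p _ f' eL]) (auto intro: tile p simp: F_def)
  have "(\<lambda>k. \<integral>x. (norm (f x - fk k x))\<^sup>2 \<partial>lborel) \<longlonglongrightarrow> (\<integral>x. 0 \<partial>(lborel :: 'a measure))"
  proof (rule integral_dominated_convergence)
    show "integrable lborel (\<lambda>x. (norm (f x))\<^sup>2)" using f by (simp add: Lp_2_iff)
    show "AE x in lborel. norm ((norm (f x - fk k x))\<^sup>2) \<le> (norm (f x))\<^sup>2" for k
      by (auto simp: fk_eq)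
    show "AE x in lborel. (\<lambda>k. (norm (f x - fk k x))\<^sup>2) \<longlonglongrightarrow> 0"
    proof (intro always_eventually allI)
      fix x
      obtain N :: nat where N: "norm (f x) + norm (base_pt x) \<le> real N" using real_arch_simple by blast
      have "fk k x = f x" if "N \<le> k" for k
      proof -
        have "norm (f x) \<le> real k" "norm (base_pt x) \<le> real k"
          using N that norm_ge_zero[of "f x"] norm_ge_zero[of "base_pt x"] by linarith+
        then show ?thesis by (simp add: fk_eq F_def base_pt_lat)
      qed
      then have "\<forall>\<^sub>F k in sequentially. (norm (f x - fk k x))\<^sup>2 = 0"
        by (auto simp: eventually_sequentially intro!: exI[of _ N])
      then show "(\<lambda>k. (norm (f x - fk k x))\<^sup>2) \<longlonglongrightarrow> 0" by (rule tendsto_eventually)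
    qed
  qed measurable
  then have "(\<lambda>k. sqrt (\<integral>x. (norm (f x - fk k x))\<^sup>2 \<partial>lborel)) \<longlonglongrightarrow> sqrt 0"
    by (intro tendsto_real_sqrt) simp
  then have "(\<lambda>k. Lp_norm 2 (\<lambda>x. f x - fk k x)) \<longlonglongrightarrow> 0" by (simp add: Lp_norm_2)
  from weak_dual_limit_left[OF bessel eL f f' fkL wk this] show ?thesis .
qed

text \<open>The extension from tiles to L2 is carried out for one argument at a time;
  \<open>weak_dual_swap\<close> reduces the second argument to the first.\<close>

lemma dual_system_iff_tiles:
  assumes bessel: "bessel_sequence J e" "bessel_sequence J d"
    and eL: "\<And>j. j \<in> J \<Longrightarrow> e j \<in> Lp 2" and dL: "\<And>j. j \<in> J \<Longrightarrow> d j \<in> Lp 2"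
  shows "dual_system J d e \<longleftrightarrow>
    (\<forall>w\<in>lat. \<forall>w'\<in>lat. \<forall>f f'. tile_fun w f \<longrightarrow> tile_fun w' f' \<longrightarrow> weak_dual J d e f f')"
  (is "_ \<longleftrightarrow> ?tiles")
proof -
  have "(\<forall>f\<in>Lp 2. \<forall>f'\<in>Lp 2. weak_dual J d e f f') \<longleftrightarrow> ?tiles"
  proof (rule iffI)
    assume weak: "\<forall>f\<in>Lp 2. \<forall>f'\<in>Lp 2. weak_dual J d e f f'"
    show ?tiles
      using weak tile_fun_Lp_2 by blast
  next
    assume tiles: ?tiles
    show "\<forall>f\<in>Lp 2. \<forall>f'\<in>Lp 2. weak_dual J d e f f'"
    proof (rule ballI, rule ballI)
      fix f f' :: "'a \<Rightarrow> complex" assume f: "f \<in> Lp 2" and f': "f' \<in> Lp 2"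
      have t: "weak_dual J d e f f'" if w: "w \<in> lat" "tile_fun w f" for w f
      proof -
        have "weak_dual J e d f' f"
        proof (rule weak_dual_of_tiles_left[OF bessel(2,1) dL tile_fun_Lp_2[OF w(2)] f'])
          fix w' f' assume "w' \<in> lat" "tile_fun w' f'"
          then have "weak_dual J d e f f'" using tiles w by blast
          then show "weak_dual J e d f' f" by (rule weak_dual_swap[THEN iffD1])
        qed
        then show ?thesis by (rule weak_dual_swap[THEN iffD1])
      qed
      show "weak_dual J d e f f'"
        by (rule weak_dual_of_tiles_left[OF bessel eL f' f t])
    qed
  qed
  then show ?thesis using dual_system_iff_weak[OF bessel eL dL] by simp
qed

end

text \<open>Fubini's theorem with the majorant of \<open>slab_sum_finite\<close>. Injectivity of
  \<open>fst\<close> on the lattice turns the sum over lattice points into one over the model set,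
  and symmetry of the window disposes of the sign of the height.\<close>

lemma (in cart_cut_project) model_set_sum_integral:
  fixes G \<phi> :: "real ^ 'm \<Rightarrow> complex"
  assumes G: "integrable lborel G" and [measurable]: "\<phi> \<in> borel_measurable borel"
    and \<phi>B: "\<And>x. norm (\<phi> x) \<le> B" and E: "bounded E" "E \<in> sets borel" "\<And>x. x \<notin> E \<Longrightarrow> \<phi> x = 0"
  shows "integrable lborel (\<lambda>x. \<phi> x * layer G 0 x)"
    and "((\<lambda>\<tau>. \<integral>x. \<phi> x * G (x - \<tau>) \<partial>lborel) has_sum (\<integral>x. \<phi> x * layer G 0 x \<partial>lborel)) (model_set lat \<Omega>)"
proof -
  have [measurable]: "G \<in> borel_measurable borel" "E \<in> sets borel" using G E by auto
  interpret pair_sigma_finite "count_space lat" "lborel :: (real^'m) measure"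
    unfolding pair_sigma_finite_def using sigma_finite_lat lborel.sigma_finite_measure_axioms by blast
  define H where "H \<gamma> x = \<phi> x * (G (x + - fst \<gamma>) * indicator \<Omega> (0 + - snd \<gamma>))" for \<gamma> :: "(real^'m) \<times> real" and x
  have B0: "0 \<le> B" using order_trans[OF norm_ge_zero \<phi>B] .
  have M: "(\<lambda>(\<gamma>, x). H \<gamma> x) \<in> borel_measurable (count_space lat \<Otimes>\<^sub>M lborel)"
    unfolding H_def by (intro measurable_pair_measure_countable1 countable_lat) (simp, measurable)
  have "integrable (count_space lat \<Otimes>\<^sub>M lborel) (\<lambda>(\<gamma>, x). H \<gamma> x)"
  proof (rule integrableI_bounded[OF M])
    have "(\<integral>\<^sup>+z. ennreal (norm (case z of (\<gamma>, x) \<Rightarrow> H \<gamma> x)) \<partial>(count_space lat \<Otimes>\<^sub>M lborel))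
      = (\<integral>\<^sup>+\<gamma>. \<integral>\<^sup>+x. ennreal (norm (H \<gamma> x)) \<partial>lborel \<partial>count_space lat)"
      using M by (subst lborel.nn_integral_fst[symmetric]) auto
    also have "\<dots> \<le> (\<integral>\<^sup>+\<gamma>. ennreal B * (indicator {s. 0 + - s \<in> \<Omega>} (snd \<gamma>) * (\<integral>\<^sup>+x. norm (G (x + - fst \<gamma>)) * indicator E x \<partial>lborel)) \<partial>count_space lat)"
    proof (rule nn_integral_mono)
      fix \<gamma> :: "(real^'m) \<times> real"
      have "(\<integral>\<^sup>+x. ennreal (norm (H \<gamma> x)) \<partial>lborel) \<le> (\<integral>\<^sup>+x. (ennreal B * indicator {s. 0 + - s \<in> \<Omega>} (snd \<gamma>)) * ennreal (norm (G (x + - fst \<gamma>)) * indicator E x) \<partial>lborel)"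
      proof (rule nn_integral_mono)
        fix x
        show "ennreal (norm (H \<gamma> x)) \<le> (ennreal B * indicator {s. 0 + - s \<in> \<Omega>} (snd \<gamma>)) * ennreal (norm (G (x + - fst \<gamma>)) * indicator E x)"
        proof (cases "x \<in> E \<and> - snd \<gamma> \<in> \<Omega>")
          case True
          then show ?thesis using \<phi>B[of x] B0
            by (simp add: H_def norm_mult ennreal_mult[symmetric] mult_right_mono)
        next
          case False
          then have "H \<gamma> x = 0" using E(3)[of x] by (auto simp: H_def)
          then show ?thesis by simp
        qed
      qed
      also have "\<dots> = (ennreal B * indicator {s. 0 + - s \<in> \<Omega>} (snd \<gamma>)) * (\<integral>\<^sup>+x. norm (G (x + - fst \<gamma>)) * indicator E x \<partial>lborel)"
        by (rule nn_integral_cmult) measurable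
      finally show "(\<integral>\<^sup>+x. ennreal (norm (H \<gamma> x)) \<partial>lborel) \<le> ennreal B * (indicator {s. 0 + - s \<in> \<Omega>} (snd \<gamma>) * (\<integral>\<^sup>+x. norm (G (x + - fst \<gamma>)) * indicator E x \<partial>lborel))"
        by (simp only: mult.assoc)
    qed
    also have "\<dots> = ennreal B * (\<integral>\<^sup>+\<gamma>. indicator {s. 0 + - s \<in> \<Omega>} (snd \<gamma>) * (\<integral>\<^sup>+x. norm (G (x + - fst \<gamma>)) * indicator E x \<partial>lborel) \<partial>count_space lat)"
      by (rule nn_integral_cmult) simp
    also have "\<dots> < \<infinity>"
      using slab_sum_finite[OF G E(1,2) bounded_window[of 0]] by (simp add: ennreal_mult_less_top)
    finally show "(\<integral>\<^sup>+z. ennreal (norm (case z of (\<gamma>, x) \<Rightarrow> H \<gamma> x)) \<partial>(count_space lat \<Otimes>\<^sub>M lborel)) < \<infinity>" .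
  qed
  note I = this
  have layer_eq: "(\<integral>\<gamma>. H \<gamma> x \<partial>count_space lat) = \<phi> x * layer G 0 x" for x
    unfolding H_def layer_def by (rule integral_mult_right_zero)
  show "integrable lborel (\<lambda>x. \<phi> x * layer G 0 x)"
    using integrable_snd[OF I] by (simp add: layer_eq)
  have "((\<lambda>\<gamma>. \<integral>x. H \<gamma> x \<partial>lborel) has_sum (\<integral>\<gamma>. \<integral>x. H \<gamma> x \<partial>lborel \<partial>count_space lat)) lat"
    using integrable_fst[OF I] by (rule has_sum_count_space)
  also have "(\<integral>\<gamma>. \<integral>x. H \<gamma> x \<partial>lborel \<partial>count_space lat) = (\<integral>x. \<phi> x * layer G 0 x \<partial>lborel)"
    using Fubini_integral[OF I] by (simp add: layer_eq)
  finally have "((\<lambda>\<gamma>. \<integral>x. \<phi> x * G (x - fst \<gamma>) \<partial>lborel) has_sum (\<integral>x. \<phi> x * layer G 0 x \<partial>lborel)) {\<gamma>\<in>lat. snd \<gamma> \<in> \<Omega>}"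
    by (rule has_sum_cong_neutral[THEN iffD1, rotated 3]) (auto simp: H_def \<Omega>_def indicator_def)
  moreover have "bij_betw fst {\<gamma>\<in>lat. snd \<gamma> \<in> \<Omega>} (model_set lat \<Omega>)"
  proof -
    have "model_set lat \<Omega> = fst ` {\<gamma>\<in>lat. snd \<gamma> \<in> \<Omega>}" unfolding model_set_def by blast
    moreover have "inj_on fst {\<gamma>\<in>lat. snd \<gamma> \<in> \<Omega>}" by (rule inj_on_subset[OF inj_fst]) blast
    ultimately show ?thesis by (simp add: bij_betw_def)
  qed
  ultimately show "((\<lambda>\<tau>. \<integral>x. \<phi> x * G (x - \<tau>) \<partial>lborel) has_sum (\<integral>x. \<phi> x * layer G 0 x \<partial>lborel)) (model_set lat \<Omega>)"
    by (simp add: has_sum_reindex_bij_betw[of fst _ _ "\<lambda>\<tau>. \<integral>x. \<phi> x * G (x - \<tau>) \<partial>lborel"])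
qed

section \<open>Determinants and covolumes\<close>

text \<open>Translation-invariant measures agree up to a factor; the factors of linear maps are
  multiplicative, so that only diagonal matrices and involutions have to be considered. The formula
  for linear images in \<^theory>\<open>HOL-Analysis.Change_Of_Vars\<close> is restricted to well-ordered index types.\<close>

lemma (in lattice_coords) emeasure_vimage_scaling:
  assumes [measurable]: "S \<in> sets borel" "U \<in> sets borel" and U: "emeasure lborel U = 1"
  shows "emeasure lborel (C -` S) = emeasure lborel S * emeasure lborel (C -` U)"
proof -
  have meas [measurable]: "C -` S \<in> sets borel" if "S \<in> sets borel" for S
    using measurable_sets_borel[OF borel_C that] .
  \<comment> \<open>The double integral of \<open>indicator U y * indicator S (C x + y)\<close> is
    evaluated twice: translating in \<open>x\<close> removes \<open>y\<close> from the second
    factor, translating in \<open>y\<close> moves \<open>C x\<close> into the first. The remaining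
    constant is identified at the end by taking \<open>S = U\<close>.\<close>
  have *: "emeasure lborel (C -` S) = emeasure lborel S * (\<integral>\<^sup>+x. indicator U (- C x) \<partial>lborel)"
    if [measurable]: "S \<in> sets borel" for S
  proof -
    have "emeasure lborel (C -` S) = (\<integral>\<^sup>+y. indicator U y * (\<integral>\<^sup>+x. indicator S (C x) \<partial>lborel) \<partial>lborel)"
    proof -
      have "emeasure lborel (C -` S) = (\<integral>\<^sup>+x. indicator (C -` S) x \<partial>lborel)" by simp
      also have "\<dots> = (\<integral>\<^sup>+x. indicator S (C x) \<partial>lborel)" by (simp add: indicator_vimage)
      finally show ?thesis by (simp add: nn_integral_multc U)
    qed
    also have "\<dots> = (\<integral>\<^sup>+y. \<integral>\<^sup>+x. indicator U y * indicator S (C x + y) \<partial>lborel \<partial>lborel)"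
    proof (rule nn_integral_cong)
      fix y
      have "(\<integral>\<^sup>+x. indicator S (C x) \<partial>lborel) = (\<integral>\<^sup>+x. indicator S (C (x + inv C y)) \<partial>(lborel :: 'a measure) :: ennreal)"
        by (rule nn_integral_translate[symmetric]) measurable
      then show "indicator U y * (\<integral>\<^sup>+x. indicator S (C x) \<partial>lborel) = (\<integral>\<^sup>+x. indicator U y * indicator S (C x + y) \<partial>lborel)"
        by (simp add: nn_integral_cmult)
    qed
    also have "\<dots> = (\<integral>\<^sup>+x. \<integral>\<^sup>+y. indicator U y * indicator S (C x + y) \<partial>lborel \<partial>lborel)"
      by (rule lborel_pair.Fubini') measurable
    also have "\<dots> = (\<integral>\<^sup>+x. \<integral>\<^sup>+y. indicator U (y - C x) * indicator S y \<partial>lborel \<partial>lborel)"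
    proof (rule nn_integral_cong)
      fix x
      show "(\<integral>\<^sup>+y. indicator U y * indicator S (C x + y) \<partial>lborel) = (\<integral>\<^sup>+y. indicator U (y - C x) * indicator S y \<partial>lborel)"
        using nn_integral_translate[of "\<lambda>y. indicator U y * indicator S (C x + y)" "- C x"] by simp
    qed
    also have "\<dots> = (\<integral>\<^sup>+y. \<integral>\<^sup>+x. indicator U (y - C x) * indicator S y \<partial>lborel \<partial>lborel)"
      by (rule lborel_pair.Fubini') measurable
    also have "\<dots> = (\<integral>\<^sup>+y. indicator S y * (\<integral>\<^sup>+x. indicator U (- C x) \<partial>lborel) \<partial>lborel)"
    proof (rule nn_integral_cong)
      fix y
      have "(\<integral>\<^sup>+x. indicator U (- C x) \<partial>lborel) = (\<integral>\<^sup>+x. indicator U (- C (x + inv C (- y))) \<partial>(lborel :: 'a measure) :: ennreal)"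
        by (rule nn_integral_translate[symmetric]) measurable
      then show "(\<integral>\<^sup>+x. indicator U (y - C x) * indicator S y \<partial>lborel) = indicator S y * (\<integral>\<^sup>+x. indicator U (- C x) \<partial>lborel)"
      proof -
        assume eq: "(\<integral>\<^sup>+x. indicator U (- C x) \<partial>lborel) = (\<integral>\<^sup>+x. indicator U (- C (x + inv C (- y))) \<partial>(lborel :: 'a measure) :: ennreal)"
        have "(\<integral>\<^sup>+x. indicator U (y - C x) * indicator S y \<partial>lborel) = (\<integral>\<^sup>+x. indicator U (y - C x) \<partial>lborel) * (indicator S y :: ennreal)"
          by (rule nn_integral_multc) measurable
        then show ?thesis using eq by (simp add: mult.commute)
      qed
    qed
    also have "\<dots> = emeasure lborel S * (\<integral>\<^sup>+x. indicator U (- C x) \<partial>lborel)"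
      by (simp add: nn_integral_multc)
    finally show ?thesis .
  qed
  show ?thesis using *[of S] *[of U] U by simp
qed

section \<open>Volume ratios of matrices\<close>

definition unit_cube :: "(real ^ 'm) set" where "unit_cube = cbox 0 (\<chi> i. 1)"

lemma emeasure_unit_cube: "emeasure lborel (unit_cube :: (real ^ 'm) set) = 1"
proof -
  have "cbox 0 (\<chi> i. 1) \<noteq> ({} :: (real ^ 'm) set)" by (simp add: interval_ne_empty_cart)
  then have "measure lborel (unit_cube :: (real ^ 'm) set) = 1" by (simp add: unit_cube_def content_cbox_cart)
  moreover have "emeasure lborel (unit_cube :: (real ^ 'm) set) = ennreal (measure lborel (unit_cube :: (real ^ 'm) set))"
    using emeasure_bounded_finite[OF bounded_cbox, of "0 :: real ^ 'm" "\<chi> i. 1"]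
    unfolding unit_cube_def by (intro emeasure_eq_ennreal_measure) auto
  ultimately show ?thesis by simp
qed

lemma unit_cube_borel [measurable]: "unit_cube \<in> sets borel"
  by (simp add: unit_cube_def)

text \<open>A volume of a preimage, therefore the reciprocal of \<open>\<bar>det A\<bar>\<close>
  when \<open>A\<close> is invertible.\<close>

definition vol_ratio :: "real ^ 'm ^ 'm \<Rightarrow> ennreal" where
  "vol_ratio A = emeasure lborel ((*v) A -` unit_cube)"

lemma invertible_lattice_coords: "invertible (A :: real ^ 'm ^ 'm) \<Longrightarrow> lattice_coords ((*v) A)"
  by (auto simp: lattice_coords_def invertible_eq_bij bij_is_inj)

lemma emeasure_vimage_matrix:
  fixes A :: "real ^ 'm ^ 'm"
  assumes "invertible A" "S \<in> sets borel"
  shows "emeasure lborel ((*v) A -` S) = emeasure lborel S * vol_ratio A"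
  unfolding vol_ratio_def
  by (rule lattice_coords.emeasure_vimage_scaling[OF invertible_lattice_coords[OF assms(1)] assms(2) unit_cube_borel emeasure_unit_cube])

lemma vol_ratio_mult:
  assumes "invertible A" "invertible B"
  shows "vol_ratio (A ** B) = vol_ratio A * vol_ratio B"
proof -
  have b: "(*v) A -` unit_cube \<in> sets borel"
    using measurable_sets_borel[OF lattice_coords.borel_C[OF invertible_lattice_coords[OF assms(1)]] unit_cube_borel] .
  have eq: "(*v) (A ** B) -` unit_cube = (*v) B -` ((*v) A -` unit_cube)"
    by (auto simp: matrix_vector_mul_assoc)
  show ?thesis
    unfolding vol_ratio_def[of "A ** B"] eq emeasure_vimage_matrix[OF assms(2) b] vol_ratio_def[of A] ..
qed

lemma vol_ratio_mat_1: "vol_ratio (mat 1 :: real ^ 'm ^ 'm) = 1"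
proof -
  have "(*v) (mat 1) -` unit_cube = (unit_cube :: (real ^ 'm) set)" by auto
  then show ?thesis unfolding vol_ratio_def by (simp only: emeasure_unit_cube)
qed

text \<open>Both the volume ratio and the determinant are multiplicative, so both square to 1;
  nonnegativity leaves only the value 1 for the ratio and for
  \<open>\<bar>det B\<bar>\<close>.\<close>

lemma vol_ratio_involution:
  assumes "B ** B = mat 1"
  shows "invertible B" "vol_ratio B * ennreal \<bar>det B\<bar> = 1"
proof -
  show inv: "invertible B" unfolding invertible_def using assms by blast
  have "vol_ratio B * vol_ratio B = 1"
    by (metis assms vol_ratio_mult[OF inv inv] vol_ratio_mat_1)
  then have "vol_ratio B = 1"
  proof (cases "vol_ratio B")
    case (real r)
    then have "ennreal (r * r) = 1" using \<open>vol_ratio B * vol_ratio B = 1\<close> by (simp add: ennreal_mult)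
    then have "r * r = 1" by simp
    then have "r = 1" using real(1) by (auto simp: square_eq_1_iff)
    then show ?thesis using real(2) by simp
  qed (simp add: ennreal_top_mult)
  moreover have "\<bar>det B\<bar> = 1"
  proof -
    have "det B * det B = 1" using assms by (metis det_I det_mul)
    then show ?thesis by (auto simp: square_eq_1_iff)
  qed
  ultimately show "vol_ratio B * ennreal \<bar>det B\<bar> = 1" by simp
qed

lemma vol_ratio_det:
  fixes A :: "real ^ 'm ^ 'm"
  shows "invertible A \<longrightarrow> vol_ratio A * ennreal \<bar>det A\<bar> = 1"
proof (induct A rule: induct_matrix_elementary_alt)
  case (1 A B)
  show ?case
  proof
    assume "invertible (A ** B)"
    then have inv: "invertible A" "invertible B" by (auto simp: invertible_det_nz det_mul)
    have "vol_ratio (A ** B) * ennreal \<bar>det (A ** B)\<bar> = (vol_ratio A * ennreal \<bar>det A\<bar>) * (vol_ratio B * ennreal \<bar>det B\<bar>)"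
      by (simp add: vol_ratio_mult[OF inv] det_mul abs_mult ennreal_mult mult_ac)
    then show "vol_ratio (A ** B) * ennreal \<bar>det (A ** B)\<bar> = 1" using 1 inv by simp
  qed
next
  case (2 A i)
  then show ?case by (simp add: invertible_det_nz det_zero_row)
next
  case (3 A)
  show ?case
  proof
    assume "invertible A"
    have det: "det A = (\<Prod>i\<in>UNIV. A $ i $ i)" by (rule det_diagonal) (use 3 in auto)
    then have nz: "A $ i $ i \<noteq> 0" for i using \<open>invertible A\<close> by (auto simp: invertible_det_nz)
    have Ax: "(A *v x) $ i = A $ i $ i * x $ i" for x i
    proof -
      have "(A *v x) $ i = (\<Sum>j\<in>UNIV. A $ i $ j * x $ j)" by (simp add: matrix_vector_mult_def)
      also have "\<dots> = (\<Sum>j\<in>UNIV. if j = i then A $ i $ i * x $ i else 0)"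
        by (intro sum.cong refl) (use 3[of i] in auto)
      finally show ?thesis by simp
    qed
    \<comment> \<open>Each coordinate ranges between 0 and \<open>1 / A $ i $ i\<close>, in an order
      that depends on the sign of the diagonal entry.\<close>
    let ?l = "\<chi> i. min 0 (1 / A $ i $ i)" and ?u = "\<chi> i. max 0 (1 / A $ i $ i)"
    have "(*v) A -` unit_cube = cbox ?l ?u"
    proof -
      have "0 \<le> c * t \<and> c * t \<le> 1 \<longleftrightarrow> min 0 (1 / c) \<le> t \<and> t \<le> max 0 (1 / c)" if "c \<noteq> 0" for c t :: real
        using that by (cases "0 < c") (auto simp: min_def max_def field_simps zero_le_mult_iff)
      then show ?thesis using nz by (auto simp: unit_cube_def mem_box_cart Ax)
    qed
    moreover have "measure lborel (cbox ?l ?u) = (\<Prod>i\<in>UNIV. 1 / \<bar>A $ i $ i\<bar>)"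
    proof -
      have "cbox ?l ?u \<noteq> {}" by (auto simp: interval_ne_empty_cart)
      moreover have "max 0 (1 / c) - min 0 (1 / c) = 1 / \<bar>c\<bar>" for c :: real by (auto simp: min_def max_def abs_if)
      ultimately show ?thesis by (simp add: content_cbox_cart)
    qed
    moreover have "emeasure lborel (cbox ?l ?u) = ennreal (measure lborel (cbox ?l ?u))"
      using emeasure_bounded_finite[OF bounded_cbox, of ?l ?u] by (intro emeasure_eq_ennreal_measure) auto
    ultimately have "vol_ratio A = ennreal (\<Prod>i\<in>UNIV. 1 / \<bar>A $ i $ i\<bar>)" by (simp add: vol_ratio_def)
    then have "vol_ratio A * ennreal \<bar>det A\<bar> = ennreal ((\<Prod>i\<in>UNIV. 1 / \<bar>A $ i $ i\<bar>) * \<bar>det A\<bar>)"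
      by (simp add: ennreal_mult prod_nonneg)
    also have "(\<Prod>i\<in>UNIV. 1 / \<bar>A $ i $ i\<bar>) * \<bar>det A\<bar> = (\<Prod>i\<in>UNIV. 1 / \<bar>A $ i $ i\<bar> * \<bar>A $ i $ i\<bar>)"
      by (simp only: det abs_prod prod.distrib)
    also have "\<dots> = 1" using nz by simp
    finally show "vol_ratio A * ennreal \<bar>det A\<bar> = 1" by simp
  qed
next
  case (4 m n)
  let ?S = "(\<chi> i j. mat 1 $ i $ Transposition.transpose m n j) :: real ^ 'm ^ 'm"
  have Sx: "(?S *v x) $ i = x $ Transposition.transpose m n i" for x i
  proof -
    have "(?S *v x) $ i = (\<Sum>j\<in>UNIV. if j = Transposition.transpose m n i then x $ j else 0)"
      by (simp only: matrix_vector_mult_def vec_lambda_beta, rule sum.cong[OF refl])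
         (auto simp: mat_def Transposition.transpose_def)
    then show ?thesis by simp
  qed
  have "?S ** ?S = mat 1"
    by (simp add: matrix_eq vec_eq_iff matrix_vector_mul_assoc[symmetric] Sx)
  then show ?case using vol_ratio_involution(2) by blast
next
  case (5 m n)
  define E :: "real ^ 'm ^ 'm" where "E = (\<chi> i j. of_bool (i = m \<and> j = n \<or> i = j))"
  \<comment> \<open>The reflection in the coordinate \<open>m\<close> turns the shear
    \<open>E\<close> into an involution: \<open>D ** E\<close> sends \<open>x $ m\<close> to
    \<open>- (x $ m + x $ n)\<close>, and doing this twice restores \<open>x $ m\<close> because
    \<open>m\<close> and \<open>n\<close> differ. So \<open>E\<close> is a product of two
    involutions.\<close>
  define D :: "real ^ 'm ^ 'm" where "D = (\<chi> i j. if i = j then (if i = m then - 1 else 1) else 0)"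
  have Ex: "(E *v x) $ i = (if i = m then x $ m + x $ n else x $ i)" for x i
  proof -
    have "(E *v x) $ i = (\<Sum>j\<in>UNIV. (if j = i then x $ i else 0) + (if j = n then (if i = m then x $ n else 0) else 0))"
      by (simp only: E_def matrix_vector_mult_def vec_lambda_beta, rule sum.cong[OF refl]) (use 5 in auto)
    then show ?thesis by (simp add: sum.distrib)
  qed
  have Dx: "(D *v x) $ i = (if i = m then - x $ m else x $ i)" for x i
  proof -
    have "(D *v x) $ i = (\<Sum>j\<in>UNIV. if j = i then (if i = m then - x $ m else x $ i) else 0)"
      by (simp only: D_def matrix_vector_mult_def vec_lambda_beta, rule sum.cong[OF refl]) auto
    then show ?thesis by simp
  qed
  have DD: "D ** D = mat 1"
    by (simp add: matrix_eq vec_eq_iff matrix_vector_mul_assoc[symmetric] Dx)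
  have DE: "(D ** E) ** (D ** E) = mat 1"
    using 5 by (simp add: matrix_eq vec_eq_iff matrix_vector_mul_assoc[symmetric] Dx Ex)
  have "E = D ** (D ** E)" by (simp add: matrix_mul_assoc DD)
  moreover have "vol_ratio (D ** (D ** E)) * ennreal \<bar>det (D ** (D ** E))\<bar> = 1"
  proof -
    note D' = vol_ratio_involution[OF DD] and DE' = vol_ratio_involution[OF DE]
    have "vol_ratio (D ** (D ** E)) * ennreal \<bar>det (D ** (D ** E))\<bar> =
      (vol_ratio D * ennreal \<bar>det D\<bar>) * (vol_ratio (D ** E) * ennreal \<bar>det (D ** E)\<bar>)"
      unfolding vol_ratio_mult[OF D'(1) DE'(1)] det_mul[of D "D ** E"] abs_mult
      by (simp add: ennreal_mult mult_ac)
    then show ?thesis using D'(2) DE'(2) by simp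
  qed
  ultimately have "vol_ratio E * ennreal \<bar>det E\<bar> = 1" by simp
  then show ?case unfolding E_def by blast
qed

lemma covol_matrix:
  fixes A :: "real ^ 'm ^ 'm"
  assumes "invertible A"
  shows "lattice_coords.covol ((*v) A) = inverse \<bar>det A\<bar>"
proof -
  interpret T: lattice_coords "(*v) A" by (rule invertible_lattice_coords[OF assms])
  \<comment> \<open>Half-open like the cell, and squeezed between the open and the closed unit box,
    both of volume 1.\<close>
  define H where "H = {x :: real ^ 'm. \<forall>i\<in>Basis. 0 \<le> x \<bullet> i \<and> x \<bullet> i < 1}"
  have Hb: "H \<in> sets borel"
  proof -
    have "H = {x \<in> space borel. \<forall>i\<in>Basis. 0 \<le> x \<bullet> i \<and> x \<bullet> i < 1}" by (simp add: H_def)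
    also have "\<dots> \<in> sets borel" by measurable
    finally show ?thesis .
  qed
  have "box 0 One \<subseteq> H" "H \<subseteq> cbox 0 One" by (auto simp: H_def mem_box less_imp_le)
  then have "emeasure lborel (box 0 One :: (real^'m) set) \<le> emeasure lborel H" "emeasure lborel H \<le> emeasure lborel (cbox 0 One :: (real^'m) set)"
    using Hb emeasure_mono[of "box 0 One" H lborel] emeasure_mono[of H "cbox 0 One" lborel] by (simp_all del: emeasure_lborel_box emeasure_lborel_cbox)
  then have "emeasure lborel H = 1" by (simp add: emeasure_lborel_box_eq emeasure_lborel_cbox_eq)
  have "T.cell = (*v) A -` H" by (auto simp: T.cell_def H_def)
  then have "ennreal T.covol = vol_ratio A"
    using emeasure_vimage_matrix[OF assms Hb] \<open>emeasure lborel H = 1\<close> by (simp add: T.emeasure_cell[symmetric])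
  then have "ennreal (T.covol * \<bar>det A\<bar>) = 1"
    using vol_ratio_det[of A] assms T.covol_pos by (simp add: ennreal_mult)
  then have "T.covol * \<bar>det A\<bar> = 1" by simp
  then show ?thesis by (metis inverse_unique mult.commute)
qed

section \<open>Gabor systems over model sets\<close>

lemma L2_inner_gabor_atom:
  assumes [measurable]: "f \<in> borel_measurable borel" "G \<in> borel_measurable borel"
  shows "L2_inner f (translate \<tau> (modulate \<beta> G)) = fourier (\<lambda>t. f (t + \<tau>) * cnj (G t)) \<beta>"
proof -
  have "L2_inner f (translate \<tau> (modulate \<beta> G)) = (\<integral>t. f t * cnj (cis (2 * pi * (\<beta> \<bullet> (t - \<tau>))) * G (t - \<tau>)) \<partial>lborel)"
    by (simp add: L2_inner_def translate_def modulate_def)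
  also have "\<dots> = (\<integral>t. f (t + \<tau>) * cnj (cis (2 * pi * (\<beta> \<bullet> (t + \<tau> - \<tau>))) * G (t + \<tau> - \<tau>)) \<partial>lborel)"
    by (rule integral_translate[symmetric]) measurable
  also have "\<dots> = fourier (\<lambda>t. f (t + \<tau>) * cnj (G t)) \<beta>"
    unfolding fourier_def
    by (intro Bochner_Integration.integral_cong refl) (simp add: cis_cnj inner_commute mult_ac)
  finally show ?thesis .
qed

lemma has_sum_finite_sum:
  fixes f :: "'i \<Rightarrow> 'x \<Rightarrow> complex"
  assumes "finite I" "\<And>i. i \<in> I \<Longrightarrow> (f i has_sum s i) X"
  shows "((\<lambda>x. \<Sum>i\<in>I. f i x) has_sum (\<Sum>i\<in>I. s i)) X"
  using assms
proof (induction I rule: finite_induct)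
  case (insert i I)
  have "((\<lambda>x. f i x + (\<Sum>i\<in>I. f i x)) has_sum (s i + (\<Sum>i\<in>I. s i))) X"
    by (rule has_sum_add[OF insert.prems insert.IH]) (use insert.prems in auto)
  then show ?case using insert.hyps by simp
qed simp

lemma gabor_atom_Lp_2:
  assumes "G \<in> Lp 2"
  shows "translate \<tau> (modulate \<beta> G) \<in> Lp 2"
proof (rule Lp_2_bound)
  have [measurable]: "G \<in> borel_measurable borel" using assms by (simp add: Lp_2_iff)
  show "(\<lambda>t. G (t + - \<tau>)) \<in> Lp 2" by (rule Lp_2_translate[OF assms])
  show "translate \<tau> (modulate \<beta> G) \<in> borel_measurable borel"
    unfolding translate_def modulate_def by measurable
qed (simp add: translate_def modulate_def norm_mult)

locale gabor_pair = cart_cut_project C a for C :: "(real ^ 'm) \<times> real \<Rightarrow> (real ^ 'm) \<times> real" and a +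
  fixes A :: "real ^ 'm ^ 'm" and L :: nat and g h :: "nat \<Rightarrow> real ^ 'm \<Rightarrow> complex"
  assumes invertible_A: "invertible A"
    and g_Lp: "\<And>l. l \<in> {1..L} \<Longrightarrow> g l \<in> Lp 2"
    and h_Lp: "\<And>l. l \<in> {1..L} \<Longrightarrow> h l \<in> Lp 2"
begin

text \<open>The coordinate map \<open>transpose A\<close> makes \<open>T.lat\<close> the lattice
  \<open>A^I Z^m\<close>. Its dual lattice is \<open>A Z^m\<close>, the set of modulation
  frequencies, and its index set of shifts is the one in the relations to be proved.\<close>

sublocale T: lattice_coords "(*v) (transpose A)"
  by (rule invertible_lattice_coords[OF transpose_invertible[OF invertible_A]])

lemma int_vecs_inner: "x \<in> int_vecs \<Longrightarrow> y \<in> int_vecs \<Longrightarrow> x \<bullet> y \<in> \<int>"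
  unfolding int_vecs_def inner_vec_def by (auto intro!: Ints_sum Ints_mult)

lemma T_lat_iff: "x \<in> T.lat \<longleftrightarrow> transpose A *v x \<in> int_vecs"
  unfolding T.lat_def int_vecs_eq by simp

lemma A_inverse: "A *v (matrix_inv A *v x) = x" "matrix_inv A *v (A *v x) = x"
  "transpose A *v (matrix_inv (transpose A) *v x) = x" "matrix_inv (transpose A) *v (transpose A *v x) = x"
proof -
  have 1: "A ** matrix_inv A = mat 1 \<and> matrix_inv A ** A = mat 1"
    using invertible_A unfolding invertible_def matrix_inv_def by (rule someI_ex)
  have 2: "transpose A ** matrix_inv (transpose A) = mat 1 \<and> matrix_inv (transpose A) ** transpose A = mat 1"
    using transpose_invertible[OF invertible_A] unfolding invertible_def matrix_inv_def by (rule someI_ex)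
  show "A *v (matrix_inv A *v x) = x" "matrix_inv A *v (A *v x) = x"
    "transpose A *v (matrix_inv (transpose A) *v x) = x" "matrix_inv (transpose A) *v (transpose A *v x) = x"
    by (simp_all only: matrix_vector_mul_assoc 1 2 matrix_vector_mul_lid)
qed

lemma T_lat_eq: "T.lat = (\<lambda>v. matrix_inv (transpose A) *v v) ` int_vecs"
proof (intro set_eqI iffI)
  fix x assume "x \<in> T.lat"
  then have "transpose A *v x \<in> int_vecs" by (simp only: T_lat_iff)
  then show "x \<in> (\<lambda>v. matrix_inv (transpose A) *v v) ` int_vecs" by (rule rev_image_eqI) (simp only: A_inverse)
next
  fix x assume "x \<in> (\<lambda>v. matrix_inv (transpose A) *v v) ` int_vecs"
  then obtain v where "v \<in> int_vecs" "x = matrix_inv (transpose A) *v v" by blast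
  then show "x \<in> T.lat" by (simp only: T_lat_iff A_inverse)
qed

lemma inner_transpose: "(transpose A *v x) \<bullet> y = x \<bullet> (A *v y)"
  by (simp add: dot_lmul_matrix)

lemma T_dual: "dual_lattice T.lat = (\<lambda>n. A *v n) ` int_vecs"
proof (intro set_eqI iffI)
  fix y assume y: "y \<in> dual_lattice T.lat"
  have "(matrix_inv A *v y) $ i \<in> \<int>" for i
  proof -
    have "axis i 1 \<in> int_vecs" by (simp add: int_vecs_def axis_def)
    then have "matrix_inv (transpose A) *v axis i 1 \<in> T.lat" by (simp only: T_lat_iff A_inverse)
    then have "(matrix_inv (transpose A) *v axis i 1) \<bullet> (A *v (matrix_inv A *v y)) \<in> \<int>"
      using y unfolding A_inverse(1) dual_lattice_def by blast
    then have "axis i 1 \<bullet> (matrix_inv A *v y) \<in> \<int>"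
      using inner_transpose[of "matrix_inv (transpose A) *v axis i 1" "matrix_inv A *v y"]
      by (simp only: A_inverse(3))
    then show ?thesis by (simp add: inner_axis inner_commute[of "axis i 1"])
  qed
  then have "matrix_inv A *v y \<in> int_vecs" by (simp add: int_vecs_def)
  then show "y \<in> (\<lambda>n. A *v n) ` int_vecs" by (rule rev_image_eqI) (simp only: A_inverse)
next
  fix y assume "y \<in> (\<lambda>n. A *v n) ` int_vecs"
  then obtain n where n: "n \<in> int_vecs" "y = A *v n" by blast
  show "y \<in> dual_lattice T.lat"
    unfolding dual_lattice_def
  proof safe
    fix \<gamma> assume "\<gamma> \<in> T.lat"
    then have "(transpose A *v \<gamma>) \<bullet> n \<in> \<int>" using n int_vecs_inner by (simp only: T_lat_iff)
    then show "\<gamma> \<bullet> y \<in> \<int>" by (simp only: n inner_transpose)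
  qed
qed

lemma bij_dual: "bij_betw (\<lambda>n. A *v n) int_vecs (dual_lattice T.lat)"
  unfolding T_dual by (intro inj_on_imp_bij_betw inj_onI) (metis A_inverse(2))

lemma T_covol: "T.covol = inverse \<bar>det A\<bar>"
  using covol_matrix[OF transpose_invertible[OF invertible_A]] by (simp add: det_transpose)

text \<open>Both factors are Fourier coefficients of functions supported in one tile once the second
  one is moved by the lattice vector \<open>w' - w\<close>, which does not change its coefficients on the dual lattice.\<close>

lemma modulation_sum:
  assumes w: "w \<in> T.lat" "w' \<in> T.lat" and f: "T.tile_fun w f" and f': "T.tile_fun w' f'"
    and G: "G \<in> Lp 2" and H: "H \<in> Lp 2"
  shows "((\<lambda>n. L2_inner f (translate \<tau> (modulate (A *v n) G)) * L2_inner (translate \<tau> (modulate (A *v n) H)) f')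
    has_sum of_real T.covol * (\<integral>t. (f t * cnj (f' (t + (w' - w)))) * (cnj (G (t - \<tau>)) * H (t - \<tau> + (w' - w))) \<partial>lborel)) int_vecs"
proof -
  define v where "v = w' - w"
  have v: "v \<in> T.lat" unfolding v_def by (rule T.lat_diff[OF w(2,1)])
  have [measurable]: "f \<in> borel_measurable borel" "f' \<in> borel_measurable borel" "G \<in> borel_measurable borel" "H \<in> borel_measurable borel"
    using f f' G H by (auto simp: T.tile_fun_def Lp_2_iff)
  obtain B where B: "\<And>x. norm (f x) \<le> B" using f by (auto simp: T.tile_fun_def)
  obtain B' where B': "\<And>x. norm (f' x) \<le> B'" using f' by (auto simp: T.tile_fun_def)
  define u where "u t = f (t + \<tau>) * cnj (G t)" for t
  define u' where "u' t = f' (t + \<tau>) * cnj (H t)" for t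
  have [measurable]: "u \<in> borel_measurable borel" "u' \<in> borel_measurable borel"
    unfolding u_def[abs_def] u'_def[abs_def] by measurable
  have uL: "u \<in> Lp 2"
    by (rule Lp_2_bound[OF Lp_2_scale[OF G, of "of_real B"]])
       (use order_trans[OF norm_ge_zero B] in \<open>auto simp: u_def norm_mult intro!: mult_right_mono order_trans[OF B]\<close>)
  have u'L: "u' \<in> Lp 2"
    by (rule Lp_2_bound[OF Lp_2_scale[OF H, of "of_real B'"]])
       (use order_trans[OF norm_ge_zero B'] in \<open>auto simp: u'_def norm_mult intro!: mult_right_mono order_trans[OF B']\<close>)
  \<comment> \<open>Translation by \<tau> puts \<open>u\<close> on the tile based at
    \<open>w - \<tau>\<close>, and the further shift by \<open>v\<close> puts \<open>u'\<close> on
    the same tile.\<close>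
  have "((\<lambda>\<eta>. fourier u \<eta> * cnj (fourier (\<lambda>t. u' (t + v)) \<eta>)) has_sum
    of_real T.covol * L2_inner u (\<lambda>t. u' (t + v))) (dual_lattice T.lat)"
  proof (rule T.Parseval[where z = "w - \<tau>", OF uL _ Lp_2_translate[OF u'L]])
    fix x assume x: "x - (w - \<tau>) \<notin> T.cell"
    have "x + \<tau> - w = x - (w - \<tau>)" "x + v + \<tau> - w' = x - (w - \<tau>)" by (simp_all add: v_def)
    then have x': "x + \<tau> - w \<notin> T.cell" "x + v + \<tau> - w' \<notin> T.cell" using x by metis+
    from x'(1) show "u x = 0" using f by (simp add: u_def T.tile_fun_def)
    from x'(2) show "u' (x + v) = 0" using f' by (simp add: u'_def T.tile_fun_def)
  qed
  then have 1: "((\<lambda>n. fourier u (A *v n) * cnj (fourier (\<lambda>t. u' (t + v)) (A *v n))) has_sum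
    of_real T.covol * L2_inner u (\<lambda>t. u' (t + v))) int_vecs"
    by (subst has_sum_reindex_bij_betw[OF bij_dual, of "\<lambda>\<eta>. fourier u \<eta> * cnj (fourier (\<lambda>t. u' (t + v)) \<eta>)"])
  have inner: "L2_inner u (\<lambda>t. u' (t + v)) = (\<integral>t. (f t * cnj (f' (t + v))) * (cnj (G (t - \<tau>)) * H (t - \<tau> + v)) \<partial>lborel)"
  proof -
    let ?F = "\<lambda>t. (f t * cnj (f' (t + v))) * (cnj (G (t - \<tau>)) * H (t - \<tau> + v))"
    have "L2_inner u (\<lambda>t. u' (t + v)) = (\<integral>t. ?F (t + \<tau>) \<partial>lborel)"
      unfolding L2_inner_def u_def u'_def
      by (intro Bochner_Integration.integral_cong refl) (simp add: add_ac mult_ac)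
    also have "\<dots> = (\<integral>t. ?F t \<partial>lborel)" by (rule integral_translate) measurable
    finally show ?thesis .
  qed
  have coef: "L2_inner f (translate \<tau> (modulate (A *v n) G)) * L2_inner (translate \<tau> (modulate (A *v n) H)) f' =
    fourier u (A *v n) * cnj (fourier (\<lambda>t. u' (t + v)) (A *v n))" if "n \<in> int_vecs" for n
  proof -
    have "A *v n \<in> dual_lattice T.lat" using that by (simp add: T_dual)
    then have "v \<bullet> (A *v n) \<in> \<int>" using v by (auto simp: dual_lattice_def)
    then have "fourier (\<lambda>t. u' (t + v)) (A *v n) = fourier u' (A *v n)"
      by (simp add: fourier_translate cis_2pi_Ints)
    then show ?thesis
      by (simp add: L2_inner_gabor_atom L2_inner_commute[of "translate _ _" f'] u_def[abs_def] u'_def[abs_def])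
  qed
  have "((\<lambda>n. L2_inner f (translate \<tau> (modulate (A *v n) G)) * L2_inner (translate \<tau> (modulate (A *v n) H)) f')
    has_sum of_real T.covol * L2_inner u (\<lambda>t. u' (t + v))) int_vecs"
    by (rule has_sum_cong[THEN iffD2, OF coef 1])
  then show ?thesis by (simp only: inner v_def[symmetric])
qed

definition cross :: "real ^ 'm \<Rightarrow> real ^ 'm \<Rightarrow> complex" where
  "cross v s = (\<Sum>l=1..L. cnj (g l s) * h l (s + v))"

lemma cross_term_integrable:
  assumes "l \<in> {1..L}"
  shows "integrable lborel (\<lambda>s. cnj (g l s) * h l (s + v))"
  using Lp_2_mult_integrable[OF Lp_2_translate[OF h_Lp[OF assms], of v] g_Lp[OF assms]]
  by (simp add: mult.commute)

lemma cross_integrable: "integrable lborel (cross v)"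
  unfolding cross_def[abs_def] by (intro Bochner_Integration.integrable_sum cross_term_integrable)

lemma tile_product:
  assumes w: "w \<in> T.lat" "w' \<in> T.lat" and f: "T.tile_fun w f" and f': "T.tile_fun w' f'"
  shows "T.tile_fun w (\<lambda>t. f t * cnj (f' (t + v)))"
proof -
  have [measurable]: "f \<in> borel_measurable borel" "f' \<in> borel_measurable borel"
    using f f' by (auto simp: T.tile_fun_def)
  obtain B where B: "\<And>x. norm (f x) \<le> B" using f by (auto simp: T.tile_fun_def)
  obtain B' where B': "\<And>x. norm (f' x) \<le> B'" using f' by (auto simp: T.tile_fun_def)
  have "norm (f t * cnj (f' (t + v))) \<le> B * B'" for t
    using B[of t] B'[of "t + v"] order_trans[OF norm_ge_zero B] by (auto simp: norm_mult intro!: mult_mono)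
  then show ?thesis using f unfolding T.tile_fun_def by auto
qed

lemma tile_model_set_sum:
  assumes G: "integrable lborel G" and \<phi>: "T.tile_fun w \<phi>"
  shows "integrable lborel (\<lambda>x. \<phi> x * layer G 0 x)"
    and "((\<lambda>\<tau>. \<integral>x. \<phi> x * G (x - \<tau>) \<partial>lborel) has_sum (\<integral>x. \<phi> x * layer G 0 x \<partial>lborel)) (model_set lat \<Omega>)"
proof -
  obtain B where B: "\<And>x. norm (\<phi> x) \<le> B" using \<phi> by (auto simp: T.tile_fun_def)
  obtain r where r: "\<And>x. x \<in> T.cell \<Longrightarrow> norm x \<le> r" using T.bounded_cell by (auto simp: bounded_iff)
  have z: "\<phi> x = 0" if "x \<notin> cball w r" for x
  proof -
    have "x - w \<notin> T.cell" using r[of "x - w"] that by (auto simp: dist_norm norm_minus_commute)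
    then show ?thesis using \<phi> by (simp add: T.tile_fun_def)
  qed
  have m: "\<phi> \<in> borel_measurable borel" using \<phi> by (simp add: T.tile_fun_def)
  have c: "cball w r \<in> sets borel" by simp
  show "integrable lborel (\<lambda>x. \<phi> x * layer G 0 x)"
    by (rule model_set_sum_integral(1)[OF G m B bounded_cball c z])
  show "((\<lambda>\<tau>. \<integral>x. \<phi> x * G (x - \<tau>) \<partial>lborel) has_sum (\<integral>x. \<phi> x * layer G 0 x \<partial>lborel)) (model_set lat \<Omega>)"
    by (rule model_set_sum_integral(2)[OF G m B bounded_cball c z])
qed

lemma tile_mult_integrable:
  assumes \<phi>: "T.tile_fun w \<phi>" and G: "integrable lborel G"
  shows "integrable lborel (\<lambda>x. \<phi> x * G (x - \<tau>))"
proof -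
  obtain B where B: "\<And>x. norm (\<phi> x) \<le> B" using \<phi> by (auto simp: T.tile_fun_def)
  have [measurable]: "\<phi> \<in> borel_measurable borel" "G \<in> borel_measurable borel"
    using \<phi> G by (auto simp: T.tile_fun_def)
  have i: "integrable lborel (\<lambda>x. of_real B * G (x + - \<tau>))" using integrable_translate[OF G, of "- \<tau>"] by simp
  show ?thesis
    by (rule Bochner_Integration.integrable_bound[OF i])
       (use B order_trans[OF norm_ge_zero B] in \<open>auto simp: norm_mult intro!: mult_right_mono order_trans[OF B]\<close>)
qed

text \<open>The Bessel property makes the whole family summable, so the sum may be evaluated
  iteratively: over the modulations by Parseval's identity, over the model set by Fubini's theorem,
  and last over the finitely many windows.\<close>

lemma frame_form:
  assumes bessel: "bessel_sequence (gabor_index L (model_set lat \<Omega>)) (gabor g A)"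
      "bessel_sequence (gabor_index L (model_set lat \<Omega>)) (gabor h A)"
    and w: "w \<in> T.lat" "w' \<in> T.lat" and f: "T.tile_fun w f" and f': "T.tile_fun w' f'"
  shows "((\<lambda>j. L2_inner f (gabor g A j) * L2_inner (gabor h A j) f') has_sum
    of_real T.covol * (\<integral>t. (f t * cnj (f' (t + (w' - w)))) * layer (cross (w' - w)) 0 t \<partial>lborel))
    (gabor_index L (model_set lat \<Omega>))"
proof -
  define v where "v = w' - w"
  define \<phi> where "\<phi> t = f t * cnj (f' (t + v))" for t
  have \<phi>: "T.tile_fun w \<phi>" unfolding \<phi>_def by (rule tile_product[OF w f f'])
  define G where "G l s = cnj (g l s) * h l (s + v)" for l s
  have G: "integrable lborel (G l)" if "l \<in> {1..L}" for l
    unfolding G_def by (rule cross_term_integrable[OF that])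
  define F where "F = (\<lambda>j. L2_inner f (gabor g A j) * L2_inner (gabor h A j) f')"
  define c where "c l \<tau> = of_real T.covol * (\<integral>t. \<phi> t * G l (t - \<tau>) \<partial>lborel)" for l \<tau>
  define S where "S l = of_real T.covol * (\<integral>t. \<phi> t * layer (G l) 0 t \<partial>lborel)" for l
  obtain K where "\<And>f f'. f \<in> Lp 2 \<Longrightarrow> f' \<in> Lp 2 \<Longrightarrow>
    \<exists>s. ((\<lambda>j. L2_inner f (gabor g A j) * L2_inner (gabor h A j) f') has_sum s) (gabor_index L (model_set lat \<Omega>)) \<and>
        norm s \<le> K * (Lp_norm 2 f * Lp_norm 2 f')"
    by (rule Bessel_pair_has_sum[OF bessel]) (blast intro: that)
  from this[OF T.tile_fun_Lp_2[OF f] T.tile_fun_Lp_2[OF f']]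
  have summ: "F summable_on {1..L} \<times> (model_set lat \<Omega> \<times> int_vecs)"
    unfolding F_def gabor_index_def by (auto simp: summable_on_def)
  have inner: "((\<lambda>n. F (l, \<tau>, n)) has_sum c l \<tau>) int_vecs" if "l \<in> {1..L}" for l \<tau>
    using modulation_sum[OF w f f' g_Lp[OF that] h_Lp[OF that], of \<tau>]
    unfolding F_def gabor_def c_def \<phi>_def G_def v_def[symmetric] by simp
  have mid: "((\<lambda>\<tau>. c l \<tau>) has_sum S l) (model_set lat \<Omega>)" if "l \<in> {1..L}" for l
    unfolding c_def S_def by (intro has_sum_cmult_right tile_model_set_sum(2)[OF G[OF that] \<phi>])
  have slice: "((\<lambda>z. F (l, z)) has_sum S l) (model_set lat \<Omega> \<times> int_vecs)" if l: "l \<in> {1..L}" for l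
  proof (rule has_sum_SigmaI)
    show "((\<lambda>n. F (l, \<tau>, n)) has_sum c l \<tau>) int_vecs" for \<tau> by (rule inner[OF l])
    show "((\<lambda>\<tau>. c l \<tau>) has_sum S l) (model_set lat \<Omega>)" by (rule mid[OF l])
    have "(\<lambda>(l, z). F (l, z)) summable_on Sigma {1..L} (\<lambda>_. model_set lat \<Omega> \<times> int_vecs)" using summ by simp
    from summable_on_SigmaD1[OF this l] show "(\<lambda>z. F (l, z)) summable_on model_set lat \<Omega> \<times> int_vecs" .
  qed
  have "(F has_sum (\<Sum>l=1..L. S l)) ({1..L} \<times> (model_set lat \<Omega> \<times> int_vecs))"
    by (rule has_sum_SigmaI[OF slice _ summ]) (auto intro: has_sum_finite)
  \<comment> \<open>Additivity of \<open>layer\<close> in its first argument is safe only where the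
    series converge absolutely. Comparing two evaluations of one sum over the model set avoids
    exceptional points.\<close>
  moreover have "(\<Sum>l=1..L. S l) = of_real T.covol * (\<integral>t. \<phi> t * layer (cross v) 0 t \<partial>lborel)"
  proof (rule has_sum_unique)
    show "((\<lambda>\<tau>. \<Sum>l=1..L. c l \<tau>) has_sum (\<Sum>l=1..L. S l)) (model_set lat \<Omega>)"
      by (rule has_sum_finite_sum) (use mid in auto)
    have "(\<Sum>l=1..L. c l \<tau>) = of_real T.covol * (\<integral>t. \<phi> t * cross v (t - \<tau>) \<partial>lborel)" for \<tau>
    proof -
      have "(\<integral>t. \<phi> t * cross v (t - \<tau>) \<partial>lborel) = (\<integral>t. (\<Sum>l=1..L. \<phi> t * G l (t - \<tau>)) \<partial>lborel)"
        unfolding cross_def G_def sum_distrib_left ..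
      also have "\<dots> = (\<Sum>l=1..L. (\<integral>t. \<phi> t * G l (t - \<tau>) \<partial>lborel))"
        by (intro Bochner_Integration.integral_sum tile_mult_integrable[OF \<phi>] G)
      finally show ?thesis by (simp add: c_def sum_distrib_left)
    qed
    then show "((\<lambda>\<tau>. \<Sum>l=1..L. c l \<tau>) has_sum of_real T.covol * (\<integral>t. \<phi> t * layer (cross v) 0 t \<partial>lborel)) (model_set lat \<Omega>)"
      using has_sum_cmult_right[OF tile_model_set_sum(2)[OF cross_integrable \<phi>], of "of_real T.covol" v] by simp
  qed
  ultimately show ?thesis unfolding F_def gabor_index_def \<phi>_def v_def by simp
qed

lemma tile_fun_disjoint:
  assumes "w \<in> T.lat" "w' \<in> T.lat" "w \<noteq> w'" "T.tile_fun w f" "T.tile_fun w' f'"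
  shows "L2_inner f f' = 0"
proof -
  have "f t * cnj (f' t) = 0" for t
  proof (rule ccontr)
    assume "f t * cnj (f' t) \<noteq> 0"
    then have "t - w \<in> T.cell" "t - w' \<in> T.cell" using assms(4,5) by (auto simp: T.tile_fun_def)
    then show False using assms(1-3) by (simp add: T.in_cell_iff)
  qed
  then show ?thesis by (simp only: L2_inner_def integral_zero)
qed

text \<open>The value \<open>\<bar>det A\<bar>\<close> compensates the factor
  \<open>T.covol\<close>, its reciprocal, from Parseval's identity on a tile. A pair of tiles with
  different base points has inner product 0, hence the value 0 for nonzero shifts.\<close>

lemma dual_iff_layers:
  assumes bessel: "bessel_sequence (gabor_index L (model_set lat \<Omega>)) (gabor g A)"
      "bessel_sequence (gabor_index L (model_set lat \<Omega>)) (gabor h A)"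
  shows "dual_system (gabor_index L (model_set lat \<Omega>)) (gabor h A) (gabor g A) \<longleftrightarrow>
    (\<forall>v\<in>T.lat. AE t in lborel. layer (cross v) 0 t = (if v = 0 then of_real \<bar>det A\<bar> else 0))"
proof -
  let ?J = "gabor_index L (model_set lat \<Omega>)"
  let ?c = "\<lambda>v. if v = 0 then complex_of_real \<bar>det A\<bar> else 0"
  have gL: "gabor g A j \<in> Lp 2" and hL: "gabor h A j \<in> Lp 2" if "j \<in> ?J" for j
    using that g_Lp h_Lp by (auto simp: gabor_index_def gabor_def intro!: gabor_atom_Lp_2)
  have det: "det A \<noteq> 0" using invertible_A by (simp add: invertible_det_nz)
  have inner_eq: "of_real T.covol * (\<integral>t. (f t * cnj (f' (t + (w' - w)))) * ?c (w' - w) \<partial>lborel) = L2_inner f f'"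
    if w: "w \<in> T.lat" "w' \<in> T.lat" and f: "T.tile_fun w f" and f': "T.tile_fun w' f'" for w w' f f'
  proof (cases "w' = w")
    case True
    then show ?thesis using det by (simp add: T_covol L2_inner_def)
  next
    case False
    then have "L2_inner f f' = 0" "w' - w \<noteq> 0" using tile_fun_disjoint[OF w _ f f'] by simp_all
    then show ?thesis by (simp only: if_False mult_zero_right integral_zero)
  qed
  have weak_iff: "weak_dual ?J (gabor h A) (gabor g A) f f' \<longleftrightarrow>
      (\<integral>t. (f t * cnj (f' (t + (w' - w)))) * layer (cross (w' - w)) 0 t \<partial>lborel) =
      (\<integral>t. (f t * cnj (f' (t + (w' - w)))) * ?c (w' - w) \<partial>lborel)" (is "_ \<longleftrightarrow> ?l = ?r")
    if w: "w \<in> T.lat" "w' \<in> T.lat" and f: "T.tile_fun w f" and f': "T.tile_fun w' f'" for w w' f f'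
  proof -
    have "weak_dual ?J (gabor h A) (gabor g A) f f' \<longleftrightarrow> of_real T.covol * ?l = L2_inner f f'"
    proof
      assume "weak_dual ?J (gabor h A) (gabor g A) f f'"
      then show "of_real T.covol * ?l = L2_inner f f'"
        unfolding weak_dual_def by (rule has_sum_unique[OF frame_form[OF bessel w f f']])
    next
      assume "of_real T.covol * ?l = L2_inner f f'"
      then show "weak_dual ?J (gabor h A) (gabor g A) f f'"
        unfolding weak_dual_def using frame_form[OF bessel w f f'] by simp
    qed
    also have "\<dots> \<longleftrightarrow> of_real T.covol * ?l = of_real T.covol * ?r"
      by (simp only: inner_eq[OF w f f'])
    also have "\<dots> \<longleftrightarrow> ?l = ?r" using T.covol_pos by simp
    finally show ?thesis .
  qed
  have "dual_system ?J (gabor h A) (gabor g A) \<longleftrightarrow>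
    (\<forall>w\<in>T.lat. \<forall>w'\<in>T.lat. \<forall>f f'. T.tile_fun w f \<longrightarrow> T.tile_fun w' f' \<longrightarrow> weak_dual ?J (gabor h A) (gabor g A) f f')"
    by (rule T.dual_system_iff_tiles[OF bessel gL hL])
  also have "\<dots> \<longleftrightarrow> (\<forall>v\<in>T.lat. AE t in lborel. layer (cross v) 0 t = ?c v)"
  proof (rule iffI)
    assume R: "\<forall>v\<in>T.lat. AE t in lborel. layer (cross v) 0 t = ?c v"
    show "\<forall>w\<in>T.lat. \<forall>w'\<in>T.lat. \<forall>f f'. T.tile_fun w f \<longrightarrow> T.tile_fun w' f' \<longrightarrow> weak_dual ?J (gabor h A) (gabor g A) f f'"
    proof (rule ballI, rule ballI, rule allI, rule allI, rule impI, rule impI)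
      fix w w' f f' assume w: "w \<in> T.lat" "w' \<in> T.lat" and f: "T.tile_fun w f" and f': "T.tile_fun w' f'"
      have AE: "AE t in lborel. layer (cross (w' - w)) 0 t = ?c (w' - w)"
        using R T.lat_diff[OF w(2,1)] by blast
      have [measurable]: "f \<in> borel_measurable borel" "f' \<in> borel_measurable borel" "cross (w' - w) \<in> borel_measurable borel"
        using f f' cross_integrable[of "w' - w"] by (auto simp: T.tile_fun_def)
      show "weak_dual ?J (gabor h A) (gabor g A) f f'"
        unfolding weak_iff[OF w f f']
      proof (rule integral_cong_AE)
        show "AE t in lborel. (f t * cnj (f' (t + (w' - w)))) * layer (cross (w' - w)) 0 t = (f t * cnj (f' (t + (w' - w)))) * ?c (w' - w)"
          using AE by eventually_elim simp
      qed measurable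
    qed
  next
    assume weak: "\<forall>w\<in>T.lat. \<forall>w'\<in>T.lat. \<forall>f f'. T.tile_fun w f \<longrightarrow> T.tile_fun w' f' \<longrightarrow> weak_dual ?J (gabor h A) (gabor g A) f f'"
    show "\<forall>v\<in>T.lat. AE t in lborel. layer (cross v) 0 t = ?c v"
    proof
      fix v assume v: "v \<in> T.lat"
      define D where "D t = layer (cross v) 0 t - ?c v" for t
      have [measurable]: "cross v \<in> borel_measurable borel" using cross_integrable[of v] by auto
      have [measurable]: "D \<in> borel_measurable borel" unfolding D_def[abs_def] by measurable
      have tile: "AE t in lborel. t + - w \<in> T.cell \<longrightarrow> layer (cross v) 0 t = ?c v" if w: "w \<in> T.lat" for w
      proof -
        \<comment> \<open>The conjugate phase of \<open>D\<close> on the tile, so that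
          \<open>f * D\<close> is the modulus of \<open>D\<close> there. Where \<open>D\<close>
          vanishes the quotient is 0 by convention, in accordance with this.\<close>
        define f where "f t = cnj (D t) / of_real (norm (D t)) * indicator T.cell (t - w)" for t
        \<comment> \<open>Shifted back by \<open>v\<close>, this is the indicator of the tile at
          \<open>w\<close> and leaves \<open>f\<close> unchanged in the product.\<close>
        define f' where "f' t = (indicator T.cell (t - (w + v)) :: complex)" for t
        have wv: "w + v \<in> T.lat" by (rule T.lat_add[OF w v])
        have f: "T.tile_fun w f"
          unfolding T.tile_fun_def
        proof (intro conjI)
          show "f \<in> borel_measurable borel" unfolding f_def[abs_def] by measurable
          have "norm (f t) \<le> 1" for t by (auto simp: f_def norm_mult norm_divide indicator_def)
          then show "\<exists>B. \<forall>t. norm (f t) \<le> B" by blast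
        qed (simp add: f_def)
        have f': "T.tile_fun (w + v) f'"
          unfolding T.tile_fun_def
        proof (intro conjI)
          show "f' \<in> borel_measurable borel" unfolding f'_def[abs_def] by measurable
          have "norm (f' t) \<le> 1" for t by (auto simp: f'_def indicator_def)
          then show "\<exists>B. \<forall>t. norm (f' t) \<le> B" by blast
        qed (simp add: f'_def)
        have ff': "f t * cnj (f' (t + (w + v - w))) = f t" for t
          by (simp add: f_def f'_def indicator_def)
        have "weak_dual ?J (gabor h A) (gabor g A) f f'" using weak w wv f f' by blast
        then have eq: "(\<integral>t. f t * layer (cross v) 0 t \<partial>lborel) = (\<integral>t. f t * ?c v \<partial>lborel)"
          unfolding weak_iff[OF w wv f f'] ff' by simp
        have i1: "integrable lborel (\<lambda>t. f t * layer (cross v) 0 t)"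
          by (rule tile_model_set_sum(1)[OF cross_integrable f])
        have i2: "integrable lborel (\<lambda>t. f t * ?c v)"
        proof -
          have "integrable lborel (\<lambda>t. indicat_real T.cell (t - w))" by (rule T.integrable_tile)
          then have "integrable lborel f"
            by (rule Bochner_Integration.integrable_bound)
               (use f in \<open>auto simp: T.tile_fun_def f_def norm_mult norm_divide indicator_def\<close>)
          then show ?thesis by simp
        qed
        have fD: "f t * D t = of_real (norm (D t) * indicator T.cell (t - w))" for t
        proof (cases "D t = 0")
          case False
          have "cnj (D t) * D t = of_real (norm (D t)) * of_real (norm (D t))"
            using complex_norm_square[of "D t"] by (simp add: power2_eq_square mult.commute)
          then show ?thesis using False by (auto simp: f_def indicator_def)
        qed (simp add: f_def)
        have i3: "integrable lborel (\<lambda>t. f t * D t)"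
          unfolding D_def right_diff_distrib by (rule Bochner_Integration.integrable_diff[OF i1 i2])
        have "(\<integral>t. f t * D t \<partial>lborel) = 0"
          unfolding D_def right_diff_distrib using eq by (simp add: i1 i2)
        then have "complex_of_real (\<integral>t. norm (D t) * indicator T.cell (t - w) \<partial>lborel) = 0"
          unfolding fD by (simp only: integral_complex_of_real)
        then have "(\<integral>t. norm (D t) * indicator T.cell (t - w) \<partial>lborel) = 0" by simp
        moreover have "integrable lborel (\<lambda>t. norm (D t) * indicator T.cell (t - w))"
          using integrable_Re[OF i3] unfolding fD by simp
        ultimately have "AE t in lborel. norm (D t) * indicator T.cell (t - w) = 0"
          by (subst (asm) integral_nonneg_eq_0_iff_AE) auto
        then show ?thesis
          by eventually_elim (auto simp: D_def indicator_def split: if_splits)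
      qed
      have "AE t in lborel. \<forall>w\<in>T.lat. t + - w \<in> T.cell \<longrightarrow> layer (cross v) 0 t = ?c v"
        using tile by (subst AE_ball_countable[OF T.countable_lat]) blast
      then show "AE t in lborel. layer (cross v) 0 t = ?c v"
      proof eventually_elim
        case (elim t)
        from bspec[OF elim T.base_pt_lat[of t]] T.base_pt_cell[of t] show ?case by simp
      qed
    qed
  qed
  finally show ?thesis .
qed

text \<open>Commuting the modulation past the translation costs a phase. A translation by
  \<open>b\<close> becomes the shift \<open>- b\<close> inside \<open>cross\<close>, and the
  frequency changes sign because \<open>fourier\<close> has a negative exponent.\<close>

lemma L2_inner_shifted:
  "(\<Sum>l=1..L. L2_inner (translate b (modulate \<beta> (h l))) (g l)) =
    cis (- (2 * pi * (\<beta> \<bullet> b))) * fourier (cross (- b)) (- \<beta>)"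
proof -
  have coef: "L2_inner (translate b (modulate \<beta> (h l))) (g l) =
    cis (- (2 * pi * (\<beta> \<bullet> b))) * fourier (\<lambda>s. cnj (g l s) * h l (s + - b)) (- \<beta>)" for l
  proof -
    have "cis (2 * pi * (\<beta> \<bullet> (t - b))) = cis (- (2 * pi * (\<beta> \<bullet> b))) * cis (- (2 * pi * (t \<bullet> (- \<beta>))))" for t
      by (simp add: cis_mult inner_diff_right right_diff_distrib inner_commute)
    then have "L2_inner (translate b (modulate \<beta> (h l))) (g l) =
      (\<integral>t. cis (- (2 * pi * (\<beta> \<bullet> b))) * ((cnj (g l t) * h l (t + - b)) * cis (- (2 * pi * (t \<bullet> (- \<beta>))))) \<partial>lborel)"
      unfolding L2_inner_def translate_def modulate_def
      by (intro Bochner_Integration.integral_cong refl) (simp add: mult_ac)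
    also have "\<dots> = cis (- (2 * pi * (\<beta> \<bullet> b))) * fourier (\<lambda>s. cnj (g l s) * h l (s + - b)) (- \<beta>)"
      unfolding fourier_def by (rule integral_mult_right_zero)
    finally show ?thesis .
  qed
  have "fourier (cross (- b)) (- \<beta>) = (\<Sum>l=1..L. fourier (\<lambda>s. cnj (g l s) * h l (s + - b)) (- \<beta>))"
    unfolding fourier_def cross_def sum_distrib_right
    by (intro Bochner_Integration.integral_sum fourier_integrable cross_term_integrable)
  then show ?thesis by (simp only: coef sum_distrib_left)
qed

text \<open>Both \<open>T.lat\<close> and the dual lattice of \<Gamma> are symmetric under negation,
  which absorbs the signs in \<open>L2_inner_shifted\<close>. What remains is to compare constants
  and to dispose of the phase.\<close>

theorem dual_iff_coefficients:
  assumes bessel: "bessel_sequence (gabor_index L (model_set lat \<Omega>)) (gabor g A)"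
      "bessel_sequence (gabor_index L (model_set lat \<Omega>)) (gabor h A)"
    and \<epsilon>: "0 < \<epsilon>" "\<epsilon> < 1"
  shows "dual_system (gabor_index L (model_set lat \<Omega>)) (gabor h A) (gabor g A) \<longleftrightarrow>
    (\<forall>\<eta>\<in>dual_lattice lat. \<forall>v\<in>int_vecs.
       of_real (point_density (model_set lat \<Omega>)) * of_real (inverse \<bar>det A\<bar>) * Phi \<Omega> \<epsilon> (- snd \<eta>) *
         (\<Sum>l = 1..L. L2_inner
            (translate (matrix_inv (transpose A) *v v) (modulate (fst \<eta>) (h l))) (g l))
       = (if \<eta> = 0 \<and> v = 0 then 1 else 0))"
proof -
  let ?B = "matrix_inv (transpose A)"
  let ?w = "fourier (indicator \<Omega>)"
  have det: "det A \<noteq> 0" using invertible_A by (simp add: invertible_det_nz)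
  \<comment> \<open>Density, inverse determinant and the denominator of \<open>Phi\<close> combine
    to \<open>1 / \<kappa>\<close>.\<close>
  define \<kappa> where "\<kappa> = covol * \<bar>det A\<bar>"
  have \<kappa>: "\<kappa> \<noteq> 0" using det covol_pos by (simp add: \<kappa>_def)
  have B0: "?B *v v = 0 \<longleftrightarrow> v = 0" for v
    by (metis A_inverse(3) matrix_vector_mult_0_right)
  have pt: "of_real (point_density (model_set lat \<Omega>)) * of_real (inverse \<bar>det A\<bar>) * Phi \<Omega> \<epsilon> (- snd \<eta>) *
         (\<Sum>l = 1..L. L2_inner (translate (?B *v v) (modulate (fst \<eta>) (h l))) (g l))
       = (if \<eta> = 0 \<and> v = 0 then 1 else 0) \<longleftrightarrow>
      fourier (cross (- (?B *v v))) (fst (- \<eta>)) * ?w (snd (- \<eta>)) =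
        (if - \<eta> = 0 then (if - (?B *v v) = 0 then of_real \<bar>det A\<bar> else 0) * of_real covol else 0)"
    (is "?lhs = ?\<delta> \<longleftrightarrow> ?X = ?rhs") for \<eta> v
  proof -
    let ?ph = "cis (- (2 * pi * (fst \<eta> \<bullet> (?B *v v))))"
    have Phi: "Phi \<Omega> \<epsilon> (- snd \<eta>) = ?w (- snd \<eta>) / of_real (2 * a)"
      unfolding \<Omega>_def by (rule Phi_eq[OF a_pos \<epsilon>])
    have "?lhs = of_real (2 * a / covol) * of_real (inverse \<bar>det A\<bar>) * (?w (- snd \<eta>) / of_real (2 * a)) *
        (?ph * fourier (cross (- (?B *v v))) (- fst \<eta>))"
      unfolding L2_inner_shifted point_density_model_set Phi ..
    also have "\<dots> = ?ph * ?X / of_real \<kappa>"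
      using a_pos covol_pos det by (simp add: \<kappa>_def field_simps)
    finally have "?lhs = ?ph * ?X / of_real \<kappa>" .
    then have "?lhs = ?\<delta> \<longleftrightarrow> ?ph * ?X = ?\<delta> * of_real \<kappa>" using \<kappa> by (simp add: divide_eq_eq)
    \<comment> \<open>The phase cancels: if the right-hand side is nonzero, both indices are 0 and
      the phase is 1; otherwise the right-hand side is 0 and a nonzero factor is immaterial.\<close>
    also have "\<dots> \<longleftrightarrow> ?X = ?\<delta> * of_real \<kappa>"
    proof (cases "\<eta> = 0 \<and> v = 0")
      case True
      then show ?thesis by simp
    next
      case False
      then show ?thesis by (auto simp: cis_neq_zero)
    qed
    also have "?\<delta> * of_real \<kappa> = ?rhs"
      by (simp add: B0 \<kappa>_def)
    finally show ?thesis .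
  qed
  have uminus_lat: "(\<forall>v\<in>T.lat. Q v) \<longleftrightarrow> (\<forall>v\<in>int_vecs. Q (- (?B *v v)))" for Q
  proof -
    have "(\<forall>v\<in>T.lat. Q v) \<longleftrightarrow> (\<forall>v\<in>T.lat. Q (- v))" using T.lat_uminus by (metis minus_minus)
    then show ?thesis unfolding T_lat_eq by simp
  qed
  have uminus_dual: "(\<forall>\<eta>\<in>dual_lattice lat. Q \<eta>) \<longleftrightarrow> (\<forall>\<eta>\<in>dual_lattice lat. Q (- \<eta>))" for Q
    using dual_uminus by (metis minus_minus)
  have "dual_system (gabor_index L (model_set lat \<Omega>)) (gabor h A) (gabor g A) \<longleftrightarrow>
    (\<forall>v\<in>T.lat. \<forall>\<eta>\<in>dual_lattice lat. fourier (cross v) (fst \<eta>) * ?w (snd \<eta>) =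
      (if \<eta> = 0 then (if v = 0 then of_real \<bar>det A\<bar> else 0) * of_real covol else 0))"
    unfolding dual_iff_layers[OF bessel] by (simp only: layer_fourier_iff[OF cross_integrable])
  also have "\<dots> \<longleftrightarrow> (\<forall>v\<in>int_vecs. \<forall>\<eta>\<in>dual_lattice lat. fourier (cross (- (?B *v v))) (fst (- \<eta>)) * ?w (snd (- \<eta>)) =
      (if - \<eta> = 0 then (if - (?B *v v) = 0 then of_real \<bar>det A\<bar> else 0) * of_real covol else 0))"
    by (subst uminus_lat, subst uminus_dual) (rule refl)
  finally show ?thesis unfolding pt by blast
qed

end

theorem theorem5p4:
  fixes \<Gamma> :: "((real ^ 'm) \<times> real) set"
    and \<Omega> :: "real set"
    and \<epsilon> :: real
    and A :: "real ^ 'm ^ 'm"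
    and L :: nat
    and g h :: "nat \<Rightarrow> real ^ 'm \<Rightarrow> complex"
  assumes lattice: "is_lattice \<Gamma>"
    and inj1: "inj_on fst \<Gamma>" and dense1: "closure (fst ` \<Gamma>) = UNIV"
    and inj2: "inj_on snd \<Gamma>" and dense2: "closure (snd ` \<Gamma>) = UNIV"
    and window: "compact \<Omega>" "is_interval \<Omega>" "interior \<Omega> \<noteq> {}"
    and symmetric: "uminus ` \<Omega> = \<Omega>"
    and generic: "snd ` \<Gamma> \<inter> frontier \<Omega> = {}"
    and generic_dual: "snd ` dual_lattice \<Gamma> \<inter> frontier \<Omega> = {}"
    and eps: "0 < \<epsilon>" "\<epsilon> < 1"
    and A: "invertible A"
    and g: "\<And>l. l \<in> {1..L} \<Longrightarrow> g l \<in> amalgam 2 1"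
    and h: "\<And>l. l \<in> {1..L} \<Longrightarrow> h l \<in> amalgam 2 1"
    and bessel_g: "bessel_sequence (gabor_index L (model_set \<Gamma> \<Omega>)) (gabor g A)"
    and bessel_h: "bessel_sequence (gabor_index L (model_set \<Gamma> \<Omega>)) (gabor h A)"
  shows "dual_system (gabor_index L (model_set \<Gamma> \<Omega>)) (gabor h A) (gabor g A) \<longleftrightarrow>
    (\<forall>\<eta>\<in>dual_lattice \<Gamma>. \<forall>v\<in>int_vecs.
       of_real (point_density (model_set \<Gamma> \<Omega>)) * of_real (inverse \<bar>det A\<bar>) * Phi \<Omega> \<epsilon> (- snd \<eta>) *
         (\<Sum>l = 1..L. L2_inner
            (translate (matrix_inv (transpose A) *v v) (modulate (fst \<eta>) (h l))) (g l))
       = (if \<eta> = 0 \<and> v = 0 then 1 else 0))"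
proof -
  obtain C :: "(real ^ 'm) \<times> real \<Rightarrow> (real ^ 'm) \<times> real" where C: "linear C" "inj C" "\<Gamma> = {x. \<forall>i\<in>Basis. C x \<bullet> i \<in> \<int>}"
    by (rule is_lattice_coords[OF lattice]) (blast intro: that)
  obtain a where a: "0 < a" "\<Omega> = {- a..a}"
    by (rule symmetric_window[OF window symmetric]) (blast intro: that)
  have fr: "frontier \<Omega> = {- a, a}" using a by (auto simp: frontier_def interior_atLeastAtMost_real)
  interpret C: lattice_coords C by (rule lattice_coords.intro[OF C(1,2)])
  have \<Gamma>: "C.lat = \<Gamma>" by (simp add: C.lat_def C(3))
  have gen: "snd ` \<Gamma> \<inter> {- a, a} = {}" using generic by (simp only: fr)
  interpret gabor_pair C a A L g h
    by unfold_locales (use a(1) inj1 dense2 gen A amalgam_2_1_subset_Lp_2[OF g] amalgam_2_1_subset_Lp_2[OF h] in \<open>simp_all only: \<Gamma>\<close>)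
  have "C.lat = \<Gamma>" "cut_project.\<Omega> a = \<Omega>" by (simp_all add: \<Gamma> \<Omega>_def a)
  with dual_iff_coefficients[OF _ _ eps] bessel_g bessel_h show ?thesis by simp
qed

end
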